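(* Let $F$ be a field of characteristic zero, and let $\mathrm{ev}_X:\mathrm{NSym}\to A_X$ and $\mathrm{ev}_Y:\mathrm{QSym}\to A_Y$ be algebra morphisms into commutative $F$-algebras; write $f[X]=\mathrm{ev}_X(f)$, $g[Y]=\mathrm{ev}_Y(g)$. Then for all compositions $\lambda,\eta$, $$\mathcal E^{\mathrm{NQ}}[X|Y]\;\mathbf s_{\lambda/\eta}[X]=\sum_{\rho,\mu}S^\vee(\mathcal S_{\eta/\mu})[Y]\;\mathcal S_{\rho/\lambda}[Y]\;\mathbf s_{\rho/\mu}[X],\qquad \mathcal E^{\mathrm{NQ}}[X|Y]=\sum_{\alpha}\mathbf s_\alpha[X]\,\mathcal S_\alpha[Y],$$ where $\rho,\mu,\alpha$ run over all compositions (including the empty one).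
   Context: $\mathrm{NSym}=F\langle H_1,H_2,\dots\rangle$ is the Hopf algebra of noncommutative symmetric functions, $\Delta(H_r)=\sum_{i+j=r}H_i\otimes H_j$ ($H_0=1$); $\mathrm{QSym}$ is the (commutative) Hopf algebra of quasisymmetric functions, with coproduct $\Delta^\vee$ and antipode $S^\vee$; they are graded dual via $\langle H_\alpha,M_\beta\rangle=\delta_{\alpha\beta}$, where $H_\alpha=H_{\alpha_1}H_{\alpha_2}\cdots$ and $M_\beta$ is the monomial basis. $\mathcal S_\alpha$ is the quasisymmetric Schur function of Haglund--Luoto--Mason--van Willigenburg: $\mathcal S_\alpha=\sum_Tx^T$ over all fillings $T$ of the diagram of $\alpha$ (row $i$ from the top has $\alpha_i$ left-justified boxes) by positive integers such that rows weakly decrease left to right, the first column strictly increases top to bottom, and, extending $T$ by zeros to a rectangle, for $i<j$ and $c\ge2$: $T(j,c)\ne0$ and $T(j,c)\ge T(i,c)$ imply $T(j,c)>T(i,c-1)$. The noncommutative Schur functions $\mathbf s_\alpha\in\mathrm{NSym}$ form the dual basis: $\langle\mathbf s_\alpha,\mathcal S_\beta\rangle=\delta_{\alpha\beta}$. Skew elements are defined by $\Delta(\mathbf s_\lambda)=\sum_\eta\mathbf s_{\lambda/\eta}\otimes\mathbf s_\eta$ and $\Delta^\vee(\mathcal S_\lambda)=\sum_\eta\mathcal S_{\lambda/\eta}\otimes\mathcal S_\eta$. Infinite sums are formal and read degreewise: the identity is the image under $\mathrm{ev}_X\otimes\mathrm{ev}_Y$, applied to each total-degree component, of an identity in $\prod_n(\mathrm{NSym}\otimes\mathrm{QSym})_n$.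 *)

theory Defs
  imports Complex_Main "HOL-Library.Poly_Mapping" "HOL-Library.Product_Plus"
begin

section \<open>Compositions\<close>

typedef comp = "{xs :: nat list. 0 \<notin> set xs}"
  morphisms parts Abs_comp
  by (rule exI[of _ "[]"]) simp

setup_lifting type_definition_comp

instantiation comp :: monoid_add
begin

lift_definition zero_comp :: comp is "[]" by simp
lift_definition plus_comp :: "comp \<Rightarrow> comp \<Rightarrow> comp" is "(@)" by simp

instance by standard (transfer; simp)+

end

definition csize :: "comp \<Rightarrow> nat" where
  "csize \<alpha> = sum_list (parts \<alpha>)"

section \<open>Monomials and power series\<close>

text \<open>A monomial in \<open>x\<^sub>1, x\<^sub>2, \<dots>\<close> is its exponent vector; the variable \<open>x\<^sub>v\<close> with \<open>v \<ge> 1\<close>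
  has index \<open>v - 1\<close>. A power series is its coefficient function.\<close>

type_synonym mon = "nat \<Rightarrow>\<^sub>0 nat"

definition mdeg :: "mon \<Rightarrow> nat" where
  "mdeg m = (\<Sum>v\<in>Poly_Mapping.keys m. Poly_Mapping.lookup m v)"

text \<open>The nonzero exponents, listed by increasing variable index:
  \<open>exps (x\<^bsub>i1\<^esub>\<^bsup>a1\<^esup> \<cdots> x\<^bsub>ik\<^esub>\<^bsup>ak\<^esup>) = [a1, \<dots>, ak]\<close> for \<open>i1 < \<cdots> < ik\<close> and all \<open>aj > 0\<close>.\<close>

definition exps :: "mon \<Rightarrow> nat list" where
  "exps m = map (Poly_Mapping.lookup m) (sorted_list_of_set (Poly_Mapping.keys m))"

lemma exps_pos: "0 \<notin> set (exps m)"
  by (auto simp: exps_def in_keys_iff)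

lemma mdeg_exps: "mdeg m = sum_list (exps m)"
  by (simp add: mdeg_def exps_def sum_list_distinct_conv_sum_set)

lemma mdeg_superset:
  assumes "finite A" "Poly_Mapping.keys m \<subseteq> A"
  shows "mdeg m = (\<Sum>v\<in>A. Poly_Mapping.lookup m v)"
  unfolding mdeg_def using assms by (intro sum.mono_neutral_left) (auto simp: in_keys_iff)

lemma mdeg_add: "mdeg (a + b) = mdeg a + mdeg b"
proof -
  let ?A = "Poly_Mapping.keys a \<union> Poly_Mapping.keys b"
  have "mdeg (a + b) = (\<Sum>v\<in>?A. Poly_Mapping.lookup (a + b) v)"
    by (rule mdeg_superset) (use Poly_Mapping.keys_add[of a b] in auto)
  also have "\<dots> = (\<Sum>v\<in>?A. Poly_Mapping.lookup a v) + (\<Sum>v\<in>?A. Poly_Mapping.lookup b v)"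
    by (simp add: lookup_add sum.distrib)
  also have "\<dots> = mdeg a + mdeg b"
    by (simp add: mdeg_superset[of ?A a] mdeg_superset[of ?A b])
  finally show ?thesis .
qed

lemma mdeg_0: "mdeg 0 = 0"
  by (simp add: mdeg_def)

lemma mdeg_sum: "mdeg (sum f A) = (\<Sum>x\<in>A. mdeg (f x))"
  by (induction A rule: infinite_finite_induct) (auto simp: mdeg_add mdeg_0)

lemma finite_splits: "finite {(a, b). a + b = (m :: mon)}"
proof -
  let ?K = "Poly_Mapping.keys m"
  let ?B = "{f. \<forall>v. (v \<in> ?K \<longrightarrow> f v \<in> {..mdeg m}) \<and> (v \<notin> ?K \<longrightarrow> f v = (0::nat))}"
  have fB: "finite ?B" by (intro finite_set_of_finite_funs) auto
  have sub: "Poly_Mapping.lookup a \<in> ?B" if "a + b = m" for a b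
  proof -
    have *: "Poly_Mapping.lookup a v \<le> Poly_Mapping.lookup m v" for v using that by (auto simp: lookup_add)
    have "Poly_Mapping.lookup m v \<le> mdeg m" if "v \<in> ?K" for v
      unfolding mdeg_def using that by (intro member_le_sum) auto
    then have "Poly_Mapping.lookup a v \<le> mdeg m" if "v \<in> ?K" for v
      using *[of v] that by (meson order_trans)
    moreover have "Poly_Mapping.lookup a v = 0" if "v \<notin> ?K" for v
      using *[of v] that by (simp add: in_keys_iff)
    ultimately show ?thesis by auto
  qed
  have fA: "finite {a. Poly_Mapping.lookup a \<in> ?B}"
    using finite_vimageI[OF fB, of Poly_Mapping.lookup] by (simp add: vimage_def inj_on_def poly_mapping_eqI)
  have "{(a, b). a + b = m} \<subseteq> {a. Poly_Mapping.lookup a \<in> ?B} \<times> {a. Poly_Mapping.lookup a \<in> ?B}"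
  proof
    fix p assume "p \<in> {(a, b). a + b = m}"
    then obtain a b where "p = (a, b)" "a + b = m" "b + a = m" by (auto simp: add.commute)
    then show "p \<in> {a. Poly_Mapping.lookup a \<in> ?B} \<times> {a. Poly_Mapping.lookup a \<in> ?B}"
      using sub[of a b] sub[of b a] by blast
  qed
  then show ?thesis using fA by (meson finite_SigmaI finite_subset)
qed

definition psmult :: "(mon \<Rightarrow> 'f) \<Rightarrow> (mon \<Rightarrow> 'f) \<Rightarrow> mon \<Rightarrow> 'f::comm_ring_1" where
  "psmult f g m = (\<Sum>(a, b) | a + b = m. f a * g b)"

lemma psmult_commute: "psmult f g = psmult g f"
proof
  fix m
  show "psmult f g m = psmult g f m"
    unfolding psmult_def
    by (rule sum.reindex_bij_witness[of _ prod.swap prod.swap]) (auto simp: algebra_simps)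
qed

lemma psmult_assoc: "psmult (psmult f g) h = psmult f (psmult g h)"
proof
  fix m
  have "psmult (psmult f g) h m
      = (\<Sum>p\<in>{(a, b). a + b = m}. \<Sum>q\<in>{(a, b). a + b = fst p}. f (fst q) * g (snd q) * h (snd p))"
    by (simp add: psmult_def case_prod_unfold sum_distrib_right)
  also have "\<dots> = (\<Sum>(p, q)\<in>(SIGMA p:{(a, b). a + b = m}. {(a, b). a + b = fst p}).
                 f (fst q) * g (snd q) * h (snd p))"
    by (rule sum.Sigma) (auto intro: finite_splits)
  also have "\<dots> = (\<Sum>(p, q)\<in>(SIGMA p:{(a, b). a + b = m}. {(a, b). a + b = snd p}).
                 f (fst p) * (g (fst q) * h (snd q)))"
    by (rule sum.reindex_bij_witness[of _
          "\<lambda>(p, q). ((fst p + fst q, snd q), (fst p, fst q))"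
          "\<lambda>(p, q). ((fst q, snd q + snd p), (snd q, snd p))"])
       (auto simp: algebra_simps)
  also have "\<dots> = (\<Sum>p\<in>{(a, b). a + b = m}. \<Sum>q\<in>{(a, b). a + b = snd p}. f (fst p) * (g (fst q) * h (snd q)))"
    by (rule sum.Sigma[symmetric]) (auto intro: finite_splits)
  also have "\<dots> = psmult f (psmult g h) m"
    by (simp add: psmult_def case_prod_unfold sum_distrib_left)
  finally show "psmult (psmult f g) h m = psmult f (psmult g h) m" .
qed

lemma psmult_one: "psmult (\<lambda>m. if m = 0 then 1 else 0) g = g"
proof
  fix m
  have "psmult (\<lambda>m. if m = 0 then 1 else 0) g m
      = (\<Sum>(a, b)\<in>{(0 :: mon, m)}. (if a = 0 then 1 else 0) * g b)"
    unfolding psmult_def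
    by (rule sum.mono_neutral_right) (auto intro: finite_splits split: if_splits)
  then show "psmult (\<lambda>m. if m = 0 then 1 else 0) g m = g m" by simp
qed

lemma psmult_add: "psmult (\<lambda>m. f m + g m) h = (\<lambda>m. psmult f h m + psmult g h m)"
  by (simp add: psmult_def fun_eq_iff case_prod_unfold distrib_right sum.distrib)

section \<open>Quasisymmetric functions\<close>

text \<open>Power series of bounded degree in which the coefficient of a monomial depends only on its
  sequence of nonzero exponents.\<close>

definition quasisym :: "(mon \<Rightarrow> 'f::zero) \<Rightarrow> bool" where
  "quasisym f \<longleftrightarrow> (\<exists>d. \<forall>m. f m \<noteq> 0 \<longrightarrow> mdeg m \<le> d) \<and>
     (\<forall>m m'. exps m = exps m' \<longrightarrow> f m = f m')"

lemma quasisymI: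
  assumes b: "\<And>m. f m \<noteq> 0 \<Longrightarrow> mdeg m \<le> d"
    and e: "\<And>m m'. exps m = exps m' \<Longrightarrow> f m = f m'"
  shows "quasisym f"
  unfolding quasisym_def
proof (rule conjI)
  show "\<exists>d. \<forall>m. f m \<noteq> 0 \<longrightarrow> mdeg m \<le> d"
    by (rule exI[of _ d]) (rule allI, rule impI, rule b)
  show "\<forall>m m'. exps m = exps m' \<longrightarrow> f m = f m'"
    by (rule allI, rule allI, rule impI, rule e)
qed

lemma quasisym_bound: "quasisym f \<Longrightarrow> \<exists>d. \<forall>m. f m \<noteq> 0 \<longrightarrow> mdeg m \<le> d"
  unfolding quasisym_def by (erule conjunct1)

lemma quasisym_eq:
  assumes "quasisym f" "exps m = exps m'"
  shows "f m = f m'"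
  by (rule assms(1)[unfolded quasisym_def, THEN conjunct2, rule_format, OF assms(2)])

lemma exps_superset:
  assumes "sorted xs" "distinct xs" "Poly_Mapping.keys m \<subseteq> set xs"
  shows "exps m = filter (\<lambda>e. e \<noteq> 0) (map (Poly_Mapping.lookup m) xs)"
proof -
  let ?ys = "filter (\<lambda>x. Poly_Mapping.lookup m x \<noteq> 0) xs"
  have "set ?ys = Poly_Mapping.keys m" using assms(3) by (auto simp: in_keys_iff)
  moreover have "sorted ?ys" "distinct ?ys" using assms(1,2) by (auto simp: sorted_wrt_filter)
  ultimately have "sorted_list_of_set (Poly_Mapping.keys m) = ?ys"
    by (metis sorted_list_of_set.idem_if_sorted_distinct)
  then show ?thesis by (simp add: exps_def filter_map comp_def)
qed

lemma psmult_exps: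
  assumes f: "\<And>m m'. exps m = exps m' \<Longrightarrow> f m = f m'"
      and g: "\<And>m m'. exps m = exps m' \<Longrightarrow> g m = g m'"
      and e: "exps m = exps m'"
  shows "psmult f g m = psmult f g m'"
proof -
  define F where "F = (\<lambda>u. f (SOME a. exps a = u))"
  define G where "G = (\<lambda>u. g (SOME a. exps a = u))"
  have F: "f a = F (exps a)" for a
    unfolding F_def by (rule f) (metis (mono_tags, lifting) someI)
  have G: "g a = G (exps a)" for a
    unfolding G_def by (rule g) (metis (mono_tags, lifting) someI)
  let ?nz = "filter (\<lambda>e. e \<noteq> (0::nat))"
  have main: "psmult f g m = (\<Sum>(u, v) | length u = length (exps m) \<and> length v = length (exps m) \<and>
      map2 (+) u v = exps m. F (?nz u) * G (?nz v))" for m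
  proof -
    define xs where "xs = sorted_list_of_set (Poly_Mapping.keys m)"
    have xs: "sorted xs" "distinct xs" "set xs = Poly_Mapping.keys m"
      by (auto simp: xs_def)
    have em: "exps m = map (Poly_Mapping.lookup m) xs" by (simp add: exps_def xs_def)
    define mk where "mk = (\<lambda>u :: nat list. \<Sum>i<length xs. Poly_Mapping.single (xs ! i) (u ! i))"
    have lk: "Poly_Mapping.lookup (mk u) (xs ! i) = u ! i" if "i < length xs" for u i
    proof -
      have "Poly_Mapping.lookup (mk u) (xs ! i) = (\<Sum>k<length xs. if k = i then u ! k else 0)"
        unfolding mk_def lookup_sum
        using that xs(2) by (intro sum.cong) (auto simp: lookup_single when_def nth_eq_iff_index_eq)
      then show ?thesis using that by simp
    qed
    have lk0: "Poly_Mapping.lookup (mk u) v = 0" if "v \<notin> set xs" for u v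
      
    proof -
      have "xs ! i \<noteq> v" if "i < length xs" for i using that \<open>v \<notin> set xs\<close> nth_mem by blast
      then show ?thesis unfolding mk_def lookup_sum by (intro sum.neutral) (simp add: lookup_single)
    qed
    have mlk: "map (Poly_Mapping.lookup (mk u)) xs = u" if "length u = length xs" for u
      using that by (intro nth_equalityI) (simp_all add: lk)
    have keys_split: "Poly_Mapping.keys a \<subseteq> set xs" "Poly_Mapping.keys b \<subseteq> set xs" if "a + b = m" for a b
      using that unfolding xs(3) by (auto simp: in_keys_iff lookup_add)
    have mkl: "mk (map (Poly_Mapping.lookup a) xs) = a" if "Poly_Mapping.keys a \<subseteq> set xs" for a
    proof (rule poly_mapping_eqI)
      fix v
      show "Poly_Mapping.lookup (mk (map (Poly_Mapping.lookup a) xs)) v = Poly_Mapping.lookup a v"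
      proof (cases "v \<in> set xs")
        case True
        then obtain i where "i < length xs" "v = xs ! i" by (auto simp: in_set_conv_nth)
        then show ?thesis by (simp add: lk)
      next
        case False
        then show ?thesis using that lk0[OF False] in_keys_iff[of v a] by force
      qed
    qed
    have addm: "mk u + mk v = m"
      if "length u = length xs" "length v = length xs" "map2 (+) u v = map (Poly_Mapping.lookup m) xs" for u v
    proof (rule poly_mapping_eqI)
      fix w
      show "Poly_Mapping.lookup (mk u + mk v) w = Poly_Mapping.lookup m w"
      proof (cases "w \<in> set xs")
        case True
        then obtain i where i: "i < length xs" "w = xs ! i" by (auto simp: in_set_conv_nth)
        have "map2 (+) u v ! i = map (Poly_Mapping.lookup m) xs ! i" using that(3) by simp
        then have "u ! i + v ! i = Poly_Mapping.lookup m (xs ! i)" using i that(1,2) by simp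
        then show ?thesis using i by (simp add: lookup_add lk)
      next
        case False
        then show ?thesis using lk0[OF False] in_keys_iff[of w m] unfolding xs(3) by (simp add: lookup_add)
      qed
    qed
    have km: "Poly_Mapping.keys (mk u) \<subseteq> set xs" for u
      using lk0[of _ u] in_keys_iff[of _ "mk u"] by blast
    have map2eq: "map2 (+) (map (Poly_Mapping.lookup a) xs) (map (Poly_Mapping.lookup b) xs) = map (Poly_Mapping.lookup m) xs"
      if "a + b = m" for a b
      unfolding that[symmetric] by (rule nth_equalityI) (simp_all add: lookup_add)
    show ?thesis
      unfolding psmult_def em
    proof (rule sum.reindex_bij_witness[of _ "\<lambda>(u, v). (mk u, mk v)"
          "\<lambda>(a, b). (map (Poly_Mapping.lookup a) xs, map (Poly_Mapping.lookup b) xs)"], goal_cases)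
      case (1 p)
      then obtain a b where "p = (a, b)" "a + b = m" by blast
      with keys_split[of a b] show ?case by (simp add: mkl)
    next
      case (2 p)
      then obtain a b where "p = (a, b)" "a + b = m" by blast
      with map2eq[of a b] show ?case by simp
    next
      case (3 p)
      then obtain u v where "p = (u, v)" "length u = length xs" "length v = length xs" by auto
      then show ?case by (simp add: mlk)
    next
      case (4 p)
      then obtain u v where "p = (u, v)" "length u = length xs" "length v = length xs"
        "map2 (+) u v = map (Poly_Mapping.lookup m) xs" by auto
      then show ?case by (simp add: addm)
    next
      case (5 p)
      then obtain a b where p: "p = (a, b)" "a + b = m" by blast
      have "exps a = ?nz (map (Poly_Mapping.lookup a) xs)" "exps b = ?nz (map (Poly_Mapping.lookup b) xs)"
        using exps_superset[OF xs(1,2)] keys_split[OF p(2)] by blast+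
      then show ?case using p(1) F[of a] G[of b] by simp
    qed
  qed
  show ?thesis by (simp only: main e)
qed

lemma quasisym_psmult:
  assumes "quasisym f" "quasisym g"
  shows "quasisym (psmult f g)"
proof -
  obtain d1 where d1: "\<forall>m. f m \<noteq> 0 \<longrightarrow> mdeg m \<le> d1" using quasisym_bound[OF assms(1)] by (rule exE)
  obtain d2 where d2: "\<forall>m. g m \<noteq> 0 \<longrightarrow> mdeg m \<le> d2" using quasisym_bound[OF assms(2)] by (rule exE)
  show ?thesis
  proof (rule quasisymI)
    fix m assume nz: "psmult f g m \<noteq> 0"
    show "mdeg m \<le> d1 + d2"
    proof (rule ccontr)
      assume large: "\<not> mdeg m \<le> d1 + d2"
      have "f a * g b = 0" if "a + b = m" for a b
      proof -
        have "\<not> mdeg a \<le> d1 \<or> \<not> mdeg b \<le> d2" using large that mdeg_add[of a b] by auto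
        then have "f a = 0 \<or> g b = 0" using d1[rule_format, of a] d2[rule_format, of b] by auto
        then show ?thesis by auto
      qed
      then have "psmult f g m = 0" unfolding psmult_def by (intro sum.neutral) auto
      with nz show False by contradiction
    qed
  next
    fix m m' assume e: "exps m = exps m'"
    show "psmult f g m = psmult f g m'"
      by (rule psmult_exps[OF quasisym_eq[OF assms(1)] quasisym_eq[OF assms(2)] e])
  qed
qed

typedef (overloaded) 'f qsym = "{f :: mon \<Rightarrow> 'f::zero. quasisym f}"
  morphisms qcoeff Abs_qsym
  by (rule exI[of _ "\<lambda>_. 0"]) (simp add: quasisym_def)

setup_lifting type_definition_qsym

lemma exps_eq_Nil: "exps m = [] \<longleftrightarrow> m = 0"
  by (auto simp: exps_def)

instantiation qsym :: (comm_ring_1) comm_ring_1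
begin

lift_definition zero_qsym :: "'a qsym" is "\<lambda>_. 0" by (rule quasisymI) auto
lift_definition one_qsym :: "'a qsym" is "\<lambda>m. if m = 0 then 1 else 0"
proof (rule quasisymI)
  fix m m' :: mon assume "exps m = exps m'"
  then have "m = 0 \<longleftrightarrow> m' = 0" using exps_eq_Nil[of m] exps_eq_Nil[of m'] by argo
  then show "(if m = 0 then 1 else 0 :: 'a) = (if m' = 0 then 1 else 0)" by simp
qed (auto simp: mdeg_0 split: if_splits)
lift_definition plus_qsym :: "'a qsym \<Rightarrow> 'a qsym \<Rightarrow> 'a qsym" is "\<lambda>f g m. f m + g m"
proof -
  fix f g :: "mon \<Rightarrow> 'a"
  assume *: "quasisym f" "quasisym g"
  obtain d1 where d1: "\<forall>m. f m \<noteq> 0 \<longrightarrow> mdeg m \<le> d1" using quasisym_bound[OF *(1)] by (rule exE)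
  obtain d2 where d2: "\<forall>m. g m \<noteq> 0 \<longrightarrow> mdeg m \<le> d2" using quasisym_bound[OF *(2)] by (rule exE)
  show "quasisym (\<lambda>m. f m + g m)"
  proof (rule quasisymI)
    fix m assume "f m + g m \<noteq> 0"
    then show "mdeg m \<le> max d1 d2"
      using d1[rule_format, of m] d2[rule_format, of m] by (cases "f m = 0") (auto simp: le_max_iff_disj)
  next
    fix m m' assume "exps m = exps m'"
    from quasisym_eq[OF *(1) this] quasisym_eq[OF *(2) this] show "f m + g m = f m' + g m'" by simp
  qed
qed
lift_definition uminus_qsym :: "'a qsym \<Rightarrow> 'a qsym" is "\<lambda>f m. - f m"
proof -
  fix f :: "mon \<Rightarrow> 'a"
  assume f: "quasisym f"
  obtain d where d: "\<forall>m. f m \<noteq> 0 \<longrightarrow> mdeg m \<le> d" using quasisym_bound[OF f] by (rule exE)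
  show "quasisym (\<lambda>m. - f m)"
  proof (rule quasisymI)
    fix m assume "- f m \<noteq> 0"
    then show "mdeg m \<le> d" using d[rule_format, of m] by simp
  next
    fix m m' assume "exps m = exps m'"
    from quasisym_eq[OF f this] show "- f m = - f m'" by simp
  qed
qed
definition minus_qsym :: "'a qsym \<Rightarrow> 'a qsym \<Rightarrow> 'a qsym" where "minus_qsym f g = f + - g"
lift_definition times_qsym :: "'a qsym \<Rightarrow> 'a qsym \<Rightarrow> 'a qsym" is psmult
  by (rule quasisym_psmult)

instance
proof
  fix a b c :: "'a qsym"
  show "a * b * c = a * (b * c)" by transfer (rule psmult_assoc)
  show "a * b = b * a" by transfer (rule psmult_commute)
  show "1 * a = a" by transfer (rule psmult_one)
  show "a + b + c = a + (b + c)" by transfer (simp add: algebra_simps)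
  show "a + b = b + a" by transfer (simp add: algebra_simps)
  show "0 + a = a" by transfer simp
  show "- a + a = 0" by transfer simp
  show "a - b = a + - b" by (rule minus_qsym_def)
  show "(a + b) * c = a * c + b * c" by transfer (rule psmult_add)
  show "(0::'a qsym) \<noteq> 1" by transfer (auto simp: fun_eq_iff)
qed

end


lift_definition scale_qsym :: "'f \<Rightarrow> 'f qsym \<Rightarrow> 'f::comm_ring_1 qsym" is "\<lambda>c f m. c * f m"
proof -
  fix c :: 'f and f :: "mon \<Rightarrow> 'f"
  assume f: "quasisym f"
  obtain d where d: "\<forall>m. f m \<noteq> 0 \<longrightarrow> mdeg m \<le> d" using quasisym_bound[OF f] by (rule exE)
  show "quasisym (\<lambda>m. c * f m)"
  proof (rule quasisymI)
    fix m assume "c * f m \<noteq> 0"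
    then show "mdeg m \<le> d" using d[rule_format, of m] by (cases "f m = 0") auto
  next
    fix m m' assume "exps m = exps m'"
    from quasisym_eq[OF f this] show "c * f m = c * f m'" by simp
  qed
qed

lift_definition monomial_qsym :: "comp \<Rightarrow> 'f::zero_neq_one qsym" is "\<lambda>xs m. if exps m = xs then 1 else 0"
proof -
  fix xs
  show "quasisym (\<lambda>m. if exps m = xs then 1 else 0 :: 'f)"
    by (rule quasisymI[of _ "sum_list xs"]) (auto simp: mdeg_exps split: if_splits)
qed

lemma exps_nth: "0 \<notin> set xs \<Longrightarrow> exps (Poly_Mapping.nth xs) = xs"
proof -
  assume xs: "0 \<notin> set xs"
  have "Poly_Mapping.keys (Poly_Mapping.nth xs) \<subseteq> set [0..<length xs]"
  proof
    fix v assume "v \<in> Poly_Mapping.keys (Poly_Mapping.nth xs)"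
    then have "nth_default 0 xs v \<noteq> 0" unfolding in_keys_iff lookup_nth .
    moreover have "nth_default 0 xs v = 0" if "\<not> v < length xs" using that by (simp add: nth_default_def)
    ultimately have "v < length xs" by (rule contrapos_np)
    then show "v \<in> set [0..<length xs]" by simp
  qed
  then have "exps (Poly_Mapping.nth xs)
      = filter (\<lambda>e. e \<noteq> 0) (map (Poly_Mapping.lookup (Poly_Mapping.nth xs)) [0..<length xs])"
    by (intro exps_superset) auto
  also have "map (Poly_Mapping.lookup (Poly_Mapping.nth xs)) [0..<length xs] = xs"
    by (rule nth_equalityI) (auto simp: nth_default_def)
  also have "filter (\<lambda>e. e \<noteq> 0) xs = xs" using xs by (auto simp: filter_id_conv intro: ccontr)
  finally show ?thesis .
qed

lemma length_le_sum_list: "0 \<notin> set xs \<Longrightarrow> length xs \<le> sum_list (xs :: nat list)"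
  by (induction xs) auto

lemma finite_comp_bounded: "finite {\<beta>. sum_list (parts \<beta>) \<le> d}"
proof -
  have "parts ` {\<beta>. sum_list (parts \<beta>) \<le> d} \<subseteq> {xs. set xs \<subseteq> {..d} \<and> length xs \<le> d}"
  proof clarify
    fix \<beta> assume *: "sum_list (parts \<beta>) \<le> d"
    have "x \<le> d" if "x \<in> set (parts \<beta>)" for x
      using member_le_sum_list[OF that] * by linarith
    moreover have "length (parts \<beta>) \<le> d"
      using length_le_sum_list[of "parts \<beta>"] parts[of \<beta>] * by simp
    ultimately show "set (parts \<beta>) \<subseteq> {..d} \<and> length (parts \<beta>) \<le> d" by auto
  qed
  then have "finite (parts ` {\<beta>. sum_list (parts \<beta>) \<le> d})"
    by (rule finite_subset) (rule finite_lists_length_le, simp)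
  then show ?thesis by (rule finite_imageD) (simp add: inj_on_def parts_inject)
qed

text \<open>Coordinates in the monomial basis: \<open>c\<^sub>\<beta>\<close> in \<open>f = (\<Sum>\<beta>. c\<^sub>\<beta> M\<^sub>\<beta>)\<close> is the coefficient of
  \<open>x\<^sub>1\<^bsup>\<beta>1\<^esup> \<cdots> x\<^sub>k\<^bsup>\<beta>k\<^esup>\<close> in \<open>f\<close>.\<close>

lift_definition M_coords :: "'f::zero qsym \<Rightarrow> comp \<Rightarrow>\<^sub>0 'f"
  is "\<lambda>f \<beta>. f (Poly_Mapping.nth (parts \<beta>))"
proof -
  fix f :: "mon \<Rightarrow> 'f"
  assume f: "quasisym f"
  obtain d where d: "\<forall>m. f m \<noteq> 0 \<longrightarrow> mdeg m \<le> d" using quasisym_bound[OF f] by (rule exE)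
  have "{\<beta>. f (Poly_Mapping.nth (parts \<beta>)) \<noteq> 0} \<subseteq> {\<beta>. sum_list (parts \<beta>) \<le> d}"
  proof clarify
    fix \<beta> assume "f (Poly_Mapping.nth (parts \<beta>)) \<noteq> 0"
    from d[rule_format, OF this] show "sum_list (parts \<beta>) \<le> d"
      using parts[of \<beta>] by (simp add: mdeg_exps exps_nth)
  qed
  then show "finite {\<beta>. f (Poly_Mapping.nth (parts \<beta>)) \<noteq> 0}"
    using finite_comp_bounded finite_subset by blast
qed

lift_definition hom_qsym :: "nat \<Rightarrow> 'f qsym \<Rightarrow> 'f::zero qsym" is "\<lambda>n f m. if mdeg m = n then f m else 0"
proof -
  fix n and f :: "mon \<Rightarrow> 'f"
  assume f: "quasisym f"
  show "quasisym (\<lambda>m. if mdeg m = n then f m else 0)"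
  proof (rule quasisymI)
    fix m assume "(if mdeg m = n then f m else 0) \<noteq> 0"
    then show "mdeg m \<le> n" by (simp split: if_splits)
  next
    fix m m' assume e: "exps m = exps m'"
    from quasisym_eq[OF f e] show "(if mdeg m = n then f m else 0) = (if mdeg m' = n then f m' else 0)"
      by (simp add: mdeg_exps e)
  qed
qed

section \<open>Quasisymmetric Schur functions\<close>

text \<open>Rows and columns are numbered from \<open>0\<close>, so column \<open>0\<close> is the first one and \<open>Suc c\<close> ranges
  over all later ones. A filling is extended by zero outside of the diagram.\<close>

definition boxes :: "nat list \<Rightarrow> (nat \<times> nat) set" where
  "boxes xs = (SIGMA i:{..<length xs}. {..<xs ! i})"

definition tableau :: "nat list \<Rightarrow> (nat \<Rightarrow> nat \<Rightarrow> nat) \<Rightarrow> bool" where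
  "tableau xs T \<longleftrightarrow>
     (\<forall>i c. T i c \<noteq> 0 \<longleftrightarrow> (i, c) \<in> boxes xs) \<and>
     (\<forall>i c. T i (Suc c) \<le> T i c) \<and>
     (\<forall>i j. i < j \<and> j < length xs \<longrightarrow> T i 0 < T j 0) \<and>
     (\<forall>i j c. i < j \<and> T j (Suc c) \<noteq> 0 \<and> T i (Suc c) \<le> T j (Suc c) \<longrightarrow> T i c < T j (Suc c))"

text \<open>The monomial \<open>x\<^sup>T\<close>.\<close>

definition weight :: "nat list \<Rightarrow> (nat \<Rightarrow> nat \<Rightarrow> nat) \<Rightarrow> mon" where
  "weight xs T = (\<Sum>(i, c)\<in>boxes xs. Poly_Mapping.single (T i c - 1) 1)"

lemma finite_boxes: "finite (boxes xs)"
  by (simp add: boxes_def)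

lemma lookup_weight:
  "Poly_Mapping.lookup (weight xs T) v = card {b \<in> boxes xs. case_prod T b - 1 = v}"
proof -
  have "Poly_Mapping.lookup (weight xs T) v = (\<Sum>b\<in>boxes xs. if case_prod T b - 1 = v then 1 else 0)"
    unfolding weight_def lookup_sum by (intro sum.cong) (auto simp: lookup_single when_def)
  then show ?thesis using finite_boxes[of xs] by (simp add: sum.If_cases Int_def)
qed

lemma tableau_entry:
  assumes "tableau xs T" "T i c \<noteq> 0"
  shows "T i c - 1 \<in> Poly_Mapping.keys (weight xs T)"
proof -
  have "(i, c) \<in> {b \<in> boxes xs. case_prod T b - 1 = T i c - 1}"
    using assms by (auto simp: tableau_def)
  then have "card {b \<in> boxes xs. case_prod T b - 1 = T i c - 1} \<noteq> 0"
    using finite_boxes[of xs] by (subst card_0_eq) auto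
  then show ?thesis by (simp add: in_keys_iff lookup_weight)
qed

lemma finite_tableaux: "finite {T. tableau xs T \<and> weight xs T = m}"
proof -
  let ?B = "{f. \<forall>b. (b \<in> boxes xs \<longrightarrow> f b \<in> Suc ` Poly_Mapping.keys m) \<and> (b \<notin> boxes xs \<longrightarrow> f b = (0::nat))}"
  have fB: "finite ?B" by (intro finite_set_of_finite_funs finite_boxes) auto
  have "case_prod T \<in> ?B" if T: "tableau xs T" "weight xs T = m" for T
  proof -
    have "case_prod T b \<in> Suc ` Poly_Mapping.keys m" if "b \<in> boxes xs" for b
    proof -
      obtain i c where b: "b = (i, c)" by fastforce
      have "T i c \<noteq> 0" using T(1) that b by (auto simp: tableau_def)
      moreover from this have "T i c - 1 \<in> Poly_Mapping.keys m" using tableau_entry[OF T(1)] T(2) by auto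
      ultimately show ?thesis unfolding b by (intro image_eqI[of _ _ "T i c - 1"]) auto
    qed
    moreover have "case_prod T b = 0" if "b \<notin> boxes xs" for b
      using T(1) that by (cases b) (auto simp: tableau_def)
    ultimately show ?thesis by auto
  qed
  then have "case_prod ` {T. tableau xs T \<and> weight xs T = m} \<subseteq> ?B"
    by (intro image_subsetI) (elim CollectE conjE)
  then have "finite (case_prod ` {T. tableau xs T \<and> weight xs T = m})" using fB finite_subset by blast
  then show ?thesis
    by (rule finite_imageD) (auto simp: inj_on_def fun_eq_iff)
qed

lemma exps_iso:
  assumes "exps m = exps m'"
  shows "\<exists>\<psi>. (\<forall>u\<in>Poly_Mapping.keys m. \<forall>v\<in>Poly_Mapping.keys m. \<psi> u < \<psi> v \<longleftrightarrow> u < v) \<and>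
    \<psi> ` Poly_Mapping.keys m = Poly_Mapping.keys m' \<and>
    (\<forall>v\<in>Poly_Mapping.keys m. Poly_Mapping.lookup m' (\<psi> v) = Poly_Mapping.lookup m v)"
proof -
  define xs where "xs = sorted_list_of_set (Poly_Mapping.keys m)"
  define ys where "ys = sorted_list_of_set (Poly_Mapping.keys m')"
  have eq: "map (Poly_Mapping.lookup m) xs = map (Poly_Mapping.lookup m') ys"
    using assms by (simp add: exps_def xs_def ys_def)
  then have len: "length xs = length ys" by (metis length_map)
  have xs: "sorted_wrt (<) xs" "set xs = Poly_Mapping.keys m" by (simp_all add: xs_def)
  have ys: "sorted_wrt (<) ys" "set ys = Poly_Mapping.keys m'" by (simp_all add: ys_def)
  have injx: "inj_on ((!) xs) {..<length xs}"
    by (rule inj_on_nth) (auto simp: xs_def)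
  define \<psi> where "\<psi> = (\<lambda>v. ys ! the_inv_into {..<length xs} ((!) xs) v)"
  have \<psi>: "\<psi> (xs ! i) = ys ! i" if "i < length xs" for i
    using that by (simp add: \<psi>_def the_inv_into_f_f[OF injx])
  have mono: "zs ! i < zs ! j \<longleftrightarrow> i < j"
    if "sorted_wrt (<) zs" "i < length zs" "j < length zs" for zs :: "nat list" and i j
    using that sorted_wrt_nth_less[of "(<)" zs i j] sorted_wrt_nth_less[of "(<)" zs j i]
    by (cases i j rule: linorder_cases) auto
  show ?thesis
  proof (intro exI[of _ \<psi>] conjI ballI)
    fix u v assume "u \<in> Poly_Mapping.keys m" "v \<in> Poly_Mapping.keys m"
    then obtain i j where "i < length xs" "u = xs ! i" "j < length xs" "v = xs ! j"
      unfolding xs(2)[symmetric] in_set_conv_nth by blast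
    then show "\<psi> u < \<psi> v \<longleftrightarrow> u < v" using xs(1) ys(1) len by (simp add: \<psi> mono)
  next
    have "\<psi> ` set xs = set ys"
    proof (intro equalityI subsetI)
      fix w assume "w \<in> \<psi> ` set xs"
      then obtain i where "i < length xs" "w = \<psi> (xs ! i)" by (auto simp: in_set_conv_nth)
      then show "w \<in> set ys" using len by (simp add: \<psi>)
    next
      fix w assume "w \<in> set ys"
      then obtain i where i: "i < length xs" "w = ys ! i" unfolding in_set_conv_nth len by blast
      then show "w \<in> \<psi> ` set xs" using \<psi>[OF i(1)] by (metis imageI nth_mem)
    qed
    then show "\<psi> ` Poly_Mapping.keys m = Poly_Mapping.keys m'" by (simp add: xs(2) ys(2))
  next
    fix v assume "v \<in> Poly_Mapping.keys m"
    then obtain i where i: "i < length xs" "v = xs ! i"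
      unfolding xs(2)[symmetric] in_set_conv_nth by blast
    have "map (Poly_Mapping.lookup m) xs ! i = map (Poly_Mapping.lookup m') ys ! i" using eq by simp
    then show "Poly_Mapping.lookup m' (\<psi> v) = Poly_Mapping.lookup m v"
      using i len by (simp add: \<psi>)
  qed
qed

lemma card_tableaux_le:
  assumes "exps m = exps m'"
  shows "card {T. tableau xs T \<and> weight xs T = m} \<le> card {T. tableau xs T \<and> weight xs T = m'}"
proof -
  obtain \<psi> where \<psi>: "(\<forall>u\<in>Poly_Mapping.keys m. \<forall>v\<in>Poly_Mapping.keys m. \<psi> u < \<psi> v \<longleftrightarrow> u < v) \<and>
    \<psi> ` Poly_Mapping.keys m = Poly_Mapping.keys m' \<and>
    (\<forall>v\<in>Poly_Mapping.keys m. Poly_Mapping.lookup m' (\<psi> v) = Poly_Mapping.lookup m v)"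
    using exps_iso[OF assms] by (rule exE)
  note lt = \<psi>[THEN conjunct1, rule_format]
  note im = \<psi>[THEN conjunct2, THEN conjunct1]
  note lk = \<psi>[THEN conjunct2, THEN conjunct2, rule_format]
  define \<phi> where "\<phi> = (\<lambda>v. if v = 0 then 0 else Suc (\<psi> (v - 1)))"
  define V where "V = insert 0 (Suc ` Poly_Mapping.keys m)"
  have \<phi>0: "\<phi> v = 0 \<longleftrightarrow> v = 0" for v by (simp add: \<phi>_def)
  have \<phi>lt: "\<phi> u < \<phi> v \<longleftrightarrow> u < v" if "u \<in> V" "v \<in> V" for u v
    using that lt by (auto simp: V_def \<phi>_def)
  have \<phi>le: "\<phi> u \<le> \<phi> v \<longleftrightarrow> u \<le> v" if "u \<in> V" "v \<in> V" for u v
    using \<phi>lt[OF that(2,1)] by (meson not_le)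
  let ?A = "\<lambda>m. {T. tableau xs T \<and> weight xs T = m}"
  let ?f = "\<lambda>T i c. \<phi> (T i c)"
  have V: "T i c \<in> V" if "T \<in> ?A m" for T i c
  proof (cases "T i c = 0")
    case True then show ?thesis by (simp add: V_def)
  next
    case False
    then have "T i c - 1 \<in> Poly_Mapping.keys m" using that tableau_entry[of xs T i c] by auto
    moreover have "T i c = Suc (T i c - 1)" using False by simp
    ultimately show ?thesis unfolding V_def by (metis imageI insertI2)
  qed
  have "?f T \<in> ?A m'" if T: "T \<in> ?A m" for T
  proof -
    have tab: "tableau xs T" and w: "weight xs T = m" using T by auto
    have "tableau xs (?f T) \<longleftrightarrow> tableau xs T"
      unfolding tableau_def by (simp only: \<phi>0 \<phi>lt[OF V[OF T] V[OF T]] \<phi>le[OF V[OF T] V[OF T]])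
    moreover have "weight xs (?f T) = m'"
    proof (rule poly_mapping_eqI)
      fix v'
      have b: "case_prod T b - 1 \<in> Poly_Mapping.keys m \<and> case_prod (?f T) b - 1 = \<psi> (case_prod T b - 1)"
        if "b \<in> boxes xs" for b
      proof -
        obtain i c where b: "b = (i, c)" by fastforce
        have "T i c \<noteq> 0" using tab that b by (auto simp: tableau_def)
        then show ?thesis using tableau_entry[OF tab] w by (simp add: b \<phi>_def)
      qed
      show "Poly_Mapping.lookup (weight xs (?f T)) v' = Poly_Mapping.lookup m' v'"
      proof (cases "v' \<in> Poly_Mapping.keys m'")
        case True
        then obtain v where v: "v \<in> Poly_Mapping.keys m" "v' = \<psi> v" using im by blast
        have inj: "\<psi> u = \<psi> v \<longleftrightarrow> u = v" if "u \<in> Poly_Mapping.keys m" for u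
          using lt[OF that v(1)] lt[OF v(1) that] by (metis nat_neq_iff)
        have "{b \<in> boxes xs. case_prod (?f T) b - 1 = v'} = {b \<in> boxes xs. case_prod T b - 1 = v}"
        proof (intro Collect_cong conj_cong refl)
          fix a assume "a \<in> boxes xs"
          from b[OF this] show "(case_prod (?f T) a - 1 = v') = (case_prod T a - 1 = v)"
            using inj v(2) by simp
        qed
        then show ?thesis using lookup_weight[of xs T v] w lk[OF v(1)] v(2) by (simp add: lookup_weight)
      next
        case False
        have "{b \<in> boxes xs. case_prod (?f T) b - 1 = v'} = {}"
        proof -
          have "case_prod (?f T) a - 1 \<noteq> v'" if "a \<in> boxes xs" for a
            using b[OF that] im False by blast
          then show ?thesis by simp
        qed
        then have "Poly_Mapping.lookup (weight xs (?f T)) v' = 0"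
            unfolding lookup_weight by (simp only: card.empty)
        then show ?thesis using False by (simp add: in_keys_iff)
      qed
    qed
    ultimately show ?thesis using tab by simp
  qed
  moreover have "inj_on ?f (?A m)"
  proof (rule inj_onI)
    fix T U assume T: "T \<in> ?A m" and U: "U \<in> ?A m" and eq: "?f T = ?f U"
    show "T = U"
    proof (intro ext)
      fix i c
      have "\<phi> (T i c) = \<phi> (U i c)" using fun_cong[OF fun_cong[OF eq]] .
      then show "T i c = U i c"
        using \<phi>le[OF V[OF T] V[OF U], of i c i c] \<phi>le[OF V[OF U] V[OF T], of i c i c] by simp
    qed
  qed
  ultimately show ?thesis
    by (intro card_inj_on_le[of ?f] finite_tableaux) auto
qed

lift_definition quasi_schur :: "comp \<Rightarrow> 'f::semiring_1 qsym"
  is "\<lambda>xs m. of_nat (card {T. tableau xs T \<and> weight xs T = m})"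
proof -
  fix xs :: "nat list"
  show "quasisym (\<lambda>m. of_nat (card {T. tableau xs T \<and> weight xs T = m}) :: 'f)"
  proof (rule quasisymI)
    fix m assume nz: "of_nat (card {T. tableau xs T \<and> weight xs T = m}) \<noteq> (0 :: 'f)"
    have "{T. tableau xs T \<and> weight xs T = m} \<noteq> {}"
    proof
      assume e: "{T. tableau xs T \<and> weight xs T = m} = {}"
      show False using nz unfolding e by simp
    qed
    then obtain T where T: "weight xs T = m" by blast
    have "mdeg m = (\<Sum>b\<in>boxes xs. mdeg (Poly_Mapping.single (case_prod T b - 1) 1))"
      unfolding T[symmetric] weight_def mdeg_sum by (simp add: case_prod_unfold)
    also have "\<dots> = card (boxes xs)" by (simp add: mdeg_def)
    finally show "mdeg m \<le> card (boxes xs)" by simp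
  next
    fix m m' assume e: "exps m = exps m'"
    have "card {T. tableau xs T \<and> weight xs T = m} = card {T. tableau xs T \<and> weight xs T = m'}"
      using card_tableaux_le[OF e] card_tableaux_le[OF e[symmetric]] by (rule antisym)
    then show "(of_nat (card {T. tableau xs T \<and> weight xs T = m}) :: 'f)
        = of_nat (card {T. tableau xs T \<and> weight xs T = m'})" by simp
  qed
qed


section \<open>Noncommutative symmetric functions\<close>

text \<open>The free algebra on \<open>H\<^sub>1, H\<^sub>2, \<dots>\<close> is the monoid algebra of the free monoid on the positive
  integers, i.e. of compositions under concatenation; the basis vector at \<open>\<alpha>\<close> is \<open>H\<^sub>\<alpha>\<close>.\<close>

type_synonym 'f nsym = "comp \<Rightarrow>\<^sub>0 'f"

definition scale_pm :: "'f \<Rightarrow> ('i \<Rightarrow>\<^sub>0 'f) \<Rightarrow> 'i \<Rightarrow>\<^sub>0 'f::mult_zero" where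
  "scale_pm c = Poly_Mapping.map ((*) c)"

definition H_gen :: "nat \<Rightarrow> 'f::field nsym" where
  "H_gen r = (if r = 0 then 1 else Poly_Mapping.single (Abs_comp [r]) 1)"

definition hom_nsym :: "nat \<Rightarrow> 'f nsym \<Rightarrow> 'f::zero nsym" where
  "hom_nsym n = Poly_Mapping.mapp (\<lambda>\<alpha> c. if csize \<alpha> = n then c else 0)"

text \<open>The tensor product of two spaces with bases indexed by \<open>'i\<close> and \<open>'j\<close> is the space with basis
  \<open>'i \<times> 'j\<close>. For \<open>NSym \<otimes> NSym\<close> the convolution product on \<open>comp \<times> comp \<Rightarrow>\<^sub>0 'f\<close> is the
  componentwise product of tensors.\<close>

definition tensor :: "('i \<Rightarrow>\<^sub>0 'f) \<Rightarrow> ('j \<Rightarrow>\<^sub>0 'f) \<Rightarrow> ('i \<times> 'j) \<Rightarrow>\<^sub>0 'f::field" where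
  "tensor f g = (\<Sum>i\<in>Poly_Mapping.keys f. \<Sum>j\<in>Poly_Mapping.keys g.
     Poly_Mapping.single (i, j) (Poly_Mapping.lookup f i * Poly_Mapping.lookup g j))"

text \<open>The algebra morphism with \<open>\<Delta>(H\<^sub>r) = (\<Sum>i+j=r. H\<^sub>i \<otimes> H\<^sub>j)\<close>.\<close>

definition coprod_nsym :: "'f::field nsym \<Rightarrow> (comp \<times> comp) \<Rightarrow>\<^sub>0 'f" where
  "coprod_nsym f = (\<Sum>\<alpha>\<in>Poly_Mapping.keys f. scale_pm (Poly_Mapping.lookup f \<alpha>)
     (prod_list (map (\<lambda>r. \<Sum>i\<le>r. tensor (H_gen i) (H_gen (r - i))) (parts \<alpha>))))"

section \<open>Duality and the Hopf structure of quasisymmetric functions\<close>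

definition pairing :: "'f nsym \<Rightarrow> 'f qsym \<Rightarrow> 'f::field" where
  "pairing f g = (\<Sum>\<alpha>\<in>Poly_Mapping.keys f. Poly_Mapping.lookup f \<alpha> * Poly_Mapping.lookup (M_coords g) \<alpha>)"

text \<open>The coproduct dual to concatenation, in the basis \<open>M\<^sub>\<gamma> \<otimes> M\<^sub>\<delta>\<close>:
  \<open>\<Delta>\<^sup>\<or>(M\<^sub>\<beta>) = (\<Sum>\<gamma>\<delta>=\<beta>. M\<^sub>\<gamma> \<otimes> M\<^sub>\<delta>)\<close>.\<close>

definition coprod_qsym :: "'f::field qsym \<Rightarrow> (comp \<times> comp) \<Rightarrow>\<^sub>0 'f" where
  "coprod_qsym g = (\<Sum>\<beta>\<in>Poly_Mapping.keys (M_coords g). \<Sum>(\<gamma>, \<delta>) | \<gamma> + \<delta> = \<beta>.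
     Poly_Mapping.single (\<gamma>, \<delta>) (Poly_Mapping.lookup (M_coords g) \<beta>))"

definition tensor_qsym :: "'f qsym \<Rightarrow> 'f qsym \<Rightarrow> (comp \<times> comp) \<Rightarrow>\<^sub>0 'f::field" where
  "tensor_qsym f g = tensor (M_coords f) (M_coords g)"

definition counit_qsym :: "'f::field qsym \<Rightarrow> 'f" where
  "counit_qsym g = Poly_Mapping.lookup (M_coords g) 0"

text \<open>The linear map \<open>f \<otimes> g \<mapsto> p f * q g\<close> on \<open>QSym \<otimes> QSym\<close>.\<close>

definition mult_map_qsym ::
  "('f qsym \<Rightarrow> 'f qsym) \<Rightarrow> ('f qsym \<Rightarrow> 'f qsym) \<Rightarrow> ((comp \<times> comp) \<Rightarrow>\<^sub>0 'f) \<Rightarrow> 'f::field qsym" where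
  "mult_map_qsym p q t = (\<Sum>(\<gamma>, \<delta>)\<in>Poly_Mapping.keys t.
     scale_qsym (Poly_Mapping.lookup t (\<gamma>, \<delta>)) (p (monomial_qsym \<gamma>) * q (monomial_qsym \<delta>)))"

text \<open>The antipode is the two-sided convolution inverse of the identity; being an inverse it is
  unique, and it exists because the Hopf algebra is graded and connected.\<close>

definition is_antipode_qsym :: "('f qsym \<Rightarrow> 'f::field qsym) \<Rightarrow> bool" where
  "is_antipode_qsym S \<longleftrightarrow> Vector_Spaces.linear scale_qsym scale_qsym S \<and>
     (\<forall>g. mult_map_qsym S id (coprod_qsym g) = scale_qsym (counit_qsym g) 1) \<and>
     (\<forall>g. mult_map_qsym id S (coprod_qsym g) = scale_qsym (counit_qsym g) 1)"

definition antipode_qsym :: "'f qsym \<Rightarrow> 'f::field qsym" where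
  "antipode_qsym = (THE S. is_antipode_qsym S)"

section \<open>Noncommutative Schur functions and skew elements\<close>

text \<open>The dual basis exists and is unique because the Schur functions are a basis: reading a filling
  from the last row upwards shows that their expansion in the monomial basis is unitriangular for
  the lexicographic order on reversed compositions.\<close>

definition nc_schur :: "comp \<Rightarrow> 'f::field nsym" where
  "nc_schur \<alpha> = (THE s. \<forall>\<beta>. pairing s (quasi_schur \<beta>) = (if \<alpha> = \<beta> then 1 else 0))"

text \<open>\<open>skew_nsym \<lambda> \<eta>\<close> is \<open>s\<^bsub>\<lambda>/\<eta>\<^esub>\<close> and \<open>skew_qsym \<lambda> \<eta>\<close> is \<open>S\<^bsub>\<lambda>/\<eta>\<^esub>\<close>: the coefficients of the
  coproduct with respect to the Schur basis in the right tensor factor.\<close>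

definition skew_nsym :: "comp \<Rightarrow> comp \<Rightarrow> 'f::field nsym" where
  "skew_nsym la = (THE h. finite {\<eta>. h \<eta> \<noteq> 0} \<and>
     coprod_nsym (nc_schur la) = (\<Sum>\<eta> | h \<eta> \<noteq> 0. tensor (h \<eta>) (nc_schur \<eta>)))"

definition skew_qsym :: "comp \<Rightarrow> comp \<Rightarrow> 'f::field qsym" where
  "skew_qsym la = (THE h. finite {\<eta>. h \<eta> \<noteq> 0} \<and>
     coprod_qsym (quasi_schur la) = (\<Sum>\<eta> | h \<eta> \<noteq> 0. tensor_qsym (h \<eta>) (quasi_schur \<eta>)))"

section \<open>Commutative algebras and their tensor product\<close>

text \<open>The sort \<open>{comm_ring, comm_monoid_mult}\<close> is that of unital commutative rings; unlike
  \<open>comm_ring_1\<close> it admits the zero ring.\<close>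

locale comm_algebra = vector_space scale
  for scale :: "'f::field \<Rightarrow> 'a::{comm_ring, comm_monoid_mult} \<Rightarrow> 'a" +
  assumes scale_mult_left: "scale c (x * y) = scale c x * y"

definition algebra_morphism ::
  "('f::field \<Rightarrow> 'a \<Rightarrow> 'a) \<Rightarrow> ('f \<Rightarrow> 'b \<Rightarrow> 'b) \<Rightarrow> ('a::{ring, monoid_mult} \<Rightarrow> 'b::{ring, monoid_mult}) \<Rightarrow> bool"
where
  "algebra_morphism s1 s2 \<phi> \<longleftrightarrow> Vector_Spaces.linear s1 s2 \<phi> \<and>
     \<phi> 1 = 1 \<and> (\<forall>x y. \<phi> (x * y) = \<phi> x * \<phi> y)"

text \<open>The tensor product of two algebras \<open>'a\<close>, \<open>'b\<close> over \<open>'f\<close> is the quotient of the free vector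
  space on \<open>'a \<times> 'b\<close> by the span of the bilinearity relations. Its elements are handled through
  representatives in the free vector space; equality is congruence modulo \<open>tensor_null\<close>.\<close>

type_synonym ('f, 'a, 'b) free_tensor = "('a \<times> 'b) \<Rightarrow>\<^sub>0 'f"

definition pure :: "'a \<Rightarrow> 'b \<Rightarrow> ('f::field, 'a, 'b) free_tensor" where
  "pure a b = Poly_Mapping.single (a, b) 1"

definition tensor_null ::
  "('f::field \<Rightarrow> 'a \<Rightarrow> 'a) \<Rightarrow> ('f \<Rightarrow> 'b \<Rightarrow> 'b) \<Rightarrow> ('f, 'a::ab_group_add, 'b::ab_group_add) free_tensor set"
where
  "tensor_null sX sY = module.span scale_pm
     ({pure (a + a') b - pure a b - pure a' b | a a' b. True} \<union>
      {pure a (b + b') - pure a b - pure a b' | a b b'. True} \<union>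
      {pure (sX c a) b - scale_pm c (pure a b) | c a b. True} \<union>
      {pure a (sY c b) - scale_pm c (pure a b) | c a b. True})"

definition tensor_mult ::
  "('f::field, 'a, 'b) free_tensor \<Rightarrow> ('f, 'a, 'b) free_tensor \<Rightarrow> ('f, 'a::times, 'b::times) free_tensor"
where
  "tensor_mult u v = (\<Sum>(a, b)\<in>Poly_Mapping.keys u. \<Sum>(a', b')\<in>Poly_Mapping.keys v.
     scale_pm (Poly_Mapping.lookup u (a, b) * Poly_Mapping.lookup v (a', b')) (pure (a * a') (b * b')))"

section \<open>Degreewise evaluation\<close>

text \<open>Formal sums are read degree by degree: an element is the sequence \<open>n \<mapsto> u\<^sub>n\<close> of the images of
  its components of total degree \<open>n\<close>, multiplied by the Cauchy product. The element \<open>f[X]\<close> has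
  \<open>n\<close>-th entry \<open>ev\<^sub>X(f\<^sub>n) \<otimes> 1\<close>, and \<open>g[Y]\<close> has \<open>n\<close>-th entry \<open>1 \<otimes> ev\<^sub>Y(g\<^sub>n)\<close>.\<close>

type_synonym ('f, 'a, 'b) graded_tensor = "nat \<Rightarrow> ('f, 'a, 'b) free_tensor"

definition eval_X :: "('f::field nsym \<Rightarrow> 'a) \<Rightarrow> 'f nsym \<Rightarrow> ('f, 'a, 'b::one) graded_tensor" where
  "eval_X evX f n = pure (evX (hom_nsym n f)) 1"

definition eval_Y :: "('f::field qsym \<Rightarrow> 'b) \<Rightarrow> 'f qsym \<Rightarrow> ('f, 'a::one, 'b) graded_tensor" where
  "eval_Y evY g n = pure 1 (evY (hom_qsym n g))"

definition graded_mult ::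
  "('f::field, 'a, 'b) graded_tensor \<Rightarrow> ('f, 'a, 'b) graded_tensor \<Rightarrow> ('f, 'a::times, 'b::times) graded_tensor"
  (infixl \<open>\<odot>\<close> 70) where
  "(u \<odot> v) n = (\<Sum>k\<le>n. tensor_mult (u k) (v (n - k)))"

text \<open>Sum of a family that in each degree has only finitely many terms that are nonzero in the tensor
  product.\<close>

definition graded_sum ::
  "('f::field \<Rightarrow> 'a \<Rightarrow> 'a) \<Rightarrow> ('f \<Rightarrow> 'b \<Rightarrow> 'b) \<Rightarrow>
   ('i \<Rightarrow> ('f, 'a::ab_group_add, 'b::ab_group_add) graded_tensor) \<Rightarrow> ('f, 'a, 'b) graded_tensor" where
  "graded_sum sX sY U n = (\<Sum>i | U i n \<notin> tensor_null sX sY. U i n)"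

definition graded_eq ::
  "('f::field \<Rightarrow> 'a \<Rightarrow> 'a) \<Rightarrow> ('f \<Rightarrow> 'b \<Rightarrow> 'b) \<Rightarrow> ('f, 'a::ab_group_add, 'b::ab_group_add) graded_tensor \<Rightarrow>
   ('f, 'a, 'b) graded_tensor \<Rightarrow> bool" where
  "graded_eq sX sY u v \<longleftrightarrow> (\<forall>n. u n - v n \<in> tensor_null sX sY)"

definition cauchy_NQ ::
  "('f::field \<Rightarrow> 'a \<Rightarrow> 'a) \<Rightarrow> ('f \<Rightarrow> 'b \<Rightarrow> 'b) \<Rightarrow> ('f nsym \<Rightarrow> 'a) \<Rightarrow> ('f qsym \<Rightarrow> 'b) \<Rightarrow>
   ('f, 'a::{comm_ring, comm_monoid_mult}, 'b::{comm_ring, comm_monoid_mult}) graded_tensor" where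
  "cauchy_NQ sX sY evX evY =
     graded_sum sX sY (\<lambda>\<alpha>. eval_X evX (nc_schur \<alpha>) \<odot> eval_Y evY (quasi_schur \<alpha>))"

end

theory Submission
  imports Defs
begin

text \<open>Let \<open>T(f) = (id \<otimes> \<langle>f, \<cdot>\<rangle>) \<circ> \<Delta>\<^sup>\<or>\<close> on quasisymmetric functions. Pairing the
  noncommutative factor with an arbitrary \<open>x\<close> turns the identity into one between linear operators.
  The left side becomes \<open>T(s\<^bsub>\<lambda>/\<eta>\<^esub>) x\<close>, because the Schur bases are dual. On the right,
  \<open>\<langle>s\<^bsub>\<rho>/\<mu>\<^esub>, x\<rangle> = \<langle>s\<^bsub>\<rho>\<^esub>, x S\<^bsub>\<mu>\<^esub>\<rangle>\<close> and \<open>S\<^bsub>\<rho>/\<lambda>\<^esub> = T(s\<^bsub>\<lambda>\<^esub>) S\<^bsub>\<rho>\<^esub>\<close>, so the sum over \<open>\<rho>\<close> is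
  \<open>T(s\<^bsub>\<lambda>\<^esub>) (x S\<^bsub>\<mu>\<^esub>)\<close>, which the product rule expands into the sum over \<open>\<nu>\<close> of
  \<open>T(s\<^bsub>\<lambda>/\<nu>\<^esub>) x\<close> times \<open>S\<^bsub>\<mu>/\<nu>\<^esub>\<close>. By the antipode axiom, multiplying by the antipode of
  \<open>S\<^bsub>\<eta>/\<mu>\<^esub>\<close> and summing over \<open>\<mu>\<close> leaves only the term \<open>\<nu> = \<eta>\<close>.\<close>

section \<open>Linear extension and coordinates\<close>

text \<open>Two obstacles remain: equality of tensors is only congruence of representatives, and the
  sums are infinite. Both are met in each bidegree. Expanding the X-factor in the basis of the
  H_\<sigma> and moving scalars to the Y-factor leaves one quasisymmetric identity for each
  \<sigma>; pairing with x = M_\<sigma> is exactly reading off the coefficient of H_\<sigma>. In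
  total degree n only |\<alpha>| \<le> n matters on the left, and on the right only |\<mu>| \<le>
  |\<eta>| and |\<rho>| \<le> n + |\<eta>|.

  The product rule holds because splitting every letter of H_\<alpha> and factoring a monomial with
  exponents \<alpha> are indexed by the same vectors, those dominated by \<alpha>. The cancellation
  holds because T(f) is the convolution of the identity with f, so convolving the antipode with T(f)
  gives f by associativity.

  The dual basis, the skew elements and the antipode are definite descriptions and have to be
  constructed: the basis from a unitriangular system graded by a numerical statistic of tableaux,
  the skew elements by contraction with the dual basis, the antipode by recursion over proper
  prefixes.\<close>

definition (in module) lin :: "('i \<Rightarrow> 'b) \<Rightarrow> ('i \<Rightarrow>\<^sub>0 'a) \<Rightarrow> 'b" where
  "lin \<phi> t = (\<Sum>k\<in>Poly_Mapping.keys t. scale (Poly_Mapping.lookup t k) (\<phi> k))"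

context module
begin

lemma lin_superset:
  assumes "finite A" "Poly_Mapping.keys t \<subseteq> A"
  shows "lin \<phi> t = (\<Sum>k\<in>A. scale (Poly_Mapping.lookup t k) (\<phi> k))"
  unfolding lin_def using assms by (intro sum.mono_neutral_left) (auto simp: in_keys_iff)

lemma lin_single: "lin \<phi> (Poly_Mapping.single k c) = scale c (\<phi> k)"
  by (subst lin_superset[of "{k}"]) auto

lemma lin_0: "lin \<phi> 0 = 0"
  by (simp add: lin_def)

lemma lin_add: "lin \<phi> (s + t) = lin \<phi> s + lin \<phi> t"
proof -
  let ?A = "Poly_Mapping.keys s \<union> Poly_Mapping.keys t"
  have "Poly_Mapping.keys (s + t) \<subseteq> ?A" by (rule Poly_Mapping.keys_add)
  then show ?thesis
    by (simp add: lin_superset[of ?A] lookup_add scale_left_distrib sum.distrib)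
qed

lemma lin_sum: "lin \<phi> (sum f A) = (\<Sum>x\<in>A. lin \<phi> (f x))"
  by (induction A rule: infinite_finite_induct) (auto simp: lin_add lin_0)

lemma lin_cong: "(\<And>k. k \<in> Poly_Mapping.keys t \<Longrightarrow> \<phi> k = \<psi> k) \<Longrightarrow> lin \<phi> t = lin \<psi> t"
  by (simp add: lin_def)

end

lemma lookup_scale_pm: "Poly_Mapping.lookup (scale_pm c t) k = c * Poly_Mapping.lookup t k"
  unfolding scale_pm_def by (simp add: Poly_Mapping.map.rep_eq when_def)

lemma scale_pm_single: "scale_pm c (Poly_Mapping.single k d) = Poly_Mapping.single k (c * d)"
  by (rule poly_mapping_eqI) (simp add: lookup_scale_pm lookup_single when_def)

interpretation pm: vector_space "scale_pm :: 'f::field \<Rightarrow> ('i \<Rightarrow>\<^sub>0 'f) \<Rightarrow> 'i \<Rightarrow>\<^sub>0 'f"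
  by standard (auto intro!: poly_mapping_eqI simp: lookup_scale_pm lookup_add algebra_simps)

interpretation qs: vector_space "scale_qsym :: 'f::field \<Rightarrow> 'f qsym \<Rightarrow> 'f qsym"
  by standard (transfer; auto simp: fun_eq_iff algebra_simps)+

interpretation sc: vector_space "(*) :: 'f::field \<Rightarrow> 'f \<Rightarrow> 'f"
  by standard (auto simp: algebra_simps)

text \<open>As a rewrite rule this instance fights the commutativity laws of multiplication.\<close>

declare sc.scale_scale [simp del]

lemma (in vector_space) lin_scale_pm: "lin \<phi> (scale_pm c t) = scale c (lin \<phi> t)"
proof -
  have "Poly_Mapping.keys (scale_pm c t) \<subseteq> Poly_Mapping.keys t"
    by (auto simp: in_keys_iff lookup_scale_pm)
  then show ?thesis
    by (subst lin_superset[of "Poly_Mapping.keys t"]) (auto simp: lin_def lookup_scale_pm scale_sum_right)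
qed

lemma linear_lin:
  assumes "Vector_Spaces.linear s1 s2 L"
  shows "L (module.lin s1 \<phi> t) = module.lin s2 (\<lambda>k. L (\<phi> k)) t"
proof -
  interpret Vector_Spaces.linear s1 s2 L by fact
  show ?thesis by (simp add: vs1.lin_def vs2.lin_def sum scale)
qed

lemma pm_lin_single: "pm.lin (\<lambda>k. Poly_Mapping.single k 1) t = t"
proof (rule poly_mapping_eqI)
  fix k
  show "Poly_Mapping.lookup (pm.lin (\<lambda>k. Poly_Mapping.single k 1) t) k = Poly_Mapping.lookup t k"
    by (simp add: pm.lin_def lookup_sum scale_pm_single lookup_single when_def in_keys_iff)
qed

section \<open>Monomial coordinates of quasisymmetric functions\<close>

abbreviation mc :: "'f::zero qsym \<Rightarrow> comp \<Rightarrow> 'f" where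
  "mc x \<beta> \<equiv> Poly_Mapping.lookup (M_coords x) \<beta>"

text \<open>Zeros arise in two ways: from variables missing in a factor of a monomial, and from H_0
  = 1. Deleting them lets compositions index both.\<close>

definition strip :: "nat list \<Rightarrow> comp" where
  "strip u = Abs_comp (filter (\<lambda>e. e \<noteq> 0) u)"

lemma parts_strip: "parts (strip u) = filter (\<lambda>e. e \<noteq> 0) u"
  by (simp add: strip_def Abs_comp_inverse)

lemma strip_Nil: "strip [] = 0"
  by (rule parts_inject[THEN iffD1]) (simp add: parts_strip zero_comp.rep_eq)

lemma strip_append: "strip (u @ v) = strip u + strip v"
  by (rule parts_inject[THEN iffD1]) (simp add: parts_strip plus_comp.rep_eq)

lemma strip_Cons: "strip (r # u) = strip [r] + strip u"
  using strip_append[of "[r]" u] by simp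

lemma csize_strip: "csize (strip u) = sum_list u"
  unfolding csize_def parts_strip by (induction u) auto

lemma csize_0: "csize 0 = 0"
  by (simp add: csize_def zero_comp.rep_eq)

lemma csize_add: "csize (\<alpha> + \<beta>) = csize \<alpha> + csize \<beta>"
  by (simp add: csize_def plus_comp.rep_eq)

lemma csize_eq_0_iff: "csize \<alpha> = 0 \<longleftrightarrow> \<alpha> = 0"
proof
  assume "csize \<alpha> = 0"
  then have "parts \<alpha> = []" using parts[of \<alpha>] by (cases "parts \<alpha>") (auto simp: csize_def)
  then show "\<alpha> = 0" by (metis parts_inject zero_comp.rep_eq)
qed (simp add: csize_0)

lemma comp_add_right_cancel: "\<alpha> + \<gamma> = \<beta> + \<gamma> \<longleftrightarrow> \<alpha> = (\<beta> :: comp)"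
  by transfer simp

lemma comp_add_eq_0_iff: "\<alpha> + \<beta> = 0 \<longleftrightarrow> \<alpha> = 0 \<and> \<beta> = (0 :: comp)"
  by transfer simp

lemma finite_csize_le: "finite {\<beta>. csize \<beta> \<le> d}"
  using finite_comp_bounded by (simp add: csize_def)

lemma finite_csize_eq: "finite {\<beta>. csize \<beta> = d}"
  by (rule finite_subset[OF _ finite_csize_le[of d]]) auto

lemma finite_deconcat: "finite {(\<gamma>, \<delta>). \<gamma> + \<delta> = (\<beta> :: comp)}"
proof (rule finite_subset)
  show "{(\<gamma>, \<delta>). \<gamma> + \<delta> = \<beta>} \<subseteq> {\<gamma>. csize \<gamma> \<le> csize \<beta>} \<times> {\<gamma>. csize \<gamma> \<le> csize \<beta>}"
    by (auto simp: csize_add)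
qed (simp add: finite_csize_le)

lemma exps_nth_filter: "exps (Poly_Mapping.nth xs) = filter (\<lambda>e. e \<noteq> 0) xs"
proof -
  have "Poly_Mapping.keys (Poly_Mapping.nth xs) \<subseteq> set [0..<length xs]"
    by (auto simp: in_keys_iff lookup_nth nth_default_def simp del: keys_nth split: if_splits)
  then have "exps (Poly_Mapping.nth xs)
      = filter (\<lambda>e. e \<noteq> 0) (map (Poly_Mapping.lookup (Poly_Mapping.nth xs)) [0..<length xs])"
    by (intro exps_superset) auto
  also have "map (Poly_Mapping.lookup (Poly_Mapping.nth xs)) [0..<length xs] = xs"
    by (rule nth_equalityI) (auto simp: nth_default_def)
  finally show ?thesis .
qed

lemma qcoeff_nth: "qcoeff x (Poly_Mapping.nth u) = mc x (strip u)"
proof -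
  have "exps (Poly_Mapping.nth u) = exps (Poly_Mapping.nth (parts (strip u)))"
    unfolding exps_nth_filter parts_strip by simp
  with qcoeff[of x] show ?thesis
    unfolding M_coords.rep_eq by (blast intro: quasisym_eq)
qed

lemma qcoeff_eq_mc: "qcoeff x m = mc x (strip (exps m))"
proof -
  have "exps m = exps (Poly_Mapping.nth (exps m))" using exps_nth[OF exps_pos[of m]] by simp
  then have "qcoeff x m = qcoeff x (Poly_Mapping.nth (exps m))"
    using qcoeff[of x] by (blast intro: quasisym_eq)
  then show ?thesis by (simp only: qcoeff_nth)
qed

lemma qsym_eqI: "(\<And>\<beta>. mc x \<beta> = mc y \<beta>) \<Longrightarrow> x = y"
  by (rule qcoeff_inject[THEN iffD1]) (simp add: fun_eq_iff qcoeff_eq_mc)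

lemma nth_parts_eq_0_iff: "Poly_Mapping.nth (parts \<beta>) = 0 \<longleftrightarrow> \<beta> = 0"
proof -
  have "Poly_Mapping.nth (parts \<beta>) = 0 \<longleftrightarrow> exps (Poly_Mapping.nth (parts \<beta>)) = []"
    by (simp add: exps_eq_Nil)
  also have "\<dots> \<longleftrightarrow> \<beta> = 0"
    using exps_nth[of "parts \<beta>"] parts[of \<beta>] by (metis mem_Collect_eq parts_inject zero_comp.rep_eq)
  finally show ?thesis .
qed

lemma mdeg_nth_parts: "mdeg (Poly_Mapping.nth (parts \<beta>)) = csize \<beta>"
  using exps_nth[of "parts \<beta>"] parts[of \<beta>] by (simp add: mdeg_exps csize_def)

lemma mc_0: "mc 0 \<beta> = 0"
  by (simp add: M_coords.rep_eq zero_qsym.rep_eq)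

lemma mc_1: "mc (1 :: 'f::comm_ring_1 qsym) \<beta> = (if \<beta> = 0 then 1 else 0)"
  by (simp add: M_coords.rep_eq one_qsym.rep_eq nth_parts_eq_0_iff)

lemma mc_add: "mc (x + y) \<beta> = mc x \<beta> + mc y \<beta>"
  by (simp add: M_coords.rep_eq plus_qsym.rep_eq)

lemma mc_sum: "mc (sum f A) \<beta> = (\<Sum>a\<in>A. mc (f a) \<beta>)"
  by (induction A rule: infinite_finite_induct) (auto simp: mc_add mc_0)

lemma mc_scale: "mc (scale_qsym c x) \<beta> = c * mc x \<beta>"
  by (simp add: M_coords.rep_eq scale_qsym.rep_eq)

lemma mc_monomial: "mc (monomial_qsym \<gamma>) \<beta> = (if \<beta> = \<gamma> then 1 else 0)"
proof -
  have "0 \<notin> set (parts \<beta>)" using parts[of \<beta>] by simp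
  then show ?thesis by (simp add: M_coords.rep_eq monomial_qsym.rep_eq exps_nth parts_inject)
qed

lemma M_coords_monomial: "M_coords (monomial_qsym \<gamma>) = Poly_Mapping.single \<gamma> 1"
  by (rule poly_mapping_eqI) (simp add: mc_monomial lookup_single when_def eq_commute)

lemma mc_hom: "mc (hom_qsym n x) \<beta> = (if csize \<beta> = n then mc x \<beta> else 0)"
  by (simp add: M_coords.rep_eq hom_qsym.rep_eq mdeg_nth_parts)

text \<open>The dominated vectors \<open>u\<close> are the exponents of the divisors of the monomial with
  exponents \<open>\<alpha>\<close>; deleting zeros turns them into compositions.\<close>

lemma mc_mult:
  "mc (x * y) \<alpha> = (\<Sum>u | list_all2 (\<le>) u (parts \<alpha>). mc x (strip u) * mc y (strip (map2 (-) (parts \<alpha>) u)))"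
proof -
  define xs where "xs = parts \<alpha>"
  let ?n = "length xs"
  let ?l = "\<lambda>a :: mon. map (Poly_Mapping.lookup a) [0..<?n]"
  have lk: "Poly_Mapping.nth (?l a) = a" if "a + b = Poly_Mapping.nth xs" for a b
  proof (rule poly_mapping_eqI)
    fix v
    have "Poly_Mapping.lookup a v + Poly_Mapping.lookup b v = nth_default 0 xs v"
      using arg_cong[OF that, of "\<lambda>m. Poly_Mapping.lookup m v"] by (simp add: lookup_add)
    then show "Poly_Mapping.lookup (Poly_Mapping.nth (?l a)) v = Poly_Mapping.lookup a v"
      by (cases "v < ?n") (auto simp: nth_default_def)
  qed
  have le: "list_all2 (\<le>) (?l a) xs" "?l b = map2 (-) xs (?l a)" if "a + b = Poly_Mapping.nth xs" for a b
  proof -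
    have *: "Poly_Mapping.lookup a v + Poly_Mapping.lookup b v = xs ! v" if "v < ?n" for v
      using arg_cong[OF \<open>a + b = _\<close>, of "\<lambda>m. Poly_Mapping.lookup m v"] that
      by (simp add: lookup_add nth_default_def)
    show "list_all2 (\<le>) (?l a) xs" using * by (fastforce simp: list_all2_conv_all_nth)
    show "?l b = map2 (-) xs (?l a)" using * by (intro nth_equalityI) (fastforce+)
  qed
  have add: "Poly_Mapping.nth u + Poly_Mapping.nth (map2 (-) xs u) = Poly_Mapping.nth xs"
    if "list_all2 (\<le>) u xs" for u
    using that by (intro poly_mapping_eqI) (auto simp: lookup_add nth_default_def list_all2_conv_all_nth)
  have "mc (x * y) \<alpha> = (\<Sum>(a, b) | a + b = Poly_Mapping.nth xs. qcoeff x a * qcoeff y b)"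
    by (simp add: M_coords.rep_eq times_qsym.rep_eq psmult_def xs_def)
  also have "\<dots> = (\<Sum>u | list_all2 (\<le>) u xs. qcoeff x (Poly_Mapping.nth u) * qcoeff y (Poly_Mapping.nth (map2 (-) xs u)))"
  proof (rule sum.reindex_bij_witness[of _ "\<lambda>u. (Poly_Mapping.nth u, Poly_Mapping.nth (map2 (-) xs u))" "?l \<circ> fst"], goal_cases)
    case (1 p)
    then obtain a b where p: "p = (a, b)" "a + b = Poly_Mapping.nth xs" "b + a = Poly_Mapping.nth xs"
      by (auto simp: add.commute)
    then show ?case using lk[OF p(2)] lk[OF p(3)] le[OF p(2)] by simp
  next
    case (2 p)
    then show ?case using le by auto
  next
    case (3 u)
    then show ?case by (auto intro!: nth_equalityI simp: list_all2_conv_all_nth nth_default_def)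
  next
    case (4 u)
    then show ?case using add by simp
  next
    case (5 p)
    then obtain a b where p: "p = (a, b)" "a + b = Poly_Mapping.nth xs" "b + a = Poly_Mapping.nth xs"
      by (auto simp: add.commute)
    then show ?case using lk[OF p(2)] lk[OF p(3)] le[OF p(2)] by simp
  qed
  finally show ?thesis unfolding qcoeff_nth xs_def .
qed

lemma sum_dominated_Cons:
  "(\<Sum>u | list_all2 (\<le>) u (r # rs). f u) = (\<Sum>i\<le>r. \<Sum>u | list_all2 (\<le>) u (rs :: nat list). f (i # u))"
proof -
  have "(\<Sum>u | list_all2 (\<le>) u (r # rs). f u) = (\<Sum>(i, u)\<in>{..r} \<times> {u. list_all2 (\<le>) u rs}. f (i # u))"
    by (rule sum.reindex_bij_witness[of _ "\<lambda>(i, u). i # u" "\<lambda>u. (hd u, tl u)"])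
       (auto simp: list_all2_Cons2)
  then show ?thesis by (simp add: sum.cartesian_product)
qed

lemma sum_dominated_append:
  "(\<Sum>u | list_all2 (\<le>) u (xs @ ys). f u) =
    (\<Sum>u | list_all2 (\<le>) u xs. \<Sum>v | list_all2 (\<le>) v (ys :: nat list). f (u @ v))"
  by (induction xs arbitrary: f) (simp_all add: sum_dominated_Cons)

section \<open>Triangularity of the quasisymmetric Schur functions\<close>

lemma nth_pos_if_zero_notin: "0 \<notin> set xs \<Longrightarrow> i < length xs \<Longrightarrow> 0 < (xs ! i :: nat)"
  by (metis gr0I nth_mem)

text \<open>The boxes are grouped by entry; the exponent of a variable is the number of boxes in its
  group.\<close>

lemma boxes_weight_sum:
  assumes "finite A" "\<And>b. b \<in> boxes xs \<Longrightarrow> case_prod T b - 1 \<in> A"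
  shows "(\<Sum>b\<in>boxes xs. g (case_prod T b - 1)) = (\<Sum>v\<in>A. g v * Poly_Mapping.lookup (weight xs T) v)"
proof -
  have "(\<Sum>b\<in>boxes xs. g (case_prod T b - 1))
      = (\<Sum>v\<in>A. \<Sum>b | b \<in> boxes xs \<and> case_prod T b - 1 = v. g (case_prod T b - 1))"
    using assms finite_boxes by (intro sum.group[symmetric]) auto
  also have "\<dots> = (\<Sum>v\<in>A. g v * Poly_Mapping.lookup (weight xs T) v)"
    by (intro sum.cong refl) (simp add: lookup_weight mult.commute)
  finally show ?thesis .
qed

lemma sum_boxes: "(\<Sum>(i, c)\<in>boxes xs. g i) = (\<Sum>i<length xs. g i * xs ! i :: nat)"
proof -
  have "(\<Sum>(i, c)\<in>boxes xs. g i) = (\<Sum>i<length xs. \<Sum>c<xs ! i. g i)"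
    unfolding boxes_def by (rule sum.Sigma[symmetric]) auto
  then show ?thesis by (simp add: mult.commute)
qed

text \<open>A strictly monotone statistic for the triangularity: the entry \<open>T i c\<close> of a tableau with
  \<open>k\<close> distinct entries and \<open>l\<close> rows is at most \<open>k\<close> minus the number of rows below \<open>i\<close>, so summing
  over all boxes compares the statistic of the content with that of the shape.\<close>

definition corank :: "nat list \<Rightarrow> nat" where
  "corank xs = (\<Sum>i<length xs. (length xs - 1 - i) * xs ! i)"

context
  fixes xs ys T
  assumes tab: "tableau xs T" and w: "weight xs T = Poly_Mapping.nth ys"
    and xs: "0 \<notin> set xs" and ys: "0 \<notin> set ys"
begin

lemma tableau_entry_pos: "(i, c) \<in> boxes xs \<Longrightarrow> 0 < T i c"
  using tab by (auto simp: tableau_def)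

lemma tableau_entry_le:
  assumes "(i, c) \<in> boxes xs"
  shows "T i c \<le> length ys"
proof -
  have "T i c - 1 \<in> Poly_Mapping.keys (Poly_Mapping.nth ys)"
    using tableau_entry[OF tab] tableau_entry_pos[OF assms] w by auto
  then have "nth_default 0 ys (T i c - 1) \<noteq> 0"
    unfolding in_keys_iff lookup_nth .
  then have "T i c - 1 < length ys" by (auto simp: nth_default_def split: if_splits)
  then show ?thesis by linarith
qed

text \<open>The first column increases strictly, so every row below row \<open>i\<close> raises its
  entry by at least one, and the last of these entries is at most \<open>length ys\<close>.\<close>

lemma tableau_first_column:
  assumes "i < length xs"
  shows "T i 0 + (length xs - 1 - i) \<le> length ys"
proof -
  have "T i 0 + d \<le> T (i + d) 0" if "i + d < length xs" for d
    using that
  proof (induction d)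
    case (Suc d)
    have "T (i + d) 0 < T (i + Suc d) 0" using tab Suc.prems by (auto simp: tableau_def)
    with Suc show ?case by simp
  qed simp
  from this[of "length xs - 1 - i"] have "T i 0 + (length xs - 1 - i) \<le> T (length xs - 1) 0"
    using assms by simp
  moreover have "(length xs - 1, 0) \<in> boxes xs"
    using assms nth_pos_if_zero_notin[OF xs, of "length xs - 1"] by (simp add: boxes_def)
  then have "T (length xs - 1) 0 \<le> length ys" by (rule tableau_entry_le)
  ultimately show ?thesis by (rule order_trans)
qed

lemma tableau_entry_corank:
  assumes "(i, c) \<in> boxes xs"
  shows "T i c + (length xs - 1 - i) \<le> length ys"
proof -
  have "T i c \<le> T i 0"
  proof (induction c)
    case (Suc c)
    have "T i (Suc c) \<le> T i c" using tab by (auto simp: tableau_def)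
    with Suc show ?case by simp
  qed simp
  moreover have "i < length xs" using assms by (auto simp: boxes_def)
  ultimately show ?thesis using tableau_first_column[of i] by simp
qed

lemma weight_sum_nth:
  "(\<Sum>b\<in>boxes xs. g (case_prod T b - 1)) = (\<Sum>v<length ys. g v * ys ! v)"
proof -
  have "(\<Sum>b\<in>boxes xs. g (case_prod T b - 1))
      = (\<Sum>v<length ys. g v * Poly_Mapping.lookup (weight xs T) v)"
  proof (rule boxes_weight_sum)
    fix b assume b: "b \<in> boxes xs"
    obtain i c where "b = (i, c)" by fastforce
    then show "case_prod T b - 1 \<in> {..<length ys}"
      using b tableau_entry_le[of i c] tableau_entry_pos[of i c] by auto
  qed simp
  also have "\<dots> = (\<Sum>v<length ys. g v * ys ! v)"
    unfolding w by (intro sum.cong) (auto simp: nth_default_def)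
  finally show ?thesis .
qed

lemma tableau_size: "sum_list ys = sum_list xs"
proof -
  have "sum_list ys = (\<Sum>b\<in>boxes xs. 1)"
    using weight_sum_nth[of "\<lambda>_. 1"] by (simp add: sum_list_sum_nth atLeast0LessThan)
  also have "\<dots> = sum_list xs"
    using sum_boxes[of "\<lambda>_. 1" xs] by (simp add: sum_list_sum_nth atLeast0LessThan)
  finally show ?thesis .
qed

text \<open>An entry belongs to the variable with index one less, so the factor
  \<open>length ys - 1 - v\<close> becomes \<open>length ys - T i c\<close>; positive entries keep
  the truncated subtraction harmless.\<close>

lemma corank_content: "corank ys = (\<Sum>(i, c)\<in>boxes xs. length ys - T i c)"
proof -
  have "corank ys = (\<Sum>b\<in>boxes xs. length ys - 1 - (case_prod T b - 1))"
    unfolding corank_def by (rule weight_sum_nth[symmetric])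
  also have "\<dots> = (\<Sum>(i, c)\<in>boxes xs. length ys - T i c)"
    by (rule sum.cong) (auto dest!: tableau_entry_pos)
  finally show ?thesis .
qed

lemma corank_shape: "corank xs = (\<Sum>(i, c)\<in>boxes xs. length xs - 1 - i)"
  unfolding corank_def by (rule sum_boxes[symmetric])

lemma corank_le: "corank xs \<le> corank ys"
  unfolding corank_content corank_shape
  by (rule sum_mono) (auto dest!: tableau_entry_corank)

text \<open>The two sums compare box by box, so equality of the totals forces equality in every box.
  Each entry is then its row number plus a shift common to all boxes, and only the value of the
  shift is left to determine.\<close>

lemma tableau_corank_eq:
  assumes eq: "corank xs = corank ys"
  shows "ys = xs" "T = (\<lambda>i c. if (i, c) \<in> boxes xs then Suc i else 0)"
proof -
  have "(\<lambda>(i, c). length xs - 1 - i) b = (\<lambda>(i, c). length ys - T i c) b" if "b \<in> boxes xs" for b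
  proof (rule sum_mono_inv[OF _ _ that finite_boxes])
    show "(\<Sum>(i, c)\<in>boxes xs. length xs - 1 - i) = (\<Sum>(i, c)\<in>boxes xs. length ys - T i c)"
      using eq unfolding corank_content corank_shape .
  qed (auto dest!: tableau_entry_corank)
  from this[of "(i, c)" for i c]
  have e: "length xs - 1 - i = length ys - T i c" if "(i, c) \<in> boxes xs" for i c
    using that by simp
  have len: "length ys = length xs"
  proof (cases "ys = []")
    case True
    then have "sum_list xs = 0" using tableau_size by simp
    then show ?thesis using xs True by (cases xs) auto
  next
    case False
    \<comment> \<open>The content uses the first variable, so some box has entry 1. This fixes the
      common shift and forces equal lengths.\<close>
    then have "ys ! 0 \<noteq> 0" using nth_pos_if_zero_notin[OF ys, of 0] by simp
    then have "Poly_Mapping.lookup (weight xs T) 0 \<noteq> 0"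
      unfolding w using False by (simp add: nth_default_def)
    then have "{b \<in> boxes xs. case_prod T b - 1 = 0} \<noteq> {}"
      unfolding lookup_weight by (metis card.empty)
    then obtain i c where b: "(i, c) \<in> boxes xs" "T i c - 1 = 0" by auto
    then have "T i c = 1" using tableau_entry_pos[OF b(1)] by simp
    moreover have "i < length xs" using b(1) by (auto simp: boxes_def)
    moreover have "0 < T 0 0"
    proof -
      have "0 < xs ! 0" using nth_pos_if_zero_notin[OF xs, of 0] \<open>i < length xs\<close> by (cases xs) auto
      then show ?thesis using \<open>i < length xs\<close> by (intro tableau_entry_pos) (auto simp: boxes_def)
    qed
    ultimately show ?thesis
      using e[OF b(1)] tableau_entry_corank[OF b(1)] tableau_first_column[of 0] False
      by linarith
  qed
  have T: "T i c = Suc i" if "(i, c) \<in> boxes xs" for i c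
    using e[OF that] tableau_entry_corank[OF that] tableau_entry_le[OF that] that len
    by (auto simp: boxes_def)
  show "T = (\<lambda>i c. if (i, c) \<in> boxes xs then Suc i else 0)"
    using T tab by (intro ext) (auto simp: tableau_def)
  show "ys = xs"
  proof (rule nth_equalityI[OF len])
    fix v assume v: "v < length ys"
    have "ys ! v = Poly_Mapping.lookup (weight xs T) v" using v by (simp add: w nth_default_def)
    also have "{b \<in> boxes xs. case_prod T b - 1 = v} = {v} \<times> {..<xs ! v}"
      using T v len by (auto simp: boxes_def)
    then have "Poly_Mapping.lookup (weight xs T) v = xs ! v" unfolding lookup_weight by simp
    finally show "ys ! v = xs ! v" .
  qed
qed

end

text \<open>Row \<open>i\<close> is constantly \<open>i + 1\<close>. The existence of this filling,
  together with the uniqueness in \<open>tableau_corank_eq\<close>, makes the diagonal of the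
  transition matrix equal to 1.\<close>

lemma superstandard_tableau:
  defines "T \<equiv> \<lambda>xs i c. if (i, c) \<in> boxes xs then Suc i else 0"
  assumes "0 \<notin> set xs"
  shows "tableau xs (T xs)" "weight xs (T xs) = Poly_Mapping.nth xs"
proof -
  have "0 < xs ! i" if "i < length xs" for i using that assms(2) by (intro nth_pos_if_zero_notin)
  then show "tableau xs (T xs)"
    unfolding tableau_def T_def by (intro conjI allI impI) (simp_all add: boxes_def split: if_splits)
  show "weight xs (T xs) = Poly_Mapping.nth xs"
  proof (rule poly_mapping_eqI)
    fix v
    have "{b \<in> boxes xs. case_prod (T xs) b - 1 = v} = (if v < length xs then {v} \<times> {..<xs ! v} else {})"
      by (auto simp: boxes_def T_def)
    then show "Poly_Mapping.lookup (weight xs (T xs)) v = Poly_Mapping.lookup (Poly_Mapping.nth xs) v"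
      unfolding lookup_weight by (simp add: nth_default_def)
  qed
qed

lemma mc_schur:
  "mc (quasi_schur \<beta>) \<gamma> =
    of_nat (card {T. tableau (parts \<beta>) T \<and> weight (parts \<beta>) T = Poly_Mapping.nth (parts \<gamma>)})"
  by (simp add: M_coords.rep_eq quasi_schur.rep_eq)

lemma parts_pos: "0 \<notin> set (parts \<beta>)"
  using parts[of \<beta>] by simp

lemma mc_schur_nonzeroE:
  assumes "mc (quasi_schur \<beta> :: 'f::semiring_1 qsym) \<gamma> \<noteq> 0"
  obtains T where "tableau (parts \<beta>) T" "weight (parts \<beta>) T = Poly_Mapping.nth (parts \<gamma>)"
proof -
  have "{T. tableau (parts \<beta>) T \<and> weight (parts \<beta>) T = Poly_Mapping.nth (parts \<gamma>)} \<noteq> {}"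
    using assms unfolding mc_schur by (metis card.empty of_nat_0)
  then show ?thesis using that by blast
qed

lemma mc_schur_size: "mc (quasi_schur \<beta> :: 'f::semiring_1 qsym) \<gamma> \<noteq> 0 \<Longrightarrow> csize \<gamma> = csize \<beta>"
  by (erule mc_schur_nonzeroE) (simp add: csize_def tableau_size[OF _ _ parts_pos parts_pos])

lemma mc_schur_corank:
  assumes "mc (quasi_schur \<beta> :: 'f::semiring_1 qsym) \<gamma> \<noteq> 0" "\<gamma> \<noteq> \<beta>"
  shows "corank (parts \<beta>) < corank (parts \<gamma>)"
proof -
  obtain T where T: "tableau (parts \<beta>) T" "weight (parts \<beta>) T = Poly_Mapping.nth (parts \<gamma>)"
    using mc_schur_nonzeroE[OF assms(1)] .
  have "corank (parts \<beta>) \<noteq> corank (parts \<gamma>)"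
    using tableau_corank_eq(1)[OF T parts_pos parts_pos] assms(2) by (metis parts_inject)
  then show ?thesis using corank_le[OF T parts_pos parts_pos] by simp
qed

lemma mc_schur_self: "mc (quasi_schur \<beta> :: 'f::semiring_1 qsym) \<beta> = 1"
proof -
  let ?T = "\<lambda>i c. if (i, c) \<in> boxes (parts \<beta>) then Suc i else 0"
  have *: "T = ?T" if "tableau (parts \<beta>) T" "weight (parts \<beta>) T = Poly_Mapping.nth (parts \<beta>)" for T
    by (rule tableau_corank_eq(2)[OF that parts_pos parts_pos refl])
  have "{T. tableau (parts \<beta>) T \<and> weight (parts \<beta>) T = Poly_Mapping.nth (parts \<beta>)} = {?T}"
  proof (intro equalityI subsetI)
    fix T assume "T \<in> {T. tableau (parts \<beta>) T \<and> weight (parts \<beta>) T = Poly_Mapping.nth (parts \<beta>)}"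
    then show "T \<in> {?T}" unfolding singleton_iff mem_Collect_eq by (elim conjE) (rule *)
  next
    fix T assume "T \<in> {?T}"
    then have "T = ?T" by (rule singletonD)
    with superstandard_tableau[OF parts_pos[of \<beta>]]
    show "T \<in> {T. tableau (parts \<beta>) T \<and> weight (parts \<beta>) T = Poly_Mapping.nth (parts \<beta>)}"
      by (simp only: mem_Collect_eq simp_thms)
  qed
  then have "card {T. tableau (parts \<beta>) T \<and> weight (parts \<beta>) T = Poly_Mapping.nth (parts \<beta>)} = 1"
    by simp
  then show ?thesis unfolding mc_schur by simp
qed

lemma corank_bound: "corank (parts \<beta>) \<le> csize \<beta> * csize \<beta>"
proof -
  have "length (parts \<beta>) \<le> csize \<beta>" using length_le_sum_list[OF parts_pos] by (simp add: csize_def)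
  then have "corank (parts \<beta>) \<le> (\<Sum>i<length (parts \<beta>). csize \<beta> * parts \<beta> ! i)"
    unfolding corank_def by (intro sum_mono mult_right_mono) auto
  also have "\<dots> = csize \<beta> * csize \<beta>"
    by (simp add: csize_def sum_list_sum_nth atLeast0LessThan sum_distrib_left)
  finally show ?thesis .
qed

text \<open>Reverses \<open>corank\<close> within one size, so that the off-diagonal monomials of a
  Schur function have smaller height and recursion is possible. By \<open>corank_bound\<close> the
  subtraction never truncates.\<close>

definition height :: "comp \<Rightarrow> nat" where
  "height \<beta> = csize \<beta> * csize \<beta> - corank (parts \<beta>)"

lemma mc_schur_height:
  assumes "mc (quasi_schur \<beta> :: 'f::semiring_1 qsym) \<gamma> \<noteq> 0" "\<gamma> \<noteq> \<beta>"
  shows "height \<gamma> < height \<beta>"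
  using mc_schur_corank[OF assms] mc_schur_size[OF assms(1)] corank_bound[of \<gamma>] corank_bound[of \<beta>]
  by (simp add: height_def)

section \<open>Noncommutative Schur functions as the dual basis\<close>

lemma pairing_lin: "pairing f x = sc.lin (mc x) f"
  by (simp add: pairing_def sc.lin_def)

lemma pairing_monomial: "pairing f (monomial_qsym \<sigma>) = Poly_Mapping.lookup f \<sigma>"
  by (simp add: pairing_def mc_monomial in_keys_iff if_distrib[of "\<lambda>c. _ * c"] cong: if_cong)

lemma pairing_mono: "finite A \<Longrightarrow> Poly_Mapping.keys (M_coords x) \<subseteq> A \<Longrightarrow>
    pairing f x = (\<Sum>\<gamma>\<in>A. Poly_Mapping.lookup f \<gamma> * mc x \<gamma>)"
proof -
  assume A: "finite A" "Poly_Mapping.keys (M_coords x) \<subseteq> A"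
  have "pairing f x = (\<Sum>\<gamma>\<in>Poly_Mapping.keys f \<union> A. Poly_Mapping.lookup f \<gamma> * mc x \<gamma>)"
    unfolding pairing_def using A(1) by (intro sum.mono_neutral_left) (auto simp: in_keys_iff)
  also have "\<dots> = (\<Sum>\<gamma>\<in>A. Poly_Mapping.lookup f \<gamma> * mc x \<gamma>)"
    using A by (intro sum.mono_neutral_right) (auto simp: in_keys_iff)
  finally show ?thesis .
qed

lemma pairing_add: "pairing f (x + y) = pairing f x + pairing f y"
  by (simp add: pairing_def mc_add distrib_left sum.distrib)

lemma pairing_scale: "pairing f (scale_qsym c x) = c * pairing f x"
  by (simp add: pairing_def mc_scale sum_distrib_left mult_ac)

lemma pairing_0: "pairing f 0 = 0"
  by (simp add: pairing_def mc_0)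

lemma keys_schur: "Poly_Mapping.keys (M_coords (quasi_schur \<beta> :: 'f::semiring_1 qsym)) \<subseteq> {\<gamma>. csize \<gamma> = csize \<beta>}"
  using mc_schur_size by (auto simp: in_keys_iff)

text \<open>One row of a unitriangular system: the unknown at \<open>\<beta>\<close> has coefficient
  1 and all others have smaller height. Values on Schur functions thus determine the
  element.\<close>

lemma pairing_schur_rec:
  fixes f :: "'f::field nsym"
  shows "pairing f (quasi_schur \<beta>) = Poly_Mapping.lookup f \<beta> +
    (\<Sum>\<gamma> | csize \<gamma> = csize \<beta> \<and> height \<gamma> < height \<beta>. Poly_Mapping.lookup f \<gamma> * mc (quasi_schur \<beta>) \<gamma>)"
proof -
  have "pairing f (quasi_schur \<beta>) = (\<Sum>\<gamma> | csize \<gamma> = csize \<beta>. Poly_Mapping.lookup f \<gamma> * mc (quasi_schur \<beta>) \<gamma>)"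
    by (rule pairing_mono[OF finite_csize_eq keys_schur])
  also have "\<dots> = (\<Sum>\<gamma> \<in> insert \<beta> {\<gamma>. csize \<gamma> = csize \<beta> \<and> height \<gamma> < height \<beta>}. Poly_Mapping.lookup f \<gamma> * mc (quasi_schur \<beta>) \<gamma>)"
    using finite_csize_eq mc_schur_height[where 'f = 'f, of \<beta>]
    by (intro sum.mono_neutral_right) auto
  also have "\<dots> = Poly_Mapping.lookup f \<beta> +
    (\<Sum>\<gamma> | csize \<gamma> = csize \<beta> \<and> height \<gamma> < height \<beta>. Poly_Mapping.lookup f \<gamma> * mc (quasi_schur \<beta>) \<gamma>)"
    by (subst sum.insert) (auto simp: mc_schur_self intro: finite_subset[OF _ finite_csize_eq[of "csize \<beta>"]])
  finally show ?thesis .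
qed

text \<open>Solves this system by forward substitution for the right-hand side of the dual basis;
  the value at \<open>\<beta>\<close> is the coefficient of H_\<beta>.\<close>

function dual_coeff :: "comp \<Rightarrow> comp \<Rightarrow> 'f::field" where
  "dual_coeff \<alpha> \<beta> = (if \<alpha> = \<beta> then 1 else 0) -
    (\<Sum>\<gamma> | csize \<gamma> = csize \<beta> \<and> height \<gamma> < height \<beta>. dual_coeff \<alpha> \<gamma> * mc (quasi_schur \<beta>) \<gamma>)"
  by auto
termination by (relation "measure (height \<circ> snd)") auto

declare dual_coeff.simps[simp del]

text \<open>The recursion stays within one size, and away from the size of \<open>\<alpha>\<close>
  its inhomogeneous term is zero. Finite support follows.\<close>

lemma dual_coeff_size: "dual_coeff \<alpha> \<beta> \<noteq> (0 :: 'f::field) \<Longrightarrow> csize \<beta> = csize \<alpha>"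
proof (induction \<beta> rule: measure_induct_rule[of height])
  case (less \<beta>)
  show ?case
  proof (rule ccontr)
    assume n: "csize \<beta> \<noteq> csize \<alpha>"
    have "dual_coeff \<alpha> \<gamma> = (0 :: 'f)" if "csize \<gamma> = csize \<beta>" "height \<gamma> < height \<beta>" for \<gamma>
      using less.IH[OF that(2)] that(1) n by auto
    then have "(\<Sum>\<gamma> | csize \<gamma> = csize \<beta> \<and> height \<gamma> < height \<beta>. dual_coeff \<alpha> \<gamma> * mc (quasi_schur \<beta>) \<gamma>) = (0 :: 'f)"
      by (intro sum.neutral) auto
    then have "dual_coeff \<alpha> \<beta> = (0 :: 'f)" using n by (subst dual_coeff.simps) auto
    with less.prems show False by simp
  qed
qed

lemma nc_schur_dual_unique:
  fixes s t :: "'f::field nsym"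
  assumes "\<And>\<beta>. pairing s (quasi_schur \<beta>) = pairing t (quasi_schur \<beta>)"
  shows "s = t"
proof (rule poly_mapping_eqI)
  fix \<beta>
  show "Poly_Mapping.lookup s \<beta> = Poly_Mapping.lookup t \<beta>"
  proof (induction \<beta> rule: measure_induct_rule[of height])
    case (less \<beta>)
    then have "(\<Sum>\<gamma> | csize \<gamma> = csize \<beta> \<and> height \<gamma> < height \<beta>. Poly_Mapping.lookup s \<gamma> * mc (quasi_schur \<beta>) \<gamma>)
        = (\<Sum>\<gamma> | csize \<gamma> = csize \<beta> \<and> height \<gamma> < height \<beta>. Poly_Mapping.lookup t \<gamma> * mc (quasi_schur \<beta>) \<gamma>)"
      by (intro sum.cong) auto
    then show ?case using assms[of \<beta>] unfolding pairing_schur_rec by simp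
  qed
qed

lemma lookup_dual_coeff:
  "Poly_Mapping.lookup (Abs_poly_mapping (dual_coeff \<alpha> :: comp \<Rightarrow> 'f::field)) = dual_coeff \<alpha>"
proof -
  have "finite {\<beta>. dual_coeff \<alpha> \<beta> \<noteq> (0 :: 'f)}"
    by (rule finite_subset[OF _ finite_csize_eq[of "csize \<alpha>"]]) (auto dest: dual_coeff_size)
  then show ?thesis by (simp add: Abs_poly_mapping_inverse)
qed

lemma nc_schur_eq: "nc_schur \<alpha> = (Abs_poly_mapping (dual_coeff \<alpha>) :: 'f::field nsym)"
proof -
  have *: "pairing (Abs_poly_mapping (dual_coeff \<alpha>) :: 'f nsym) (quasi_schur \<beta>) = (if \<alpha> = \<beta> then 1 else 0)" for \<beta>
    unfolding pairing_schur_rec lookup_dual_coeff by (subst dual_coeff.simps) simp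
  show ?thesis unfolding nc_schur_def
  proof (rule the_equality)
    fix s :: "'f nsym" assume "\<forall>\<beta>. pairing s (quasi_schur \<beta>) = (if \<alpha> = \<beta> then 1 else 0)"
    then show "s = Abs_poly_mapping (dual_coeff \<alpha>)" by (intro nc_schur_dual_unique) (simp add: *)
  qed (simp add: *)
qed

lemma pairing_nc_schur: "pairing (nc_schur \<alpha>) (quasi_schur \<beta> :: 'f::field qsym) = (if \<alpha> = \<beta> then 1 else 0)"
  unfolding nc_schur_eq pairing_schur_rec lookup_dual_coeff by (subst dual_coeff.simps) simp

lemma nc_schur_size: "Poly_Mapping.lookup (nc_schur \<alpha> :: 'f::field nsym) \<beta> \<noteq> 0 \<Longrightarrow> csize \<beta> = csize \<alpha>"
  unfolding nc_schur_eq lookup_dual_coeff by (rule dual_coeff_size)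

lemma qsym_expand: "qs.lin monomial_qsym (M_coords x) = (x :: 'f::field qsym)"
  by (rule qsym_eqI) (simp add: qs.lin_def mc_sum mc_scale mc_monomial in_keys_iff if_distrib[of "\<lambda>c. _ * c"] cong: if_cong)


text \<open>Inverts the unitriangular expansion: the monomial function is its Schur function minus
  monomial functions of smaller height, which induction covers.\<close>

lemma monomial_in_schur_span:
  "(monomial_qsym \<gamma> :: 'f::field qsym) \<in> qs.span (quasi_schur ` {\<alpha>. csize \<alpha> = csize \<gamma>})"
proof (induction \<gamma> rule: measure_induct_rule[of height])
  case (less \<gamma>)
  let ?A = "{\<alpha>. csize \<alpha> = csize \<gamma>}"
  let ?S = "quasi_schur \<gamma> :: 'f qsym"
  have "?S = (\<Sum>\<delta>\<in>?A. scale_qsym (mc ?S \<delta>) (monomial_qsym \<delta>))"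
    using qs.lin_superset[OF finite_csize_eq keys_schur] qsym_expand[of ?S] by metis
  also have "\<dots> = monomial_qsym \<gamma> + (\<Sum>\<delta>\<in>?A - {\<gamma>}. scale_qsym (mc ?S \<delta>) (monomial_qsym \<delta>))"
    by (subst sum.remove[of _ \<gamma>]) (auto simp: finite_csize_eq mc_schur_self)
  finally have "monomial_qsym \<gamma> = ?S - (\<Sum>\<delta>\<in>?A - {\<gamma>}. scale_qsym (mc ?S \<delta>) (monomial_qsym \<delta>))"
    by (simp add: algebra_simps)
  also have "\<dots> \<in> qs.span (quasi_schur ` ?A)"
  proof (intro qs.span_diff qs.span_sum)
    show "?S \<in> qs.span (quasi_schur ` ?A)" by (auto intro: qs.span_base)
    fix \<delta> assume \<delta>: "\<delta> \<in> ?A - {\<gamma>}"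
    show "scale_qsym (mc ?S \<delta>) (monomial_qsym \<delta>) \<in> qs.span (quasi_schur ` ?A)"
    proof (cases "mc ?S \<delta> = 0")
      case True
      then show ?thesis by (simp add: qs.span_zero)
    next
      case False
      then have "height \<delta> < height \<gamma>" using mc_schur_height \<delta> by blast
      from less.IH[OF this] \<delta> show ?thesis by (simp add: qs.span_scale)
    qed
  qed
  finally show ?case .
qed

text \<open>The cutoff makes the dual-basis expansion a finite sum \<open>P\<close>. Its fixed
  points form a subspace containing the Schur functions of size at most \<open>N\<close>, hence
  their span, and triangularity puts \<open>x\<close> into that span.\<close>

lemma schur_expand:
  fixes x :: "'f::field qsym"
  assumes x: "Poly_Mapping.keys (M_coords x) \<subseteq> {\<gamma>. csize \<gamma> \<le> N}"
  shows "x = (\<Sum>\<alpha> | csize \<alpha> \<le> N. scale_qsym (pairing (nc_schur \<alpha>) x) (quasi_schur \<alpha>))"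
proof -
  let ?A = "{\<alpha>. csize \<alpha> \<le> N}"
  define P where "P = (\<lambda>x :: 'f qsym. \<Sum>\<alpha>\<in>?A. scale_qsym (pairing (nc_schur \<alpha>) x) (quasi_schur \<alpha>))"
  have P_0: "P 0 = 0" and P_add: "P (x + y) = P x + P y" and P_scale: "P (scale_qsym c x) = scale_qsym c (P x)" for x y c
    unfolding P_def
    by (simp_all only: pairing_0 pairing_add pairing_scale qs.scale_zero_left sum.neutral_const
        qs.scale_left_distrib sum.distrib qs.scale_sum_right qs.scale_scale)
  have P_schur: "P (quasi_schur \<beta>) = quasi_schur \<beta>" if "\<beta> \<in> ?A" for \<beta>
  proof -
    have "P (quasi_schur \<beta>) = (\<Sum>\<alpha>\<in>?A. if \<alpha> = \<beta> then quasi_schur \<alpha> else 0)"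
      unfolding P_def pairing_nc_schur by (intro sum.cong) auto
    then show ?thesis using that finite_csize_le[of N] by simp
  qed
  have "qs.span (quasi_schur ` ?A) \<subseteq> {x. x = P x}"
  proof (rule qs.span_minimal)
    show "quasi_schur ` ?A \<subseteq> {x. x = P x}" using P_schur by (metis (mono_tags) image_subsetI mem_Collect_eq)
    show "qs.subspace {x. x = P x}"
      by (rule qs.subspaceI) (simp_all only: mem_Collect_eq P_0, metis P_add, metis P_scale)
  qed
  moreover have "x \<in> qs.span (quasi_schur ` ?A)"
  proof -
    have "x = qs.lin monomial_qsym (M_coords x)" by (simp add: qsym_expand)
    also have "\<dots> \<in> qs.span (quasi_schur ` ?A)"
      unfolding qs.lin_def
    proof (intro qs.span_sum qs.span_scale)
      fix \<gamma> assume "\<gamma> \<in> Poly_Mapping.keys (M_coords x)"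
      then have "{\<alpha>. csize \<alpha> = csize \<gamma>} \<subseteq> ?A" using x by auto
      then show "monomial_qsym \<gamma> \<in> qs.span (quasi_schur ` ?A :: 'f qsym set)"
        using monomial_in_schur_span[of \<gamma>] qs.span_mono[OF image_mono] by blast
    qed
    finally show ?thesis .
  qed
  ultimately have "x = P x" by blast
  then show ?thesis unfolding P_def .
qed

text \<open>The transpose of the expansion of monomial functions into Schur functions: the
  coefficient at \<open>\<gamma>\<close> is the \<open>\<delta>\<close>-coordinate of the expansion
  of M_\<gamma>.\<close>

lemma H_expand:
  fixes \<delta> :: comp
  assumes "csize \<delta> \<le> N"
  shows "(\<Sum>\<alpha> | csize \<alpha> \<le> N. scale_pm (mc (quasi_schur \<alpha> :: 'f::field qsym) \<delta>) (nc_schur \<alpha>)) = Poly_Mapping.single \<delta> 1"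
proof (rule poly_mapping_eqI)
  fix \<gamma>
  let ?M = "monomial_qsym \<gamma> :: 'f qsym"
  \<comment> \<open>Expanding \<open>?M\<close> needs the larger cutoff. The surplus terms vanish at
    \<open>\<delta>\<close>, since their sizes exceed that of \<open>\<delta>\<close>.\<close>
  let ?A = "{\<alpha>. csize \<alpha> \<le> max N (csize \<gamma>)}"
  have "Poly_Mapping.keys (M_coords ?M) \<subseteq> {\<gamma>'. csize \<gamma>' \<le> max N (csize \<gamma>)}"
    by (auto simp: in_keys_iff mc_monomial split: if_splits)
  then have "?M = (\<Sum>\<alpha>\<in>?A. scale_qsym (pairing (nc_schur \<alpha>) ?M) (quasi_schur \<alpha>))"
    by (rule schur_expand)
  then have "mc ?M \<delta> = mc (\<Sum>\<alpha>\<in>?A. scale_qsym (pairing (nc_schur \<alpha>) ?M) (quasi_schur \<alpha>)) \<delta>"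
    by simp
  also have "\<dots> = (\<Sum>\<alpha>\<in>?A. Poly_Mapping.lookup (nc_schur \<alpha>) \<gamma> * mc (quasi_schur \<alpha>) \<delta>)"
    by (simp add: mc_sum mc_scale pairing_monomial)
  also have "\<dots> = (\<Sum>\<alpha> | csize \<alpha> \<le> N. Poly_Mapping.lookup (nc_schur \<alpha>) \<gamma> * mc (quasi_schur \<alpha>) \<delta>)"
    using finite_csize_le assms mc_schur_size[where 'f = 'f]
    by (intro sum.mono_neutral_right) (auto simp: le_max_iff_disj)
  finally show "Poly_Mapping.lookup (\<Sum>\<alpha> | csize \<alpha> \<le> N. scale_pm (mc (quasi_schur \<alpha>) \<delta>) (nc_schur \<alpha>)) \<gamma>
      = Poly_Mapping.lookup (Poly_Mapping.single \<delta> (1 :: 'f)) \<gamma>"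
    by (simp add: lookup_sum lookup_scale_pm mc_monomial lookup_single when_def mult.commute)
qed

section \<open>Skew elements\<close>

text \<open>Evaluates the right tensor factor against the coordinate vector \<open>v\<close>.
  Working in coordinates, it serves the coproducts of both Hopf algebras.\<close>

definition contract :: "((comp \<times> comp) \<Rightarrow>\<^sub>0 'f) \<Rightarrow> (comp \<Rightarrow>\<^sub>0 'f) \<Rightarrow> comp \<Rightarrow>\<^sub>0 'f::field" where
  "contract t v = pm.lin (\<lambda>(\<sigma>, \<delta>). Poly_Mapping.single \<sigma> (Poly_Mapping.lookup v \<delta>)) t"

lemma lookup_contract_keys:
  "Poly_Mapping.lookup (contract t v) i =
    (\<Sum>p\<in>Poly_Mapping.keys t. if fst p = i then Poly_Mapping.lookup t p * Poly_Mapping.lookup v (snd p) else 0)"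
  unfolding contract_def pm.lin_def lookup_sum
  by (intro sum.cong refl) (auto simp: scale_pm_single lookup_single when_def)

lemma lookup_contract:
  assumes "finite A" "Poly_Mapping.keys v \<subseteq> A"
  shows "Poly_Mapping.lookup (contract t v) i = (\<Sum>\<delta>\<in>A. Poly_Mapping.lookup t (i, \<delta>) * Poly_Mapping.lookup v \<delta>)"
proof -
  have "Poly_Mapping.lookup (contract t v) i =
    (\<Sum>p\<in>Poly_Mapping.keys t \<union> {i} \<times> A. if fst p = i then Poly_Mapping.lookup t p * Poly_Mapping.lookup v (snd p) else 0)"
    unfolding lookup_contract_keys using assms by (intro sum.mono_neutral_left) (auto simp: in_keys_iff)
  also have "\<dots> = (\<Sum>p\<in>{i} \<times> A. if fst p = i then Poly_Mapping.lookup t p * Poly_Mapping.lookup v (snd p) else 0)"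
    using assms by (intro sum.mono_neutral_right) (auto simp: in_keys_iff)
  also have "\<dots> = (\<Sum>\<delta>\<in>A. Poly_Mapping.lookup t (i, \<delta>) * Poly_Mapping.lookup v \<delta>)"
    by (rule sum.reindex_bij_witness[of _ "\<lambda>\<delta>. (i, \<delta>)" snd]) auto
  finally show ?thesis .
qed

lemma tensor_lin: "tensor f g = pm.lin (\<lambda>i. pm.lin (\<lambda>j. Poly_Mapping.single (i, j) 1) g) f"
  by (simp add: tensor_def pm.lin_def pm.scale_sum_right scale_pm_single)

lemma lookup_tensor: "Poly_Mapping.lookup (tensor f g) (i, j) = Poly_Mapping.lookup f i * Poly_Mapping.lookup g j"
proof -
  have "Poly_Mapping.lookup (tensor f g) (i, j) =
    (\<Sum>i'\<in>Poly_Mapping.keys f. \<Sum>j'\<in>Poly_Mapping.keys g.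
      if i' = i then if j' = j then Poly_Mapping.lookup f i' * Poly_Mapping.lookup g j' else 0 else 0)"
    unfolding tensor_def lookup_sum by (intro sum.cong refl) (auto simp: lookup_single when_def)
  also have "\<dots> = (\<Sum>i'\<in>Poly_Mapping.keys f. if i' = i then \<Sum>j'\<in>Poly_Mapping.keys g.
      if j' = j then Poly_Mapping.lookup f i' * Poly_Mapping.lookup g j' else 0 else 0)"
    by (intro sum.cong refl) auto
  also have "\<dots> = Poly_Mapping.lookup f i * Poly_Mapping.lookup g j"
    by (simp add: in_keys_iff)
  finally show ?thesis .
qed

section \<open>Expansion of the right tensor factor along one of two dual graded bases\<close>

context
  fixes b b' :: "comp \<Rightarrow> comp \<Rightarrow>\<^sub>0 'f::field"
  assumes ortho: "\<And>\<zeta> \<eta>. (\<Sum>\<delta>\<in>Poly_Mapping.keys (b' \<eta>). Poly_Mapping.lookup (b \<zeta>) \<delta> * Poly_Mapping.lookup (b' \<eta>) \<delta>)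
            = (if \<zeta> = \<eta> then 1 else 0)"
    and complete: "\<And>\<delta> j N. csize \<delta> \<le> N \<Longrightarrow>
            (\<Sum>\<eta> | csize \<eta> \<le> N. Poly_Mapping.lookup (b' \<eta>) \<delta> * Poly_Mapping.lookup (b \<eta>) j) = (if j = \<delta> then 1 else 0)"
    and graded: "\<And>\<eta> \<delta>. Poly_Mapping.lookup (b' \<eta>) \<delta> \<noteq> 0 \<Longrightarrow> csize \<eta> = csize \<delta>"
begin

text \<open>Contraction with the dual vector kills every right factor except
  \<open>b \<eta>\<close>, so coefficients of any finite expansion are forced.\<close>

lemma contract_unique:
  assumes fin: "finite {\<eta>. h \<eta> \<noteq> 0}" and t: "t = (\<Sum>\<eta> | h \<eta> \<noteq> 0. tensor (h \<eta>) (b \<eta>))"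
  shows "h \<eta> = contract t (b' \<eta>)"
proof (rule poly_mapping_eqI)
  fix i
  have "Poly_Mapping.lookup (contract t (b' \<eta>)) i =
     (\<Sum>\<delta>\<in>Poly_Mapping.keys (b' \<eta>). \<Sum>\<zeta> | h \<zeta> \<noteq> 0.
        Poly_Mapping.lookup (h \<zeta>) i * (Poly_Mapping.lookup (b \<zeta>) \<delta> * Poly_Mapping.lookup (b' \<eta>) \<delta>))"
    by (subst lookup_contract[OF finite_keys order_refl])
       (simp add: t lookup_sum lookup_tensor sum_distrib_right mult.assoc)
  also have "\<dots> = (\<Sum>\<zeta> | h \<zeta> \<noteq> 0. Poly_Mapping.lookup (h \<zeta>) i * (if \<zeta> = \<eta> then 1 else 0))"
    unfolding ortho[symmetric] sum_distrib_left by (rule sum.swap)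
  also have "\<dots> = (\<Sum>\<zeta> | h \<zeta> \<noteq> 0. if \<zeta> = \<eta> then Poly_Mapping.lookup (h \<zeta>) i else 0)"
    by (intro sum.cong) auto
  also have "\<dots> = Poly_Mapping.lookup (h \<eta>) i" using fin by simp
  finally show "Poly_Mapping.lookup (h \<eta>) i = Poly_Mapping.lookup (contract t (b' \<eta>)) i" ..
qed

text \<open>Completeness reassembles \<open>t\<close> from its contractions. By the grading, indices
  larger than every right index in \<open>t\<close> contract to zero, which makes the expansion
  finite.\<close>

lemma contract_expand:
  shows "finite {\<eta>. contract t (b' \<eta>) \<noteq> 0}"
    and "t = (\<Sum>\<eta> | contract t (b' \<eta>) \<noteq> 0. tensor (contract t (b' \<eta>)) (b \<eta>))"
proof -
  \<comment> \<open>The inserted 0 keeps the maximum defined when \<open>t\<close> is zero.\<close>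
  define N where "N = Max (insert 0 (csize ` snd ` Poly_Mapping.keys t))"
  have N: "csize (snd p) \<le> N" if "p \<in> Poly_Mapping.keys t" for p
    unfolding N_def using that by (intro Max_ge) auto
  have sub: "{\<eta>. contract t (b' \<eta>) \<noteq> 0} \<subseteq> {\<eta>. csize \<eta> \<le> N}"
  proof safe
    fix \<eta> assume nz: "contract t (b' \<eta>) \<noteq> 0"
    show "csize \<eta> \<le> N"
    proof (rule ccontr)
      assume "\<not> csize \<eta> \<le> N"
      then have "Poly_Mapping.lookup (b' \<eta>) (snd p) = 0" if "p \<in> Poly_Mapping.keys t" for p
        using N[OF that] graded[of \<eta> "snd p"] by auto
      then have "contract t (b' \<eta>) = 0"
        by (intro poly_mapping_eqI) (auto simp: lookup_contract_keys intro!: sum.neutral)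
      with nz show False by simp
    qed
  qed
  then show fin: "finite {\<eta>. contract t (b' \<eta>) \<noteq> 0}" using finite_csize_le finite_subset by blast
  have "t = (\<Sum>\<eta> | csize \<eta> \<le> N. tensor (contract t (b' \<eta>)) (b \<eta>))"
  proof (rule poly_mapping_eqI)
    fix p :: "comp \<times> comp"
    obtain i j where p: "p = (i, j)" by fastforce
    let ?t = "Poly_Mapping.lookup t"
    have "Poly_Mapping.lookup (\<Sum>\<eta> | csize \<eta> \<le> N. tensor (contract t (b' \<eta>)) (b \<eta>)) p =
      (\<Sum>\<eta> | csize \<eta> \<le> N. \<Sum>q\<in>Poly_Mapping.keys t.
        if fst q = i then ?t q * (Poly_Mapping.lookup (b' \<eta>) (snd q) * Poly_Mapping.lookup (b \<eta>) j) else 0)"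
      unfolding p lookup_sum lookup_tensor lookup_contract_keys sum_distrib_right
      by (intro sum.cong refl) auto
    also have "\<dots> = (\<Sum>q\<in>Poly_Mapping.keys t. \<Sum>\<eta> | csize \<eta> \<le> N.
        if fst q = i then ?t q * (Poly_Mapping.lookup (b' \<eta>) (snd q) * Poly_Mapping.lookup (b \<eta>) j) else 0)"
      by (rule sum.swap)
    also have "\<dots> = (\<Sum>q\<in>Poly_Mapping.keys t. if q = p then ?t q else 0)"
    proof (intro sum.cong refl)
      fix q assume q: "q \<in> Poly_Mapping.keys t"
      show "(\<Sum>\<eta> | csize \<eta> \<le> N.
        if fst q = i then ?t q * (Poly_Mapping.lookup (b' \<eta>) (snd q) * Poly_Mapping.lookup (b \<eta>) j) else 0) = (if q = p then ?t q else 0)"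
        using complete[OF N[OF q], of j] by (cases "fst q = i"; cases q) (auto simp: p sum_distrib_left[symmetric])
    qed
    also have "\<dots> = ?t p" by (simp add: in_keys_iff)
    finally show "?t p = Poly_Mapping.lookup (\<Sum>\<eta> | csize \<eta> \<le> N. tensor (contract t (b' \<eta>)) (b \<eta>)) p" ..
  qed
  also have "\<dots> = (\<Sum>\<eta> | contract t (b' \<eta>) \<noteq> 0. tensor (contract t (b' \<eta>)) (b \<eta>))"
    using sub finite_csize_le by (intro sum.mono_neutral_right) (auto simp: tensor_def)
  finally show "t = (\<Sum>\<eta> | contract t (b' \<eta>) \<noteq> 0. tensor (contract t (b' \<eta>)) (b \<eta>))" .
qed

end

lemma pairing_keys_right:
  "pairing f x = (\<Sum>\<gamma>\<in>Poly_Mapping.keys (M_coords x). Poly_Mapping.lookup f \<gamma> * mc x \<gamma>)"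
  by (rule pairing_mono) auto

lemma schur_complete_mc:
  assumes "csize \<delta> \<le> N"
  shows "(\<Sum>\<eta> | csize \<eta> \<le> N. Poly_Mapping.lookup (nc_schur \<eta> :: 'f::field nsym) \<delta> * mc (quasi_schur \<eta>) j) = (if j = \<delta> then 1 else 0)"
proof -
  let ?M = "monomial_qsym \<delta> :: 'f qsym"
  have "?M = (\<Sum>\<alpha> | csize \<alpha> \<le> N. scale_qsym (pairing (nc_schur \<alpha>) ?M) (quasi_schur \<alpha>))"
    using assms by (intro schur_expand) (auto simp: in_keys_iff mc_monomial split: if_splits)
  then have "mc ?M j = mc (\<Sum>\<alpha> | csize \<alpha> \<le> N. scale_qsym (pairing (nc_schur \<alpha>) ?M) (quasi_schur \<alpha>)) j"
    by simp
  then show ?thesis by (simp add: mc_sum mc_scale pairing_monomial mc_monomial)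
qed

lemma nc_schur_complete:
  assumes "csize \<delta> \<le> N"
  shows "(\<Sum>\<eta> | csize \<eta> \<le> N. mc (quasi_schur \<eta>) \<delta> * Poly_Mapping.lookup (nc_schur \<eta> :: 'f::field nsym) j) = (if j = \<delta> then 1 else 0)"
  using arg_cong[OF H_expand[OF assms, where 'f = 'f], of "\<lambda>f. Poly_Mapping.lookup f j"]
  by (simp add: lookup_sum lookup_scale_pm lookup_single when_def eq_commute)

lemma skew_nsym_eq: "skew_nsym la = (\<lambda>\<eta>. contract (coprod_nsym (nc_schur la)) (M_coords (quasi_schur \<eta> :: 'f::field qsym)))"
  and skew_nsym_finite: "finite {\<eta>. skew_nsym la \<eta> \<noteq> (0 :: 'f nsym)}"
  and skew_nsym_expand: "coprod_nsym (nc_schur la :: 'f nsym) = (\<Sum>\<eta> | skew_nsym la \<eta> \<noteq> (0 :: 'f nsym). tensor (skew_nsym la \<eta>) (nc_schur \<eta>))"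
proof -
  let ?b = "nc_schur :: comp \<Rightarrow> 'f nsym" and ?b' = "\<lambda>\<eta>. M_coords (quasi_schur \<eta> :: 'f qsym)"
  let ?h = "\<lambda>\<eta>. contract (coprod_nsym (?b la)) (?b' \<eta>)"
  have ortho: "(\<Sum>\<delta>\<in>Poly_Mapping.keys (?b' \<eta>). Poly_Mapping.lookup (?b \<zeta>) \<delta> * Poly_Mapping.lookup (?b' \<eta>) \<delta>)
            = (if \<zeta> = \<eta> then 1 else 0)" for \<zeta> \<eta>
    unfolding pairing_keys_right[symmetric] by (rule pairing_nc_schur)
  have graded: "csize \<eta> = csize \<delta>" if "Poly_Mapping.lookup (?b' \<eta>) \<delta> \<noteq> 0" for \<eta> \<delta>
    using mc_schur_size[OF that] by simp
  note complete = nc_schur_complete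
  show eq: "skew_nsym la = ?h"
    unfolding skew_nsym_def
  proof (rule the_equality, goal_cases)
    case 1
    show ?case using contract_expand[where b = ?b and b' = ?b', OF ortho complete graded] by blast
  next
    case (2 h)
    then show ?case
      by (intro ext contract_unique[where b = ?b and b' = ?b', OF ortho complete graded]) auto
  qed
  show "finite {\<eta>. skew_nsym la \<eta> \<noteq> (0 :: 'f nsym)}"
    unfolding eq by (rule contract_expand(1)[where b = ?b and b' = ?b', OF ortho complete graded])
  show "coprod_nsym (nc_schur la :: 'f nsym) = (\<Sum>\<eta> | skew_nsym la \<eta> \<noteq> (0 :: 'f nsym). tensor (skew_nsym la \<eta>) (nc_schur \<eta>))"
    unfolding eq by (rule contract_expand(2)[where b = ?b and b' = ?b', OF ortho complete graded])
qed

lemma M_coords_lin_monomial: "M_coords (qs.lin monomial_qsym v) = (v :: comp \<Rightarrow>\<^sub>0 'f::field)"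
  by (rule poly_mapping_eqI)
     (simp add: qs.lin_def mc_sum mc_scale mc_monomial in_keys_iff if_distrib[of "\<lambda>c. _ * c"] cong: if_cong)

lemma M_coords_eq_0_iff: "M_coords x = 0 \<longleftrightarrow> x = 0"
  by (metis qsym_eqI mc_0 lookup_zero poly_mapping_eqI)

text \<open>The argument for \<open>skew_nsym\<close> with the two bases exchanged. Uniqueness is
  obtained for coordinates, where the tensors live, and carried back by
  \<open>qsym_expand\<close>.\<close>

lemma skew_qsym_coords: "M_coords (skew_qsym la \<eta>) = contract (coprod_qsym (quasi_schur la)) (nc_schur \<eta> :: 'f::field nsym)"
  and skew_qsym_finite: "finite {\<eta>. skew_qsym la \<eta> \<noteq> (0 :: 'f qsym)}"
  and skew_qsym_expand: "coprod_qsym (quasi_schur la :: 'f qsym) = (\<Sum>\<eta> | skew_qsym la \<eta> \<noteq> (0 :: 'f qsym). tensor_qsym (skew_qsym la \<eta>) (quasi_schur \<eta>))"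
proof -
  let ?b' = "nc_schur :: comp \<Rightarrow> 'f nsym" and ?b = "\<lambda>\<eta>. M_coords (quasi_schur \<eta> :: 'f qsym)"
  let ?h = "\<lambda>\<eta>. contract (coprod_qsym (quasi_schur la)) (?b' \<eta>)"
  have ortho: "(\<Sum>\<delta>\<in>Poly_Mapping.keys (?b' \<eta>). Poly_Mapping.lookup (?b \<zeta>) \<delta> * Poly_Mapping.lookup (?b' \<eta>) \<delta>)
            = (if \<zeta> = \<eta> then 1 else 0)" for \<zeta> \<eta>
    using pairing_nc_schur[of \<eta> \<zeta>, where 'f = 'f] by (auto simp: pairing_def mult.commute)
  have graded: "csize \<eta> = csize \<delta>" if "Poly_Mapping.lookup (?b' \<eta>) \<delta> \<noteq> 0" for \<eta> \<delta>
    using nc_schur_size[OF that] by simp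
  note complete = schur_complete_mc
  have eq: "skew_qsym la = (\<lambda>\<eta>. qs.lin monomial_qsym (?h \<eta>))"
    unfolding skew_qsym_def
  proof (rule the_equality, goal_cases)
    case 1
    have nz: "qs.lin monomial_qsym (?h \<eta>) \<noteq> 0 \<longleftrightarrow> ?h \<eta> \<noteq> 0" for \<eta>
      using M_coords_eq_0_iff[of "qs.lin monomial_qsym (?h \<eta>)"] unfolding M_coords_lin_monomial by blast
    show ?case unfolding nz tensor_qsym_def M_coords_lin_monomial
      by (rule conjI; rule contract_expand[where b = ?b and b' = ?b', OF ortho complete graded])
  next
    case (2 h)
    have "M_coords (h \<eta>) = ?h \<eta>" for \<eta>
    proof (rule contract_unique[where b = ?b and b' = ?b' and h = "\<lambda>\<eta>. M_coords (h \<eta>)", OF ortho complete graded])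
      show "finite {\<eta>. M_coords (h \<eta>) \<noteq> 0}"
        using 2 unfolding M_coords_eq_0_iff by (rule conjunct1)
      show "coprod_qsym (quasi_schur la) = (\<Sum>\<eta> | M_coords (h \<eta>) \<noteq> 0. tensor (M_coords (h \<eta>)) (?b \<eta>))"
        using 2 unfolding M_coords_eq_0_iff tensor_qsym_def by (rule conjunct2)
    qed
    then have "h \<eta> = qs.lin monomial_qsym (?h \<eta>)" for \<eta>
      using qsym_expand[of "h \<eta>"] by (simp only:)
    then show ?case by (rule ext)
  qed
  show h: "M_coords (skew_qsym la \<eta>) = ?h \<eta>" for \<eta> unfolding eq M_coords_lin_monomial ..
  have nz: "skew_qsym la \<eta> \<noteq> (0 :: 'f qsym) \<longleftrightarrow> ?h \<eta> \<noteq> 0" for \<eta>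
    unfolding h[symmetric] M_coords_eq_0_iff ..
  show "finite {\<eta>. skew_qsym la \<eta> \<noteq> (0 :: 'f qsym)}"
    unfolding nz by (rule contract_expand(1)[where b = ?b and b' = ?b', OF ortho complete graded])
  show "coprod_qsym (quasi_schur la :: 'f qsym) = (\<Sum>\<eta> | skew_qsym la \<eta> \<noteq> (0 :: 'f qsym). tensor_qsym (skew_qsym la \<eta>) (quasi_schur \<eta>))"
    unfolding nz tensor_qsym_def h by (rule contract_expand(2)[where b = ?b and b' = ?b', OF ortho complete graded])
qed

section \<open>Coproducts and deconcatenation\<close>

lemma lookup_coprod_qsym: "Poly_Mapping.lookup (coprod_qsym g) (\<gamma>, \<delta>) = mc g (\<gamma> + \<delta>)"
proof -
  have "Poly_Mapping.lookup (coprod_qsym g) (\<gamma>, \<delta>) =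
    (\<Sum>\<beta>\<in>Poly_Mapping.keys (M_coords g). \<Sum>p | fst p + snd p = \<beta>. if p = (\<gamma>, \<delta>) then mc g \<beta> else 0)"
    unfolding coprod_qsym_def lookup_sum case_prod_unfold
    by (intro sum.cong refl) (auto simp: lookup_single when_def)
  also have "\<dots> = (\<Sum>\<beta>\<in>Poly_Mapping.keys (M_coords g). if \<beta> = \<gamma> + \<delta> then mc g \<beta> else 0)"
    using finite_deconcat by (intro sum.cong refl) (simp add: case_prod_unfold sum.delta')
  also have "\<dots> = mc g (\<gamma> + \<delta>)" by (simp add: in_keys_iff)
  finally show ?thesis .
qed

text \<open>The left coefficient of M_\<delta> in the coproduct of \<open>x\<close>; equivalently,
  the transpose of right multiplication by H_\<delta>.\<close>

definition rshift :: "comp \<Rightarrow> 'f qsym \<Rightarrow> 'f::field qsym" where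
  "rshift \<delta> x = (\<Sum>\<gamma> | \<gamma> + \<delta> \<in> Poly_Mapping.keys (M_coords x). scale_qsym (mc x (\<gamma> + \<delta>)) (monomial_qsym \<gamma>))"

lemma mc_rshift: "mc (rshift \<delta> x) \<gamma> = mc x (\<gamma> + \<delta>)"
proof -
  have "finite ((\<lambda>\<gamma>. \<gamma> + \<delta>) -` Poly_Mapping.keys (M_coords x))"
    by (intro finite_vimageI) (auto simp: inj_on_def comp_add_right_cancel)
  then have "finite {\<gamma>. \<gamma> + \<delta> \<in> Poly_Mapping.keys (M_coords x)}" by (simp add: vimage_def)
  then show ?thesis
    unfolding rshift_def
    by (simp add: mc_sum mc_scale mc_monomial in_keys_iff if_distrib[of "\<lambda>c. _ * c"] cong: if_cong)
qed

text \<open>An exponent vector dominated by a concatenation splits at the boundary. The part over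
  the prefix forms a product of quasisymmetric functions, the part over \<open>\<delta>\<close>
  indexes the sum.\<close>

lemma rshift_mult:
  "rshift \<delta> (x * y) = (\<Sum>v | list_all2 (\<le>) v (parts \<delta>). rshift (strip v) x * rshift (strip (map2 (-) (parts \<delta>) v)) y)"
proof (rule qsym_eqI)
  fix \<gamma>
  have len: "map2 (-) (parts \<gamma> @ parts \<delta>) (u @ v) = map2 (-) (parts \<gamma>) u @ map2 (-) (parts \<delta>) v"
    if "list_all2 (\<le>) u (parts \<gamma>)" for u v
    using list_all2_lengthD[OF that] by simp
  have "mc (rshift \<delta> (x * y)) \<gamma> = (\<Sum>u | list_all2 (\<le>) u (parts \<gamma>). \<Sum>v | list_all2 (\<le>) v (parts \<delta>).
      mc x (strip u + strip v) * mc y (strip (map2 (-) (parts \<gamma>) u) + strip (map2 (-) (parts \<delta>) v)))"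
    unfolding mc_rshift mc_mult plus_comp.rep_eq sum_dominated_append
    by (intro sum.cong refl) (simp add: strip_append len del: zip_append)
  also have "\<dots> = (\<Sum>v | list_all2 (\<le>) v (parts \<delta>). \<Sum>u | list_all2 (\<le>) u (parts \<gamma>).
      mc x (strip u + strip v) * mc y (strip (map2 (-) (parts \<gamma>) u) + strip (map2 (-) (parts \<delta>) v)))"
    by (rule sum.swap)
  finally show "mc (rshift \<delta> (x * y)) \<gamma> =
      mc (\<Sum>v | list_all2 (\<le>) v (parts \<delta>). rshift (strip v) x * rshift (strip (map2 (-) (parts \<delta>) v)) y) \<gamma>"
    by (simp add: mc_sum mc_mult mc_rshift)
qed

text \<open>The operator \<open>(id \<otimes> \<langle>f, \<cdot>\<rangle>) \<circ> \<Delta>\<^sup>\<or>\<close> on quasisymmetric functions.\<close>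

definition rskew :: "'f nsym \<Rightarrow> 'f qsym \<Rightarrow> 'f::field qsym" where
  "rskew f x = qs.lin (\<lambda>\<delta>. rshift \<delta> x) f"

lemma mc_rskew:
  assumes "finite A" "Poly_Mapping.keys f \<subseteq> A"
  shows "mc (rskew f x) \<gamma> = (\<Sum>\<delta>\<in>A. Poly_Mapping.lookup f \<delta> * mc x (\<gamma> + \<delta>))"
  using assms by (simp add: rskew_def qs.lin_superset[of A] mc_sum mc_scale mc_rshift)

lemma skew_qsym_rskew: "skew_qsym la \<eta> = rskew (nc_schur \<eta>) (quasi_schur la)"
  by (rule qsym_eqI)
     (simp add: skew_qsym_coords lookup_contract[OF finite_keys order_refl] mc_rskew[OF finite_keys order_refl]
       lookup_coprod_qsym mult.commute)

lemma pairing_rskew: "pairing f x = mc (rskew f x) 0"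
  by (simp add: mc_rskew[OF finite_keys order_refl] pairing_def)

text \<open>Since \<open>strip\<close> deletes a zero, H_0 = 1 needs no separate case in the
  coproduct formula.\<close>

lemma H_gen_strip: "H_gen r = Poly_Mapping.single (strip [r]) (1 :: 'f::field)"
proof (cases "r = 0")
  case True
  then have "strip [r] = 0" by (intro parts_inject[THEN iffD1]) (simp add: parts_strip zero_comp.rep_eq)
  with True show ?thesis by (simp add: H_gen_def)
qed (simp add: H_gen_def strip_def)

lemma tensor_single: "tensor (Poly_Mapping.single i c) (Poly_Mapping.single j d) = Poly_Mapping.single (i, j) (c * d)"
  by (simp add: tensor_lin pm.lin_single scale_pm_single)

text \<open>Expanding the product chooses a split of each letter, so the index set is the set of
  dominated vectors that also occurs in \<open>mc_mult\<close>. This coincidence is the duality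
  between the coproduct here and the product of quasisymmetric functions.\<close>

lemma coprod_H:
  "prod_list (map (\<lambda>r. \<Sum>i\<le>r. tensor (H_gen i) (H_gen (r - i))) xs) =
    (\<Sum>u | list_all2 (\<le>) u xs. Poly_Mapping.single (strip u, strip (map2 (-) xs u)) (1 :: 'f::field))"
proof (induction xs)
  case Nil
  show ?case by (simp add: strip_Nil zero_prod_def[symmetric])
next
  case (Cons r xs)
  have mult: "Poly_Mapping.single (strip [i], strip [r - i]) (1 :: 'f) * Poly_Mapping.single (strip u, strip w) 1
      = Poly_Mapping.single (strip (i # u), strip ((r - i) # w)) 1" for i u w
    by (simp only: mult_single strip_Cons[of i u] strip_Cons[of "r - i" w] plus_prod_def fst_conv snd_conv mult_1_left)
  show ?case
    unfolding list.map prod_list.Cons Cons.IH sum_dominated_Cons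
    by (simp add: H_gen_strip tensor_single sum_product mult)
qed

lemma coprod_nsym_lin:
  "coprod_nsym f = pm.lin (\<lambda>\<alpha>. \<Sum>u | list_all2 (\<le>) u (parts \<alpha>).
      Poly_Mapping.single (strip u, strip (map2 (-) (parts \<alpha>) u)) 1) f"
  by (simp add: coprod_nsym_def pm.lin_def coprod_H)

lemma (in vector_space) lin_pm_lin: "lin \<phi> (pm.lin \<psi> t) = lin (\<lambda>k. lin \<phi> (\<psi> k)) t"
  unfolding pm.lin_def by (simp add: lin_sum lin_scale_pm) (simp add: lin_def)

text \<open>The product rule for skewing: by linearity \<open>f\<close> may be a basis element, and
  then \<open>rshift_mult\<close> and the coproduct run over the same dominated vectors.\<close>

lemma rskew_mult:
  "rskew f (x * y) = qs.lin (\<lambda>(\<gamma>, \<delta>). rshift \<gamma> x * rshift \<delta> y) (coprod_nsym f)"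
  by (simp add: rskew_def rshift_mult coprod_nsym_lin qs.lin_pm_lin qs.lin_sum qs.lin_single)

lemma scale_qsym_mult_left: "scale_qsym c x * y = scale_qsym c (x * y)"
  by (rule qsym_eqI) (simp add: mc_mult mc_scale sum_distrib_left mult.assoc)

lemma scale_qsym_mult_right: "x * scale_qsym c y = scale_qsym c (x * y)"
  using scale_qsym_mult_left[of c y x] by (simp add: mult.commute)

lemma qs_lin_mult_tensor:
  "qs.lin (\<lambda>(i, j). \<phi> i * \<psi> j) (tensor f g) = qs.lin \<phi> f * qs.lin \<psi> g"
  unfolding tensor_lin
  by (simp add: qs.lin_pm_lin qs.lin_single)
     (simp add: qs.lin_def sum_product scale_qsym_mult_left scale_qsym_mult_right qs.scale_sum_right mult.commute)

lemma rskew_schur_mult: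
  "rskew (nc_schur la :: 'f::field nsym) (x * quasi_schur \<mu>) =
    (\<Sum>\<nu> | skew_nsym la \<nu> \<noteq> (0 :: 'f nsym). rskew (skew_nsym la \<nu>) x * skew_qsym \<mu> \<nu>)"
  unfolding rskew_mult skew_nsym_expand qs.lin_sum qs_lin_mult_tensor skew_qsym_rskew
  by (simp add: rskew_def)

lemma mc_mult_0: "mc (x * y) 0 = mc x 0 * mc y 0"
  by (simp add: mc_mult zero_comp.rep_eq strip_Nil)

text \<open>Obtained from the product rule at the empty composition: that coordinate is
  multiplicative and turns each skewing operator into a pairing, and duality keeps only
  \<open>\<nu> = \<mu>\<close>.\<close>

lemma pairing_skew_nsym:
  "pairing (skew_nsym la \<mu> :: 'f::field nsym) x = pairing (nc_schur la) (x * quasi_schur \<mu>)"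
proof -
  have "pairing (nc_schur la) (x * quasi_schur \<mu>) =
    (\<Sum>\<nu> | skew_nsym la \<nu> \<noteq> (0 :: 'f nsym). pairing (skew_nsym la \<nu>) x * pairing (nc_schur \<nu>) (quasi_schur \<mu>))"
    unfolding pairing_rskew rskew_schur_mult mc_sum mc_mult_0 skew_qsym_rskew ..
  also have "\<dots> = (\<Sum>\<nu> | skew_nsym la \<nu> \<noteq> (0 :: 'f nsym). if \<nu> = \<mu> then pairing (skew_nsym la \<nu>) x else 0)"
    by (intro sum.cong) (auto simp: pairing_nc_schur)
  also have "\<dots> = pairing (skew_nsym la \<mu>) x"
    using skew_nsym_finite[of la, where 'f = 'f] by (auto simp: pairing_def)
  finally show ?thesis ..
qed

section \<open>Gradings\<close>

lemma sum_list_dominated: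
  "list_all2 (\<le>) u xs \<Longrightarrow> sum_list u + sum_list (map2 (-) xs u) = sum_list (xs :: nat list)"
  by (induction u xs rule: list_all2_induct) auto

lemma mc_mult_graded:
  assumes x: "\<And>\<gamma>. mc x \<gamma> \<noteq> 0 \<Longrightarrow> csize \<gamma> = m" and y: "\<And>\<gamma>. mc y \<gamma> \<noteq> 0 \<Longrightarrow> csize \<gamma> = n"
    and nz: "mc (x * y) \<alpha> \<noteq> 0"
  shows "csize \<alpha> = m + n"
proof -
  from nz obtain u where u: "list_all2 (\<le>) u (parts \<alpha>)"
      "mc x (strip u) * mc y (strip (map2 (-) (parts \<alpha>) u)) \<noteq> 0"
    unfolding mc_mult by (elim sum.not_neutral_contains_not_neutral) blast
  then have "mc x (strip u) \<noteq> 0" "mc y (strip (map2 (-) (parts \<alpha>) u)) \<noteq> 0" by auto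
  then show ?thesis
    using x[of "strip u"] y[of "strip (map2 (-) (parts \<alpha>) u)"] sum_list_dominated[OF u(1)]
    by (simp add: csize_strip csize_def[of \<alpha>])
qed

text \<open>By adjointness the coefficient at \<open>\<sigma>\<close> pairs a homogeneous element
  with the product of M_\<sigma> and a Schur function, so the degrees must match.\<close>

lemma skew_nsym_size:
  assumes "Poly_Mapping.lookup (skew_nsym la \<mu> :: 'f::field nsym) \<sigma> \<noteq> 0"
  shows "csize la = csize \<sigma> + csize \<mu>"
proof -
  let ?x = "monomial_qsym \<sigma> * quasi_schur \<mu> :: 'f qsym"
  have "pairing (nc_schur la) ?x \<noteq> 0"
    using assms unfolding pairing_skew_nsym[symmetric] pairing_monomial .
  then obtain \<alpha> where "Poly_Mapping.lookup (nc_schur la :: 'f nsym) \<alpha> * mc ?x \<alpha> \<noteq> 0"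
    unfolding pairing_def by (elim sum.not_neutral_contains_not_neutral) blast
  then have \<alpha>: "Poly_Mapping.lookup (nc_schur la :: 'f nsym) \<alpha> \<noteq> 0" "mc ?x \<alpha> \<noteq> 0" by auto
  have "csize \<alpha> = csize \<sigma> + csize \<mu>"
    by (rule mc_mult_graded[OF _ mc_schur_size \<alpha>(2)]) (auto simp: mc_monomial split: if_splits)
  with nc_schur_size[OF \<alpha>(1)] show ?thesis by simp
qed

lemma skew_qsym_size:
  assumes "mc (skew_qsym la \<mu> :: 'f::field qsym) \<sigma> \<noteq> 0"
  shows "csize la = csize \<sigma> + csize \<mu>"
proof -
  from assms obtain \<delta> where "Poly_Mapping.lookup (nc_schur \<mu> :: 'f nsym) \<delta> * mc (quasi_schur la :: 'f qsym) (\<sigma> + \<delta>) \<noteq> 0"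
    unfolding skew_qsym_rskew mc_rskew[OF finite_keys order_refl] by (elim sum.not_neutral_contains_not_neutral) blast
  then have "Poly_Mapping.lookup (nc_schur \<mu> :: 'f nsym) \<delta> \<noteq> 0" "mc (quasi_schur la :: 'f qsym) (\<sigma> + \<delta>) \<noteq> 0"
    by auto
  from nc_schur_size[OF this(1)] mc_schur_size[OF this(2)] show ?thesis by (simp add: csize_add)
qed

lemma skew_qsym_index_size:
  assumes "skew_qsym \<eta> \<mu> \<noteq> (0 :: 'f::field qsym)"
  shows "csize \<mu> \<le> csize \<eta>"
proof -
  from assms obtain \<sigma> where "mc (skew_qsym \<eta> \<mu> :: 'f qsym) \<sigma> \<noteq> 0"
    using qsym_eqI[of "skew_qsym \<eta> \<mu> :: 'f qsym" 0] by (auto simp: mc_0)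
  from skew_qsym_size[OF this] show ?thesis by simp
qed

lemma hom_qsym_mult: "hom_qsym n (x * y) = (\<Sum>i\<le>n. hom_qsym i x * hom_qsym (n - i) y)"
proof (rule qsym_eqI)
  fix \<alpha>
  let ?A = "{u. list_all2 (\<le>) u (parts \<alpha>)}"
  let ?v = "map2 (-) (parts \<alpha>)"
  have "mc (\<Sum>i\<le>n. hom_qsym i x * hom_qsym (n - i) y) \<alpha> =
    (\<Sum>u\<in>?A. \<Sum>i\<le>n. mc (hom_qsym i x) (strip u) * mc (hom_qsym (n - i) y) (strip (?v u)))"
    unfolding mc_sum mc_mult by (rule sum.swap)
  also have "\<dots> = (\<Sum>u\<in>?A. if csize \<alpha> = n then mc x (strip u) * mc y (strip (?v u)) else 0)"
  proof (intro sum.cong refl)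
    fix u assume "u \<in> ?A"
    then have s: "sum_list u + sum_list (?v u) = csize \<alpha>"
      using sum_list_dominated by (simp add: csize_def)
    have "(\<Sum>i\<le>n. mc (hom_qsym i x) (strip u) * mc (hom_qsym (n - i) y) (strip (?v u))) =
      (\<Sum>i\<le>n. if i = sum_list u then (if csize \<alpha> = n then mc x (strip u) * mc y (strip (?v u)) else 0) else 0)"
      using s by (intro sum.cong) (auto simp: mc_hom csize_strip)
    also have "\<dots> = (if csize \<alpha> = n then mc x (strip u) * mc y (strip (?v u)) else 0)"
      using s by (subst sum.delta) auto
    finally show "(\<Sum>i\<le>n. mc (hom_qsym i x) (strip u) * mc (hom_qsym (n - i) y) (strip (?v u))) =
        (if csize \<alpha> = n then mc x (strip u) * mc y (strip (?v u)) else 0)" .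
  qed
  also have "\<dots> = mc (hom_qsym n (x * y)) \<alpha>" by (simp add: mc_hom mc_mult)
  finally show "mc (hom_qsym n (x * y)) \<alpha> = mc (\<Sum>i\<le>n. hom_qsym i x * hom_qsym (n - i) y) \<alpha>" ..
qed

section \<open>The antipode\<close>

text \<open>Convolution of linear maps on quasisymmetric functions, each given by its values on the
  monomial basis, whose coproduct is deconcatenation.\<close>

definition conv :: "(comp \<Rightarrow> 'b) \<Rightarrow> (comp \<Rightarrow> 'b) \<Rightarrow> comp \<Rightarrow> 'b::ring_1" where
  "conv f g \<beta> = (\<Sum>p | fst p + snd p = \<beta>. f (fst p) * g (snd p))"

definition conv_unit :: "comp \<Rightarrow> 'b::ring_1" where
  "conv_unit \<beta> = (if \<beta> = 0 then 1 else 0)"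

lemma finite_deconcat': "finite {p. fst p + snd p = (\<beta> :: comp)}"
  using finite_deconcat[of \<beta>] by (simp add: case_prod_unfold)

lemma conv_assoc: "conv (conv f g) h = conv f (conv g h)"
proof
  fix \<beta>
  let ?D = "\<lambda>\<beta> :: comp. {p. fst p + snd p = \<beta>}"
  have "conv (conv f g) h \<beta> = (\<Sum>p\<in>?D \<beta>. \<Sum>q\<in>?D (fst p). f (fst q) * g (snd q) * h (snd p))"
    by (simp add: conv_def sum_distrib_right)
  also have "\<dots> = (\<Sum>(p, q)\<in>(SIGMA p:?D \<beta>. ?D (fst p)). f (fst q) * g (snd q) * h (snd p))"
    by (rule sum.Sigma) (auto intro: finite_deconcat')
  also have "\<dots> = (\<Sum>(p, q)\<in>(SIGMA p:?D \<beta>. ?D (snd p)). f (fst p) * (g (fst q) * h (snd q)))"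
    by (rule sum.reindex_bij_witness[of _
          "\<lambda>(p, q). ((fst p + fst q, snd q), (fst p, fst q))"
          "\<lambda>(p, q). ((fst q, snd q + snd p), (snd q, snd p))"])
       (auto simp: add.assoc mult.assoc)
  also have "\<dots> = (\<Sum>p\<in>?D \<beta>. \<Sum>q\<in>?D (snd p). f (fst p) * (g (fst q) * h (snd q)))"
    by (rule sum.Sigma[symmetric]) (auto intro: finite_deconcat')
  also have "\<dots> = conv f (conv g h) \<beta>"
    by (simp add: conv_def sum_distrib_left)
  finally show "conv (conv f g) h \<beta> = conv f (conv g h) \<beta>" .
qed

lemma conv_unit_left: "conv conv_unit f = f"
proof
  fix \<beta>
  have "conv conv_unit f \<beta> = (\<Sum>p\<in>{(0, \<beta>)}. conv_unit (fst p) * f (snd p))"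
    unfolding conv_def using finite_deconcat' by (intro sum.mono_neutral_right) (auto simp: conv_unit_def)
  then show "conv conv_unit f \<beta> = f \<beta>" by (simp add: conv_unit_def)
qed

lemma conv_unit_right: "conv f conv_unit = f"
proof
  fix \<beta>
  have "conv f conv_unit \<beta> = (\<Sum>p\<in>{(\<beta>, 0)}. f (fst p) * conv_unit (snd p))"
    unfolding conv_def using finite_deconcat' by (intro sum.mono_neutral_right) (auto simp: conv_unit_def)
  then show "conv f conv_unit \<beta> = f \<beta>" by (simp add: conv_unit_def)
qed

lemma deconcat_0: "{p. fst p + snd p = (0 :: comp)} = {(0, 0)}"
  by (auto simp: comp_add_eq_0_iff)

text \<open>The equation for a left inverse at \<open>\<beta>\<close> is solved for the term with
  empty suffix, all other terms involving proper prefixes. It is an inverse when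
  \<open>u 0 = 1\<close>. Since convolution is not commutative, a right inverse is built separately
  and identified with it by associativity.\<close>

function conv_linv :: "(comp \<Rightarrow> 'b) \<Rightarrow> comp \<Rightarrow> 'b::ring_1" where
  "conv_linv u \<beta> = (if \<beta> = 0 then 1 else
     - (\<Sum>p | fst p + snd p = \<beta> \<and> snd p \<noteq> 0. conv_linv u (fst p) * u (snd p)))"
  by auto
termination
  by (relation "measure (csize \<circ> snd)") (auto simp: csize_add csize_eq_0_iff simp flip: neq0_conv)

function conv_rinv :: "(comp \<Rightarrow> 'b) \<Rightarrow> comp \<Rightarrow> 'b::ring_1" where
  "conv_rinv u \<beta> = (if \<beta> = 0 then 1 else
     - (\<Sum>p | fst p + snd p = \<beta> \<and> fst p \<noteq> 0. u (fst p) * conv_rinv u (snd p)))"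
  by auto
termination
  by (relation "measure (csize \<circ> snd)") (auto simp: csize_add csize_eq_0_iff simp flip: neq0_conv)

declare conv_linv.simps[simp del] conv_rinv.simps[simp del]

lemma conv_linv:
  assumes "u 0 = 1"
  shows "conv (conv_linv u) u = conv_unit"
proof
  fix \<beta>
  show "conv (conv_linv u) u \<beta> = conv_unit \<beta>"
  proof (cases "\<beta> = 0")
    case True
    then show ?thesis
      by (simp add: conv_def deconcat_0 conv_linv.simps[of u 0] assms conv_unit_def)
  next
    case False
    have "{p. fst p + snd p = \<beta>} = insert (\<beta>, 0) {p. fst p + snd p = \<beta> \<and> snd p \<noteq> 0}" by auto
    moreover have "finite {p. fst p + snd p = \<beta> \<and> snd p \<noteq> 0}"
      by (rule finite_subset[OF _ finite_deconcat'[of \<beta>]]) auto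
    ultimately have "conv (conv_linv u) u \<beta> = conv_linv u \<beta> +
        (\<Sum>p | fst p + snd p = \<beta> \<and> snd p \<noteq> 0. conv_linv u (fst p) * u (snd p))"
      by (simp add: conv_def assms)
    then show ?thesis using False by (simp add: conv_linv.simps[of u \<beta>] conv_unit_def)
  qed
qed

lemma conv_rinv:
  assumes "u 0 = 1"
  shows "conv u (conv_rinv u) = conv_unit"
proof
  fix \<beta>
  show "conv u (conv_rinv u) \<beta> = conv_unit \<beta>"
  proof (cases "\<beta> = 0")
    case True
    then show ?thesis
      by (simp add: conv_def deconcat_0 conv_rinv.simps[of u 0] assms conv_unit_def)
  next
    case False
    have "{p. fst p + snd p = \<beta>} = insert (0, \<beta>) {p. fst p + snd p = \<beta> \<and> fst p \<noteq> 0}" by auto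
    moreover have "finite {p. fst p + snd p = \<beta> \<and> fst p \<noteq> 0}"
      by (rule finite_subset[OF _ finite_deconcat'[of \<beta>]]) auto
    ultimately have "conv u (conv_rinv u) \<beta> = conv_rinv u \<beta> +
        (\<Sum>p | fst p + snd p = \<beta> \<and> fst p \<noteq> 0. u (fst p) * conv_rinv u (snd p))"
      by (simp add: conv_def assms)
    then show ?thesis using False by (simp add: conv_rinv.simps[of u \<beta>] conv_unit_def)
  qed
qed

lemma conv_inverse_unique:
  assumes "conv l u = conv_unit" "conv u r = conv_unit"
  shows "l = r"
  by (metis assms conv_assoc conv_unit_left conv_unit_right)

lemma monomial_qsym_0: "monomial_qsym 0 = (1 :: 'f::comm_ring_1 qsym)"
  by (rule qsym_eqI) (simp add: mc_monomial mc_1)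

lemma coprod_qsym_lin:
  "coprod_qsym g = pm.lin (\<lambda>\<beta>. \<Sum>p | fst p + snd p = \<beta>. Poly_Mapping.single p 1) (M_coords g)"
  by (simp add: coprod_qsym_def pm.lin_def pm.scale_sum_right scale_pm_single case_prod_unfold)

lemma mult_map_qsym_lin: "mult_map_qsym p q t = qs.lin (\<lambda>(\<gamma>, \<delta>). p (monomial_qsym \<gamma>) * q (monomial_qsym \<delta>)) t"
  by (simp add: mult_map_qsym_def qs.lin_def case_prod_unfold)

text \<open>Turns the antipode axioms into equations between convolutions of functions on
  compositions.\<close>

lemma mult_map_coprod_qsym:
  "mult_map_qsym p q (coprod_qsym g) =
    qs.lin (conv (\<lambda>\<gamma>. p (monomial_qsym \<gamma>)) (\<lambda>\<delta>. q (monomial_qsym \<delta>))) (M_coords g)"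
  unfolding mult_map_qsym_lin coprod_qsym_lin qs.lin_pm_lin
  by (rule qs.lin_cong) (simp add: qs.lin_sum qs.lin_single conv_def case_prod_unfold)

lemma lin_conv_unit: "qs.lin conv_unit (M_coords g) = scale_qsym (counit_qsym g) 1"
proof -
  have "qs.lin conv_unit (M_coords g) =
    (\<Sum>\<beta>\<in>Poly_Mapping.keys (M_coords g). if \<beta> = 0 then scale_qsym (mc g 0) 1 else 0)"
    unfolding qs.lin_def by (intro sum.cong) (auto simp: conv_unit_def)
  then show ?thesis by (simp add: counit_qsym_def in_keys_iff)
qed

lemma linear_lin_M_coords: "Vector_Spaces.linear scale_qsym scale_qsym (\<lambda>g. qs.lin \<phi> (M_coords g :: comp \<Rightarrow>\<^sub>0 'f::field))"
proof -
  have "M_coords (x + y :: 'f qsym) = M_coords x + M_coords y" for x y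
    by (rule poly_mapping_eqI) (simp add: mc_add lookup_add)
  moreover have "M_coords (scale_qsym c x :: 'f qsym) = scale_pm c (M_coords x)" for c x
    by (rule poly_mapping_eqI) (simp add: mc_scale lookup_scale_pm)
  ultimately show ?thesis
    unfolding Vector_Spaces.linear_iff
    by (simp add: qs.vector_space_axioms qs.lin_add qs.lin_scale_pm)
qed

lemma linear_qsym_expand:
  assumes "Vector_Spaces.linear scale_qsym scale_qsym L"
  shows "L x = qs.lin (\<lambda>\<beta>. L (monomial_qsym \<beta>)) (M_coords (x :: 'f::field qsym))"
  using linear_lin[OF assms, of monomial_qsym "M_coords x"] unfolding qsym_expand .

text \<open>A linear map is an antipode exactly when its values on the monomial basis are a
  two-sided convolution inverse of that basis. Such an inverse exists because M_0 = 1, and it is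
  unique.\<close>

lemma antipode_qsym: "is_antipode_qsym (antipode_qsym :: 'f qsym \<Rightarrow> 'f::field qsym)"
  unfolding antipode_qsym_def
proof (rule theI'[of is_antipode_qsym])
  let ?M = "monomial_qsym :: comp \<Rightarrow> 'f qsym"
  let ?S = "\<lambda>g. qs.lin (conv_linv ?M) (M_coords g)"
  have M0: "?M 0 = 1" by (rule monomial_qsym_0)
  have eq: "conv_linv ?M = conv_rinv ?M"
    by (rule conv_inverse_unique[OF conv_linv conv_rinv]) (rule M0)+
  have S: "?S (?M \<gamma>) = conv_linv ?M \<gamma>" for \<gamma>
    by (simp add: M_coords_monomial qs.lin_single)
  show "\<exists>!S. is_antipode_qsym (S :: 'f qsym \<Rightarrow> 'f qsym)"
  proof (rule ex1I[of _ ?S])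
    show "is_antipode_qsym ?S"
      unfolding is_antipode_qsym_def mult_map_coprod_qsym S id_def conv_linv[where u = ?M, OF M0]
      unfolding eq conv_rinv[where u = ?M, OF M0] lin_conv_unit
      using linear_lin_M_coords[of "conv_rinv ?M"] by simp
  next
    fix S :: "'f qsym \<Rightarrow> 'f qsym"
    assume anti: "is_antipode_qsym S"
    have "conv (\<lambda>\<gamma>. S (?M \<gamma>)) ?M = conv_unit"
    proof
      fix \<beta>
      have "mult_map_qsym S id (coprod_qsym (?M \<beta>)) = scale_qsym (counit_qsym (?M \<beta>)) 1"
        using anti by (simp add: is_antipode_qsym_def)
      then show "conv (\<lambda>\<gamma>. S (?M \<gamma>)) ?M \<beta> = conv_unit \<beta>"
        unfolding mult_map_coprod_qsym id_def lin_conv_unit[symmetric] by (simp add: M_coords_monomial qs.lin_single)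
    qed
    from conv_inverse_unique[OF this conv_rinv[where u = ?M, OF M0]]
    have SM: "S (?M \<gamma>) = conv_linv ?M \<gamma>" for \<gamma> unfolding eq by (rule fun_cong)
    have lin: "Vector_Spaces.linear scale_qsym scale_qsym S" using anti by (simp add: is_antipode_qsym_def)
    show "S = ?S" using linear_qsym_expand[OF lin] unfolding SM by (rule ext)
  qed
qed

lemma linear_antipode: "Vector_Spaces.linear scale_qsym scale_qsym (antipode_qsym :: 'f qsym \<Rightarrow> 'f::field qsym)"
  using antipode_qsym unfolding is_antipode_qsym_def by blast

lemma conv_antipode:
  "conv (\<lambda>\<gamma>. antipode_qsym (monomial_qsym \<gamma>)) monomial_qsym = (conv_unit :: comp \<Rightarrow> 'f::field qsym)"
proof
  fix \<beta>
  have "mult_map_qsym antipode_qsym id (coprod_qsym (monomial_qsym \<beta> :: 'f qsym)) = scale_qsym (counit_qsym (monomial_qsym \<beta>)) 1"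
    using antipode_qsym unfolding is_antipode_qsym_def by blast
  then show "conv (\<lambda>\<gamma>. antipode_qsym (monomial_qsym \<gamma>)) monomial_qsym \<beta> = (conv_unit \<beta> :: 'f qsym)"
    unfolding mult_map_coprod_qsym id_def lin_conv_unit[symmetric] by (simp add: M_coords_monomial qs.lin_single)
qed

lemma linear_rskew: "Vector_Spaces.linear scale_qsym scale_qsym (rskew (f :: 'f::field nsym))"
proof -
  have "rskew f (x + y) = rskew f x + rskew f y" for x y
    by (rule qsym_eqI)
      (simp add: mc_rskew[OF finite_keys order_refl] mc_add distrib_left sum.distrib)
  moreover have "rskew f (scale_qsym c x) = scale_qsym c (rskew f x)" for c x
    by (rule qsym_eqI)
      (simp add: mc_rskew[OF finite_keys order_refl] mc_scale sum_distrib_left mult_ac)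
  ultimately show ?thesis
    unfolding Vector_Spaces.linear_iff by (simp add: qs.vector_space_axioms)
qed

text \<open>Presents the skewing operator as the identity convolved with \<open>f\<close>, viewed as
  a scalar-valued map, so that associativity can bring the antipode next to the identity.\<close>

lemma rskew_monomial:
  "rskew f (monomial_qsym \<delta>) = conv monomial_qsym (\<lambda>\<beta>. scale_qsym (Poly_Mapping.lookup f \<beta>) (1 :: 'f::field qsym)) \<delta>"
proof (rule qsym_eqI)
  fix \<gamma>
  let ?D = "{p. fst p + snd p = \<delta>}"
  \<comment> \<open>The suffixes of \<open>\<delta>\<close> are added so that all deconcatenations
    are present, including those where \<open>f\<close> has coefficient zero.\<close>
  let ?A = "Poly_Mapping.keys f \<union> snd ` ?D"
  have "mc (rskew f (monomial_qsym \<delta>)) \<gamma> =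
    (\<Sum>\<beta>\<in>?A. if \<gamma> + \<beta> = \<delta> then Poly_Mapping.lookup f \<beta> else 0)"
    using finite_deconcat'[of \<delta>] by (subst mc_rskew[of ?A]) (auto simp: mc_monomial intro!: sum.cong)
  also have "\<dots> = (\<Sum>\<beta> | \<gamma> + \<beta> = \<delta>. Poly_Mapping.lookup f \<beta>)"
    using finite_deconcat'[of \<delta>]
    by (subst sum.inter_filter[symmetric]) (auto intro!: sum.cong image_eqI[where x = "(\<gamma>, _)"])
  also have "\<dots> = (\<Sum>p\<in>{p \<in> ?D. \<gamma> = fst p}. Poly_Mapping.lookup f (snd p))"
    by (rule sum.reindex_bij_witness[of _ snd "\<lambda>\<beta>. (\<gamma>, \<beta>)"]) auto
  also have "\<dots> = (\<Sum>p\<in>?D. if \<gamma> = fst p then Poly_Mapping.lookup f (snd p) else 0)"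
    by (rule sum.inter_filter) (rule finite_deconcat')
  also have "\<dots> = mc (conv monomial_qsym (\<lambda>\<beta>. scale_qsym (Poly_Mapping.lookup f \<beta>) 1) \<delta>) \<gamma>"
    unfolding conv_def mc_sum by (intro sum.cong) (auto simp: scale_qsym_mult_right mc_scale mc_monomial)
  finally show "mc (rskew f (monomial_qsym \<delta>)) \<gamma> =
      mc (conv monomial_qsym (\<lambda>\<beta>. scale_qsym (Poly_Mapping.lookup f \<beta>) 1) \<delta>) \<gamma>" .
qed

text \<open>The sum applies the antipode and the skewing operator of \<open>nc_schur \<nu>\<close>
  to the two factors of the coproduct. Regrouping the convolution cancels antipode against identity
  and leaves the pairing of \<open>nc_schur \<nu>\<close> with
  \<open>quasi_schur \<eta>\<close>.\<close>

lemma antipode_skew: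
  "(\<Sum>\<mu> | skew_qsym \<eta> \<mu> \<noteq> (0 :: 'f::field qsym). antipode_qsym (skew_qsym \<eta> \<mu>) * skew_qsym \<mu> \<nu>) =
    (if \<nu> = \<eta> then 1 else 0 :: 'f qsym)"
proof -
  let ?f = "nc_schur \<nu> :: 'f nsym"
  let ?S = "antipode_qsym :: 'f qsym \<Rightarrow> 'f qsym"
  let ?s = "quasi_schur \<eta> :: 'f qsym"
  have "(\<Sum>\<mu> | skew_qsym \<eta> \<mu> \<noteq> (0 :: 'f qsym). ?S (skew_qsym \<eta> \<mu>) * skew_qsym \<mu> \<nu>) =
      mult_map_qsym ?S (rskew ?f) (coprod_qsym ?s)"
    unfolding skew_qsym_expand mult_map_qsym_lin qs.lin_sum tensor_qsym_def qs_lin_mult_tensor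
      linear_qsym_expand[OF linear_antipode, symmetric] linear_qsym_expand[OF linear_rskew, symmetric]
    by (simp only: skew_qsym_rskew)
  also have "\<dots> = qs.lin (\<lambda>\<beta>. scale_qsym (Poly_Mapping.lookup ?f \<beta>) 1) (M_coords ?s)"
    unfolding mult_map_coprod_qsym rskew_monomial conv_assoc[symmetric] conv_antipode conv_unit_left ..
  also have "\<dots> = scale_qsym (pairing ?f ?s) 1"
    by (simp add: qs.lin_def pairing_keys_right qs.scale_sum_left mult.commute)
  also have "\<dots> = (if \<nu> = \<eta> then 1 else 0)"
    by (simp add: pairing_nc_schur)
  finally show ?thesis .
qed

section \<open>Products of noncommutative symmetric functions\<close>

lemma nsym_mult_lin: "f * g = pm.lin (\<lambda>i. pm.lin (\<lambda>j. Poly_Mapping.single (i + j) 1) g) (f :: 'f::field nsym)"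
proof -
  have "f * g = pm.lin (\<lambda>k. Poly_Mapping.single k 1) f * pm.lin (\<lambda>k. Poly_Mapping.single k 1) g"
    by (simp only: pm_lin_single)
  also have "\<dots> = pm.lin (\<lambda>i. pm.lin (\<lambda>j. Poly_Mapping.single (i + j) 1) g) f"
    by (simp add: pm.lin_def scale_pm_single sum_product mult_single pm.scale_sum_right)
  finally show ?thesis .
qed

text \<open>On basis elements both sides are the coordinate of \<open>x\<close> at a concatenation;
  skewing by \<open>g\<close> is the adjoint of right multiplication by \<open>g\<close>.\<close>

lemma pairing_mult: "pairing (f * g) x = pairing f (rskew g x)"
  unfolding nsym_mult_lin pairing_lin sc.lin_pm_lin
  by (intro sc.lin_cong)
    (simp add: sc.lin_single mc_rskew[OF finite_keys order_refl] sc.lin_def)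

lemma lookup_nsym_mult:
  "Poly_Mapping.lookup (f * g :: 'f::field nsym) \<alpha> =
    (\<Sum>p | fst p + snd p = \<alpha>. Poly_Mapping.lookup f (fst p) * Poly_Mapping.lookup g (snd p))"
proof -
  let ?D = "{p. fst p + snd p = \<alpha>}"
  let ?h = "\<lambda>p. Poly_Mapping.lookup f (fst p) * Poly_Mapping.lookup g (snd p)"
  let ?K = "Poly_Mapping.keys f \<times> Poly_Mapping.keys g"
  have "Poly_Mapping.lookup (f * g) \<alpha> = (\<Sum>p\<in>?K. if fst p + snd p = \<alpha> then ?h p else 0)"
    by (simp add: nsym_mult_lin pm.lin_def lookup_sum lookup_scale_pm lookup_single when_def
        sum.cartesian_product case_prod_unfold sum_distrib_left if_distrib[of "\<lambda>c. _ * c"] mult.assoc cong: if_cong)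
  also have "\<dots> = (\<Sum>p\<in>{p \<in> ?K. fst p + snd p = \<alpha>}. ?h p)"
    by (rule sum.inter_filter[symmetric]) simp
  also have "\<dots> = (\<Sum>p\<in>?D. ?h p)"
    using finite_deconcat' by (intro sum.mono_neutral_left) (auto simp: in_keys_iff)
  finally show ?thesis .
qed

lemma lookup_hom_nsym: "Poly_Mapping.lookup (hom_nsym n f) \<alpha> = (if csize \<alpha> = n then Poly_Mapping.lookup f \<alpha> else 0)"
  by (simp add: hom_nsym_def lookup_mapp when_def in_keys_iff)

lemma hom_nsym_mult: "hom_nsym n (f * g) = (\<Sum>i\<le>n. hom_nsym i f * hom_nsym (n - i) (g :: 'f::field nsym))"
proof (rule poly_mapping_eqI)
  fix \<alpha> :: comp
  let ?D = "{p. fst p + snd p = \<alpha>}"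
  let ?h = "\<lambda>p. Poly_Mapping.lookup f (fst p) * Poly_Mapping.lookup g (snd p)"
  have "Poly_Mapping.lookup (\<Sum>i\<le>n. hom_nsym i f * hom_nsym (n - i) g) \<alpha> =
    (\<Sum>p\<in>?D. \<Sum>i\<le>n. Poly_Mapping.lookup (hom_nsym i f) (fst p) * Poly_Mapping.lookup (hom_nsym (n - i) g) (snd p))"
    unfolding lookup_sum lookup_nsym_mult by (rule sum.swap)
  also have "\<dots> = (\<Sum>p\<in>?D. if csize \<alpha> = n then ?h p else 0)"
  proof (intro sum.cong refl)
    fix p assume "p \<in> ?D"
    then have s: "csize (fst p) + csize (snd p) = csize \<alpha>" by (auto simp: csize_add)
    have "(\<Sum>i\<le>n. Poly_Mapping.lookup (hom_nsym i f) (fst p) * Poly_Mapping.lookup (hom_nsym (n - i) g) (snd p)) =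
      (\<Sum>i\<le>n. if i = csize (fst p) then (if csize \<alpha> = n then ?h p else 0) else 0)"
      using s by (intro sum.cong) (auto simp: lookup_hom_nsym)
    also have "\<dots> = (if csize \<alpha> = n then ?h p else 0)" using s by (subst sum.delta) auto
    finally show "(\<Sum>i\<le>n. Poly_Mapping.lookup (hom_nsym i f) (fst p) * Poly_Mapping.lookup (hom_nsym (n - i) g) (snd p)) =
      (if csize \<alpha> = n then ?h p else 0)" .
  qed
  also have "\<dots> = Poly_Mapping.lookup (hom_nsym n (f * g)) \<alpha>" by (simp add: lookup_hom_nsym lookup_nsym_mult)
  finally show "Poly_Mapping.lookup (hom_nsym n (f * g)) \<alpha> = Poly_Mapping.lookup (\<Sum>i\<le>n. hom_nsym i f * hom_nsym (n - i) g) \<alpha>" ..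
qed

section \<open>The identity of linear operators\<close>

lemma rskew_size:
  assumes "mc (rskew f x) \<gamma> \<noteq> 0" "\<And>\<beta>. mc x \<beta> \<noteq> 0 \<Longrightarrow> csize \<beta> \<le> N"
  shows "csize \<gamma> \<le> N"
proof -
  from assms(1) obtain \<delta> where "mc x (\<gamma> + \<delta>) \<noteq> 0"
    unfolding mc_rskew[OF finite_keys order_refl] by (elim sum.not_neutral_contains_not_neutral) auto
  with assms(2)[of "\<gamma> + \<delta>"] show ?thesis by (simp add: csize_add)
qed

text \<open>By adjointness this is the Schur expansion of \<open>rskew f x\<close>. Skewing passes
  to prefixes, so the degree bound of \<open>x\<close> is still valid.\<close>

lemma cauchy_operator:
  assumes "\<And>\<beta>. mc x \<beta> \<noteq> 0 \<Longrightarrow> csize \<beta> \<le> N"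
  shows "(\<Sum>\<alpha> | csize \<alpha> \<le> N. scale_qsym (pairing (nc_schur \<alpha> * f) x) (quasi_schur \<alpha>)) = rskew f (x :: 'f::field qsym)"
  unfolding pairing_mult
proof (rule schur_expand[symmetric])
  show "Poly_Mapping.keys (M_coords (rskew f x)) \<subseteq> {\<gamma>. csize \<gamma> \<le> N}"
    unfolding subset_iff in_keys_iff mem_Collect_eq by (intro allI impI rskew_size[OF _ assms])
qed

text \<open>The condition on \<open>N\<close> loses no \<open>\<rho>\<close>: a contributing
  \<open>\<mu>\<close> has size at most that of \<open>\<eta>\<close>, so
  \<open>x * quasi_schur \<mu>\<close> has degree at most \<open>N\<close> and its expansion is
  complete.\<close>

lemma skew_operator:
  fixes x :: "'f::field qsym"
  assumes x: "\<And>\<beta>. mc x \<beta> \<noteq> 0 \<Longrightarrow> csize \<beta> = m" and N: "m + csize \<eta> \<le> N"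
  shows "(\<Sum>\<mu> | skew_qsym \<eta> \<mu> \<noteq> (0 :: 'f qsym). \<Sum>\<rho> | csize \<rho> \<le> N.
      scale_qsym (pairing (skew_nsym \<rho> \<mu>) x) (antipode_qsym (skew_qsym \<eta> \<mu>) * skew_qsym \<rho> la)) =
    rskew (skew_nsym la \<eta>) x"
proof -
  let ?V = "{\<mu>. skew_qsym \<eta> \<mu> \<noteq> (0 :: 'f qsym)}"
  let ?W = "{\<nu>. skew_nsym la \<nu> \<noteq> (0 :: 'f nsym)}"
  let ?A = "\<lambda>\<mu>. antipode_qsym (skew_qsym \<eta> \<mu>) :: 'f qsym"
  interpret L: Vector_Spaces.linear scale_qsym scale_qsym "rskew (nc_schur la :: 'f nsym)"
    by (rule linear_rskew)
  have "(\<Sum>\<rho> | csize \<rho> \<le> N. scale_qsym (pairing (skew_nsym \<rho> \<mu>) x) (?A \<mu> * skew_qsym \<rho> la)) =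
      (\<Sum>\<nu>\<in>?W. rskew (skew_nsym la \<nu>) x * (?A \<mu> * skew_qsym \<mu> \<nu>))" if \<mu>: "\<mu> \<in> ?V" for \<mu>
  proof -
    from \<mu> have "csize \<mu> \<le> csize \<eta>" by (intro skew_qsym_index_size) simp
    have "Poly_Mapping.keys (M_coords (x * quasi_schur \<mu>)) \<subseteq> {\<gamma>. csize \<gamma> \<le> N}"
    proof
      fix \<gamma> assume "\<gamma> \<in> Poly_Mapping.keys (M_coords (x * quasi_schur \<mu>))"
      then have "csize \<gamma> = m + csize \<mu>"
        by (intro mc_mult_graded[OF x mc_schur_size]) (auto simp: in_keys_iff)
      then show "\<gamma> \<in> {\<gamma>. csize \<gamma> \<le> N}" using N \<open>csize \<mu> \<le> csize \<eta>\<close> by simp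
    qed
    then have "x * quasi_schur \<mu> = (\<Sum>\<rho> | csize \<rho> \<le> N. scale_qsym (pairing (skew_nsym \<rho> \<mu>) x) (quasi_schur \<rho>))"
      unfolding pairing_skew_nsym by (rule schur_expand)
    then have "rskew (nc_schur la) (x * quasi_schur \<mu>) =
      (\<Sum>\<rho> | csize \<rho> \<le> N. scale_qsym (pairing (skew_nsym \<rho> \<mu>) x) (skew_qsym \<rho> la))"
      by (simp only: L.sum L.scale skew_qsym_rskew)
    then have "(\<Sum>\<rho> | csize \<rho> \<le> N. scale_qsym (pairing (skew_nsym \<rho> \<mu>) x) (?A \<mu> * skew_qsym \<rho> la)) =
       ?A \<mu> * rskew (nc_schur la) (x * quasi_schur \<mu>)"
      by (simp add: sum_distrib_left scale_qsym_mult_right)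
    \<comment> \<open>Commutativity brings the antipode factor next to
      \<open>skew_qsym \<mu> \<nu>\<close>.\<close>
    then show ?thesis unfolding rskew_schur_mult by (simp add: sum_distrib_left mult_ac)
  qed
  then have "(\<Sum>\<mu>\<in>?V. \<Sum>\<rho> | csize \<rho> \<le> N. scale_qsym (pairing (skew_nsym \<rho> \<mu>) x) (?A \<mu> * skew_qsym \<rho> la)) =
      (\<Sum>\<mu>\<in>?V. \<Sum>\<nu>\<in>?W. rskew (skew_nsym la \<nu>) x * (?A \<mu> * skew_qsym \<mu> \<nu>))"
    by (rule sum.cong[OF refl])
  also have "\<dots> = (\<Sum>\<nu>\<in>?W. rskew (skew_nsym la \<nu>) x * (\<Sum>\<mu>\<in>?V. ?A \<mu> * skew_qsym \<mu> \<nu>))"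
    unfolding sum_distrib_left by (rule sum.swap)
  also have "\<dots> = (\<Sum>\<nu>\<in>?W. if \<nu> = \<eta> then rskew (skew_nsym la \<nu>) x else 0)"
    unfolding antipode_skew by (intro sum.cong) auto
  \<comment> \<open>If \<open>\<eta>\<close> lies outside \<open>?W\<close>, the skew element is
    zero and so is its operator.\<close>
  also have "\<dots> = rskew (skew_nsym la \<eta>) x"
    using skew_nsym_finite[of la, where 'f = 'f] by (auto simp: rskew_def qs.lin_0)
  finally show ?thesis .
qed

section \<open>Degreewise evaluation\<close>

lemma tensor_mult_pure: "tensor_mult u (pure a b) = pm.lin (\<lambda>(x, y). pure (x * a) (y * b)) u"
  by (simp add: tensor_mult_def pm.lin_def case_prod_unfold pure_def)

lemma tensor_mult_pure_pure: "tensor_mult (pure a b) (pure c d) = pure (a * c) (b * d)"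
  unfolding tensor_mult_pure by (subst (2) pure_def) (simp add: pm.lin_single)

lemma tensor_mult_pure_sum: "tensor_mult (sum f A) (pure a b) = (\<Sum>i\<in>A. tensor_mult (f i) (pure a b))"
  by (simp add: tensor_mult_pure pm.lin_sum)

lemma hom_qsym_0: "hom_qsym n 0 = 0"
  by (rule qsym_eqI) (simp add: mc_hom mc_0)

lemma hom_qsym_sum: "hom_qsym n (sum f A) = (\<Sum>i\<in>A. hom_qsym n (f i))"
  by (rule qsym_eqI) (simp add: mc_hom mc_sum)

lemma hom_qsym_scale: "hom_qsym n (scale_qsym c x) = scale_qsym c (hom_qsym n x)"
  by (rule qsym_eqI) (simp add: mc_hom mc_scale)

lemma hom_nsym_expand:
  "hom_nsym p (f :: 'f::field nsym) = (\<Sum>\<sigma> | csize \<sigma> = p. scale_pm (Poly_Mapping.lookup f \<sigma>) (Poly_Mapping.single \<sigma> 1))"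
proof (rule poly_mapping_eqI)
  fix \<alpha>
  show "Poly_Mapping.lookup (hom_nsym p f) \<alpha> =
      Poly_Mapping.lookup (\<Sum>\<sigma> | csize \<sigma> = p. scale_pm (Poly_Mapping.lookup f \<sigma>) (Poly_Mapping.single \<sigma> 1)) \<alpha>"
    using finite_csize_eq by (simp add: lookup_hom_nsym lookup_sum scale_pm_single lookup_single when_def)
qed

context
  fixes sX :: "'f::field \<Rightarrow> 'a::{comm_ring, comm_monoid_mult} \<Rightarrow> 'a"
    and sY :: "'f \<Rightarrow> 'b::{comm_ring, comm_monoid_mult} \<Rightarrow> 'b"
    and evX :: "'f nsym \<Rightarrow> 'a"
    and evY :: "'f qsym \<Rightarrow> 'b"
  assumes algX: "comm_algebra sX"
    and algY: "comm_algebra sY"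
    and morX: "algebra_morphism scale_pm sX evX"
    and morY: "algebra_morphism scale_qsym sY evY"
begin

interpretation X: comm_algebra sX by (rule algX)
interpretation Y: comm_algebra sY by (rule algY)
interpretation evX: Vector_Spaces.linear scale_pm sX evX
  using morX by (simp add: algebra_morphism_def)
interpretation evY: Vector_Spaces.linear scale_qsym sY evY
  using morY by (simp add: algebra_morphism_def)

lemma evX_mult: "evX (x * y) = evX x * evX y"
  using morX by (simp add: algebra_morphism_def)

lemma evY_mult: "evY (x * y) = evY x * evY y"
  using morY by (simp add: algebra_morphism_def)

section \<open>Congruence modulo the bilinearity relations\<close>

definition tcong :: "('f, 'a, 'b) free_tensor \<Rightarrow> ('f, 'a, 'b) free_tensor \<Rightarrow> bool" (infix "\<simeq>" 50) where
  "u \<simeq> v \<longleftrightarrow> u - v \<in> tensor_null sX sY"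

lemma null_subspace: "pm.subspace (tensor_null sX sY)"
  unfolding tensor_null_def by (rule pm.subspace_span)

lemmas null_0 = pm.subspace_0[OF null_subspace]
lemmas null_add = pm.subspace_add[OF null_subspace]
lemmas null_diff = pm.subspace_diff[OF null_subspace]
lemmas null_sum = pm.subspace_sum[OF null_subspace]

lemma tcong_sym: "u \<simeq> v \<Longrightarrow> v \<simeq> u"
  using null_diff[OF null_0, of "u - v"] by (simp add: tcong_def)

lemma tcong_trans [trans]: "u \<simeq> v \<Longrightarrow> v \<simeq> w \<Longrightarrow> u \<simeq> w"
  using null_add[of "u - v" "v - w"] by (simp add: tcong_def)

lemma tcong_sum: "(\<And>i. i \<in> A \<Longrightarrow> f i \<simeq> g i) \<Longrightarrow> sum f A \<simeq> sum g A"
  unfolding tcong_def sum_subtractf[symmetric] by (rule null_sum)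

lemma tcong_null: "u \<simeq> v \<Longrightarrow> v \<in> tensor_null sX sY \<Longrightarrow> u \<in> tensor_null sX sY"
  using null_add[of "u - v" v] by (simp add: tcong_def)

lemma pure_add_left: "pure (a + a') b \<simeq> pure a b + pure a' b"
  unfolding tcong_def tensor_null_def diff_diff_eq[symmetric] by (intro pm.span_base) blast

lemma pure_add_right: "pure a (b + b') \<simeq> pure a b + pure a b'"
  unfolding tcong_def tensor_null_def diff_diff_eq[symmetric] by (intro pm.span_base) blast

lemma pure_scale_left: "pure (sX c a) b \<simeq> scale_pm c (pure a b)"
  unfolding tcong_def tensor_null_def by (intro pm.span_base) blast

lemma pure_scale_right: "pure a (sY c b) \<simeq> scale_pm c (pure a b)"
  unfolding tcong_def tensor_null_def by (intro pm.span_base) blast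

lemma pure_scale_move: "pure (sX c a) b \<simeq> pure a (sY c b)"
  by (rule tcong_trans[OF pure_scale_left tcong_sym[OF pure_scale_right]])

lemma pure_0_left: "pure 0 b \<in> tensor_null sX sY"
  using pure_scale_left[of 0 0 b] by (simp add: tcong_def)

lemma pure_0_right: "pure a 0 \<in> tensor_null sX sY"
  using pure_scale_right[of a 0 0] by (simp add: tcong_def)

lemma pure_sum_left: "pure (sum f A) b \<simeq> (\<Sum>i\<in>A. pure (f i) b)"
proof (induction A rule: infinite_finite_induct)
  case (insert i A)
  have "pure (f i + sum f A) b \<simeq> pure (f i) b + pure (sum f A) b" by (rule pure_add_left)
  also have "pure (f i) b + pure (sum f A) b \<simeq> pure (f i) b + (\<Sum>i\<in>A. pure (f i) b)"
    using insert.IH by (simp add: tcong_def)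
  finally show ?case using insert.hyps by simp
qed (simp_all add: tcong_def pure_0_left)

lemma pure_sum_right: "pure a (sum f A) \<simeq> (\<Sum>i\<in>A. pure a (f i))"
proof (induction A rule: infinite_finite_induct)
  case (insert i A)
  have "pure a (f i + sum f A) \<simeq> pure a (f i) + pure a (sum f A)" by (rule pure_add_right)
  also have "pure a (f i) + pure a (sum f A) \<simeq> pure a (f i) + (\<Sum>i\<in>A. pure a (f i))"
    using insert.IH by (simp add: tcong_def)
  finally show ?case using insert.hyps by simp
qed (simp_all add: tcong_def pure_0_right)

text \<open>Multiplication by a pure tensor carries each defining relation to a relation of the same
  kind. Pure right factors suffice, since every entry of \<open>eval_X\<close> and
  \<open>eval_Y\<close> is pure.\<close>

lemma tensor_mult_null:
  assumes "u \<in> tensor_null sX sY"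
  shows "tensor_mult u (pure a b) \<in> tensor_null sX sY"
proof -
  let ?m = "\<lambda>u. tensor_mult u (pure a b)"
  have add: "?m (u + v) = ?m u + ?m v" and scale: "?m (scale_pm c u) = scale_pm c (?m u)" for u v c
    by (simp_all add: tensor_mult_pure pm.lin_add pm.lin_scale_pm)
  have zero: "?m 0 = 0"
    by (simp add: tensor_mult_pure pm.lin_0)
  have diff: "?m (u - v) = ?m u - ?m v" for u v
    using add[of "u - v" v] by simp
  have "tensor_null sX sY \<subseteq> {u. ?m u \<in> tensor_null sX sY}"
    unfolding tensor_null_def[of sX sY]
  proof (rule pm.span_minimal, unfold tensor_null_def[of sX sY, symmetric])
    show "pm.subspace {u. ?m u \<in> tensor_null sX sY}"
      by (rule pm.subspaceI)
        (simp_all add: zero add scale null_0 null_add pm.subspace_scale[OF null_subspace])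
    have "?m (pure (x + x') y - pure x y - pure x' y) \<in> tensor_null sX sY" for x x' y
      using pure_add_left[of "x * a" "x' * a" "y * b", unfolded tcong_def]
      by (simp only: add diff tensor_mult_pure_pure distrib_right diff_diff_eq)
    moreover have "?m (pure x (y + y') - pure x y - pure x y') \<in> tensor_null sX sY" for x y y'
      using pure_add_right[of "x * a" "y * b" "y' * b", unfolded tcong_def]
      by (simp only: add diff tensor_mult_pure_pure distrib_right diff_diff_eq)
    moreover have "?m (pure (sX c x) y - scale_pm c (pure x y)) \<in> tensor_null sX sY" for c x y
      using pure_scale_left[of c "x * a" "y * b", unfolded tcong_def]
      by (simp only: diff scale tensor_mult_pure_pure X.scale_mult_left)
    moreover have "?m (pure x (sY c y) - scale_pm c (pure x y)) \<in> tensor_null sX sY" for c x y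
      using pure_scale_right[of "x * a" c "y * b", unfolded tcong_def]
      by (simp only: diff scale tensor_mult_pure_pure Y.scale_mult_left)
    ultimately show "{pure (a + a') b - pure a b - pure a' b | a a' b. True} \<union>
      {pure a (b + b') - pure a b - pure a b' | a b b'. True} \<union>
      {pure (sX c a) b - scale_pm c (pure a b) | c a b. True} \<union>
      {pure a (sY c b) - scale_pm c (pure a b) | c a b. True} \<subseteq> {u. ?m u \<in> tensor_null sX sY}"
      by (intro Un_least; blast)
  qed
  then show ?thesis using assms by blast
qed

lemma tensor_mult_tcong: "u \<simeq> v \<Longrightarrow> tensor_mult u (pure a b) \<simeq> tensor_mult v (pure a b)"
proof -
  assume "u \<simeq> v"
  then have "tensor_mult (u - v) (pure a b) \<in> tensor_null sX sY"
    unfolding tcong_def by (rule tensor_mult_null)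
  moreover have "tensor_mult (u - v) (pure a b) + tensor_mult v (pure a b) = tensor_mult u (pure a b)"
    by (simp add: tensor_mult_pure pm.lin_add[symmetric])
  ultimately show ?thesis unfolding tcong_def by (metis add_diff_cancel_right')
qed

text \<open>A representative can be nonzero although its tensor is zero. The formal sum omits such
  terms, and restoring finitely many of them does not change the class.\<close>

lemma graded_sum_tcong:
  assumes "finite I" "\<And>i. i \<notin> I \<Longrightarrow> U i n \<in> tensor_null sX sY"
  shows "graded_sum sX sY U n \<simeq> (\<Sum>i\<in>I. U i n)"
proof -
  let ?J = "{i. U i n \<notin> tensor_null sX sY}"
  have "?J \<subseteq> I" using assms(2) by blast
  then have "(\<Sum>i\<in>I. U i n) = graded_sum sX sY U n + (\<Sum>i\<in>I - ?J. U i n)"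
    unfolding graded_sum_def using assms(1) by (subst sum.subset_diff[of ?J]) (auto simp: add.commute)
  moreover have "(\<Sum>i\<in>I - ?J. U i n) \<in> tensor_null sX sY" by (rule null_sum) simp
  ultimately have "(\<Sum>i\<in>I. U i n) \<simeq> graded_sum sX sY U n" by (simp add: tcong_def)
  then show ?thesis by (rule tcong_sym)
qed

section \<open>Components of fixed bidegree\<close>

definition bipart :: "'f nsym \<Rightarrow> 'f qsym \<Rightarrow> nat \<Rightarrow> nat \<Rightarrow> ('f, 'a, 'b) free_tensor" where
  "bipart f g p q = pure (evX (hom_nsym p f)) (evY (hom_qsym q g))"

lemma bipart_null:
  assumes "hom_nsym p f = 0 \<or> hom_qsym q g = 0"
  shows "bipart f g p q \<in> tensor_null sX sY"
  using assms by (auto simp: bipart_def pure_0_left pure_0_right)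

text \<open>A normal form: one quasisymmetric function for each basis element H_\<sigma>. Two
  families for which these functions agree have congruent sums, so tensors are compared without any
  independence argument.\<close>

lemma bipart_expand:
  assumes "finite I"
  shows "(\<Sum>i\<in>I. bipart (f i) (g i) p q) \<simeq> (\<Sum>\<sigma> | csize \<sigma> = p. pure (evX (Poly_Mapping.single \<sigma> 1))
     (evY (\<Sum>i\<in>I. scale_qsym (Poly_Mapping.lookup (f i) \<sigma>) (hom_qsym q (g i)))))"
proof -
  let ?e = "\<lambda>\<sigma>. evX (Poly_Mapping.single \<sigma> 1)"
  let ?t = "\<lambda>i \<sigma>. pure (?e \<sigma>) (evY (scale_qsym (Poly_Mapping.lookup (f i) \<sigma>) (hom_qsym q (g i))))"
  have "bipart (f i) (g i) p q \<simeq> (\<Sum>\<sigma> | csize \<sigma> = p. ?t i \<sigma>)" for i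
  proof -
    have "bipart (f i) (g i) p q =
        pure (\<Sum>\<sigma> | csize \<sigma> = p. sX (Poly_Mapping.lookup (f i) \<sigma>) (?e \<sigma>)) (evY (hom_qsym q (g i)))"
      unfolding bipart_def hom_nsym_expand evX.sum evX.scale ..
    also have "\<dots> \<simeq> (\<Sum>\<sigma> | csize \<sigma> = p. pure (sX (Poly_Mapping.lookup (f i) \<sigma>) (?e \<sigma>)) (evY (hom_qsym q (g i))))"
      by (rule pure_sum_left)
    \<comment> \<open>The coefficients cross to the Y-factor, where the contributions of all
      \<open>i\<close> to the same \<open>\<sigma>\<close> can be added.\<close>
    also have "\<dots> \<simeq> (\<Sum>\<sigma> | csize \<sigma> = p. ?t i \<sigma>)"
      unfolding evY.scale by (intro tcong_sum pure_scale_move)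
    finally show ?thesis .
  qed
  then have "(\<Sum>i\<in>I. bipart (f i) (g i) p q) \<simeq> (\<Sum>i\<in>I. \<Sum>\<sigma> | csize \<sigma> = p. ?t i \<sigma>)"
    by (rule tcong_sum)
  also have "(\<Sum>i\<in>I. \<Sum>\<sigma> | csize \<sigma> = p. ?t i \<sigma>) = (\<Sum>\<sigma> | csize \<sigma> = p. \<Sum>i\<in>I. ?t i \<sigma>)"
    by (rule sum.swap)
  also have "\<dots> \<simeq> (\<Sum>\<sigma> | csize \<sigma> = p. pure (?e \<sigma>)
     (evY (\<Sum>i\<in>I. scale_qsym (Poly_Mapping.lookup (f i) \<sigma>) (hom_qsym q (g i)))))"
    unfolding evY.sum by (intro tcong_sum tcong_sym[OF pure_sum_right])
  finally show ?thesis .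
qed

lemma eval_X_eval_Y: "(eval_X evX f \<odot> eval_Y evY g) n = (\<Sum>i\<le>n. bipart f g i (n - i))"
  by (simp add: graded_mult_def eval_X_def eval_Y_def tensor_mult_pure_pure bipart_def)

lemma eval_Y_Y_X:
  "(eval_Y evY g \<odot> eval_Y evY h \<odot> eval_X evX f) n \<simeq> (\<Sum>k\<le>n. bipart f (g * h) (n - k) k)"
proof -
  have "(eval_Y evY g \<odot> eval_Y evY h \<odot> eval_X evX f) n =
    (\<Sum>k\<le>n. \<Sum>i\<le>k. pure (evX (hom_nsym (n - k) f)) (evY (hom_qsym i g * hom_qsym (k - i) h)))"
    by (simp add: graded_mult_def eval_X_def eval_Y_def tensor_mult_pure_pure tensor_mult_pure_sum evY_mult)
  also have "\<dots> \<simeq> (\<Sum>k\<le>n. bipart f (g * h) (n - k) k)"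
    unfolding bipart_def hom_qsym_mult evY.sum by (intro tcong_sum tcong_sym[OF pure_sum_right])
  finally show ?thesis .
qed

text \<open>Both sides run over triples of total \<open>n\<close>, grouped on the left by the last
  member and on the right by the middle one.\<close>

lemma sum_triples_reindex:
  fixes F :: "nat \<Rightarrow> nat \<Rightarrow> nat \<Rightarrow> 'z::comm_monoid_add"
  shows "(\<Sum>k\<le>n. \<Sum>i\<le>k. F i (k - i) (n - k)) = (\<Sum>q\<le>n. \<Sum>i\<le>n - q. F i q (n - q - i))"
proof -
  have "(\<Sum>k\<le>n. \<Sum>i\<le>k. F i (k - i) (n - k)) = (\<Sum>(k, i)\<in>(SIGMA k:{..n}. {..k}). F i (k - i) (n - k))"
    by (rule sum.Sigma) auto
  also have "\<dots> = (\<Sum>(q, i)\<in>(SIGMA q:{..n}. {..n - q}). F i q (n - q - i))"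
    by (rule sum.reindex_bij_witness[of _ "\<lambda>(q, i). (q + i, i)" "\<lambda>(k, i). (k - i, i)"]) auto
  also have "\<dots> = (\<Sum>q\<le>n. \<Sum>i\<le>n - q. F i q (n - q - i))"
    by (rule sum.Sigma[symmetric]) auto
  finally show ?thesis .
qed

lemma hom_schur_0: "csize \<alpha> \<noteq> k \<Longrightarrow> hom_qsym k (quasi_schur \<alpha> :: 'f qsym) = 0"
  by (rule qsym_eqI) (use mc_schur_size in \<open>force simp: mc_hom mc_0\<close>)

text \<open>Schur functions are homogeneous, so an \<open>\<alpha>\<close> of size above
  \<open>n\<close> has no component of Y-degree at most \<open>n\<close>.\<close>

lemma cauchy_eval:
  "(cauchy_NQ sX sY evX evY \<odot> eval_X evX f) n \<simeq>
    (\<Sum>q\<le>n. \<Sum>\<alpha> | csize \<alpha> \<le> n. bipart (nc_schur \<alpha> * f) (quasi_schur \<alpha>) (n - q) q)"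
proof -
  let ?A = "{\<alpha>. csize \<alpha> \<le> n}"
  let ?U = "\<lambda>\<alpha>. eval_X evX (nc_schur \<alpha>) \<odot> eval_Y evY (quasi_schur \<alpha> :: 'f qsym) :: ('f, 'a, 'b) graded_tensor"
  let ?F = "\<lambda>\<alpha> i q m. pure (evX (hom_nsym i (nc_schur \<alpha>) * hom_nsym m f)) (evY (hom_qsym q (quasi_schur \<alpha>)))
    :: ('f, 'a, 'b) free_tensor"
  have "cauchy_NQ sX sY evX evY k \<simeq> (\<Sum>\<alpha>\<in>?A. ?U \<alpha> k)" if "k \<le> n" for k
    unfolding cauchy_NQ_def
  proof (rule graded_sum_tcong)
    fix \<alpha> assume \<alpha>: "\<alpha> \<notin> ?A"
    show "?U \<alpha> k \<in> tensor_null sX sY"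
      unfolding eval_X_eval_Y using \<alpha> that by (intro null_sum bipart_null disjI2 hom_schur_0) auto
  qed (rule finite_csize_le)
  then have "(cauchy_NQ sX sY evX evY \<odot> eval_X evX f) n \<simeq>
      (\<Sum>k\<le>n. tensor_mult (\<Sum>\<alpha>\<in>?A. ?U \<alpha> k) (pure (evX (hom_nsym (n - k) f)) 1))"
    unfolding graded_mult_def[of _ "eval_X evX f"] eval_X_def[of evX f]
    by (intro tcong_sum tensor_mult_tcong) simp
  also have "\<dots> = (\<Sum>k\<le>n. \<Sum>\<alpha>\<in>?A. \<Sum>i\<le>k. ?F \<alpha> i (k - i) (n - k))"
    by (simp only: tensor_mult_pure_sum eval_X_eval_Y bipart_def tensor_mult_pure_pure evX_mult mult_1_right)
  also have "\<dots> = (\<Sum>\<alpha>\<in>?A. \<Sum>k\<le>n. \<Sum>i\<le>k. ?F \<alpha> i (k - i) (n - k))"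
    by (rule sum.swap)
  \<comment> \<open>With the Y-degree \<open>q\<close> fixed, the X-degrees of the two factors add
    up to \<open>n - q\<close> and recombine into one component of the noncommutative
    product.\<close>
  also have "\<dots> = (\<Sum>\<alpha>\<in>?A. \<Sum>q\<le>n. \<Sum>i\<le>n - q. ?F \<alpha> i q (n - q - i))"
    by (intro sum.cong[OF refl] sum_triples_reindex[where F = "?F \<alpha>" for \<alpha>])
  also have "\<dots> = (\<Sum>q\<le>n. \<Sum>\<alpha>\<in>?A. \<Sum>i\<le>n - q. ?F \<alpha> i q (n - q - i))"
    by (rule sum.swap)
  also have "\<dots> \<simeq> (\<Sum>q\<le>n. \<Sum>\<alpha>\<in>?A. bipart (nc_schur \<alpha> * f) (quasi_schur \<alpha>) (n - q) q)"
    unfolding bipart_def hom_nsym_mult evX.sum by (intro tcong_sum tcong_sym[OF pure_sum_left])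
  finally show ?thesis .
qed

text \<open>The bound on \<open>\<rho>\<close> comes from the grading: its size is the X-degree, at
  most \<open>n\<close>, plus the size of \<open>\<mu>\<close>, which is at most that of
  \<open>\<eta>\<close> when the antipode factor is nonzero.\<close>

lemma skew_sum_eval:
  "graded_sum sX sY (\<lambda>(\<rho>, \<mu>).
       eval_Y evY (antipode_qsym (skew_qsym \<eta> \<mu>)) \<odot> eval_Y evY (skew_qsym \<rho> la) \<odot>
       eval_X evX (skew_nsym \<rho> \<mu>)) n \<simeq>
    (\<Sum>q\<le>n. \<Sum>(\<rho>, \<mu>)\<in>{\<rho>. csize \<rho> \<le> n + csize \<eta>} \<times> {\<mu>. skew_qsym \<eta> \<mu> \<noteq> (0 :: 'f qsym)}.
       bipart (skew_nsym \<rho> \<mu>) (antipode_qsym (skew_qsym \<eta> \<mu>) * skew_qsym \<rho> la) (n - q) q)"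
proof -
  let ?I = "{\<rho>. csize \<rho> \<le> n + csize \<eta>} \<times> {\<mu>. skew_qsym \<eta> \<mu> \<noteq> (0 :: 'f qsym)}"
  let ?U = "\<lambda>(\<rho>, \<mu>). eval_Y evY (antipode_qsym (skew_qsym \<eta> \<mu>)) \<odot> eval_Y evY (skew_qsym \<rho> la) \<odot>
       eval_X evX (skew_nsym \<rho> \<mu>) :: ('f, 'a, 'b) graded_tensor"
  let ?b = "\<lambda>q (\<rho>, \<mu>). bipart (skew_nsym \<rho> \<mu>) (antipode_qsym (skew_qsym \<eta> \<mu>) * skew_qsym \<rho> la) (n - q) q"
  interpret S: Vector_Spaces.linear scale_qsym scale_qsym "antipode_qsym :: 'f qsym \<Rightarrow> 'f qsym"
    by (rule linear_antipode)
  have U: "?U i n \<simeq> (\<Sum>q\<le>n. ?b q i)" for i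
    using eval_Y_Y_X by (cases i) simp
  have "graded_sum sX sY ?U n \<simeq> (\<Sum>i\<in>?I. ?U i n)"
  proof (rule graded_sum_tcong)
    show "finite ?I" using finite_csize_le skew_qsym_finite by blast
    fix i assume i: "i \<notin> ?I"
    obtain \<rho> \<mu> where [simp]: "i = (\<rho>, \<mu>)" by fastforce
    have "?b q i \<in> tensor_null sX sY" if "q \<le> n" for q
    proof (cases "skew_qsym \<eta> \<mu> = (0 :: 'f qsym)")
      case True
      then show ?thesis by (simp add: bipart_null hom_qsym_0)
    next
      case False
      then have "csize \<mu> \<le> csize \<eta>" by (rule skew_qsym_index_size)
      moreover have "n + csize \<eta> < csize \<rho>" using i False by simp
      ultimately have "Poly_Mapping.lookup (hom_nsym (n - q) (skew_nsym \<rho> \<mu> :: 'f nsym)) \<sigma> = 0" for \<sigma>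
        using skew_nsym_size[of \<rho> \<mu> \<sigma>, where 'f = 'f]
        by (cases "Poly_Mapping.lookup (skew_nsym \<rho> \<mu> :: 'f nsym) \<sigma> = 0") (auto simp: lookup_hom_nsym)
      then have "hom_nsym (n - q) (skew_nsym \<rho> \<mu> :: 'f nsym) = 0" by (intro poly_mapping_eqI) simp
      then show ?thesis by (simp add: bipart_null)
    qed
    then have "(\<Sum>q\<le>n. ?b q i) \<in> tensor_null sX sY" by (intro null_sum) simp
    with U show "?U i n \<in> tensor_null sX sY" by (rule tcong_null)
  qed
  also have "\<dots> \<simeq> (\<Sum>i\<in>?I. \<Sum>q\<le>n. ?b q i)" by (intro tcong_sum U)
  also have "(\<Sum>i\<in>?I. \<Sum>q\<le>n. ?b q i) = (\<Sum>q\<le>n. \<Sum>i\<in>?I. ?b q i)" by (rule sum.swap)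
  finally show ?thesis .
qed

lemma cauchy_skew_identity:
  "graded_eq sX sY
    (cauchy_NQ sX sY evX evY \<odot> eval_X evX (skew_nsym la \<eta>))
    (graded_sum sX sY (\<lambda>(\<rho>, \<mu>).
       eval_Y evY (antipode_qsym (skew_qsym \<eta> \<mu>)) \<odot> eval_Y evY (skew_qsym \<rho> la) \<odot>
       eval_X evX (skew_nsym \<rho> \<mu>)))"
  unfolding graded_eq_def tcong_def[symmetric]
proof
  fix n
  let ?A = "{\<alpha>. csize \<alpha> \<le> n}"
  let ?R = "{\<rho>. csize \<rho> \<le> n + csize \<eta>}" and ?V = "{\<mu>. skew_qsym \<eta> \<mu> \<noteq> (0 :: 'f qsym)}"
  let ?f = "skew_nsym la \<eta> :: 'f nsym"
  let ?g = "\<lambda>\<rho> \<mu>. antipode_qsym (skew_qsym \<eta> \<mu>) * skew_qsym \<rho> la :: 'f qsym"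
  note cauchy_eval[of ?f n]
  also have "(\<Sum>q\<le>n. \<Sum>\<alpha>\<in>?A. bipart (nc_schur \<alpha> * ?f) (quasi_schur \<alpha>) (n - q) q) \<simeq>
      (\<Sum>q\<le>n. \<Sum>(\<rho>, \<mu>)\<in>?R \<times> ?V. bipart (skew_nsym \<rho> \<mu>) (?g \<rho> \<mu>) (n - q) q)"
  proof (rule tcong_sum)
    fix q
    have eq: "(\<Sum>\<alpha>\<in>?A. scale_qsym (Poly_Mapping.lookup (nc_schur \<alpha> * ?f) \<sigma>) (hom_qsym q (quasi_schur \<alpha>))) =
      (\<Sum>i\<in>?R \<times> ?V. scale_qsym (Poly_Mapping.lookup (skew_nsym (fst i) (snd i)) \<sigma>) (hom_qsym q (?g (fst i) (snd i))))"
      if \<sigma>: "csize \<sigma> = n - q" for \<sigma>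
    proof -
      \<comment> \<open>Pairing with this element reads the coefficient of H_\<sigma>, so the two
        operator identities, applied to it, compare the normal forms.\<close>
      let ?x = "monomial_qsym \<sigma> :: 'f qsym"
      have "(\<Sum>\<alpha>\<in>?A. scale_qsym (Poly_Mapping.lookup (nc_schur \<alpha> * ?f) \<sigma>) (hom_qsym q (quasi_schur \<alpha>))) =
         hom_qsym q (\<Sum>\<alpha>\<in>?A. scale_qsym (pairing (nc_schur \<alpha> * ?f) ?x) (quasi_schur \<alpha>))"
        unfolding pairing_monomial by (simp only: hom_qsym_sum hom_qsym_scale)
      also have "(\<Sum>\<alpha>\<in>?A. scale_qsym (pairing (nc_schur \<alpha> * ?f) ?x) (quasi_schur \<alpha>)) = rskew ?f ?x"
        by (rule cauchy_operator) (use \<sigma> in \<open>auto simp: mc_monomial split: if_splits\<close>)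
      \<comment> \<open>The size \<open>n - q\<close> of \<open>\<sigma>\<close> is at most
        \<open>n\<close>, so the cutoff \<open>n + csize \<eta>\<close> is large enough for the skew
        operator identity.\<close>
      also have "\<dots> = (\<Sum>\<mu>\<in>?V. \<Sum>\<rho>\<in>?R. scale_qsym (pairing (skew_nsym \<rho> \<mu>) ?x) (?g \<rho> \<mu>))"
        by (rule skew_operator[of _ "n - q", symmetric]) (use \<sigma> in \<open>auto simp: mc_monomial split: if_splits\<close>)
      also have "\<dots> = (\<Sum>\<rho>\<in>?R. \<Sum>\<mu>\<in>?V. scale_qsym (pairing (skew_nsym \<rho> \<mu>) ?x) (?g \<rho> \<mu>))"
        by (rule sum.swap)
      also have "hom_qsym q \<dots> = (\<Sum>i\<in>?R \<times> ?V. scale_qsym (Poly_Mapping.lookup (skew_nsym (fst i) (snd i)) \<sigma>) (hom_qsym q (?g (fst i) (snd i))))"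
        unfolding pairing_monomial hom_qsym_sum hom_qsym_scale sum.cartesian_product case_prod_unfold ..
      finally show ?thesis .
    qed
    have "(\<Sum>\<alpha>\<in>?A. bipart (nc_schur \<alpha> * ?f) (quasi_schur \<alpha>) (n - q) q) \<simeq>
       (\<Sum>\<sigma> | csize \<sigma> = n - q. pure (evX (Poly_Mapping.single \<sigma> 1))
         (evY (\<Sum>\<alpha>\<in>?A. scale_qsym (Poly_Mapping.lookup (nc_schur \<alpha> * ?f) \<sigma>) (hom_qsym q (quasi_schur \<alpha>)))))"
      by (rule bipart_expand) (rule finite_csize_le)
    also have "\<dots> = (\<Sum>\<sigma> | csize \<sigma> = n - q. pure (evX (Poly_Mapping.single \<sigma> 1))
         (evY (\<Sum>i\<in>?R \<times> ?V. scale_qsym (Poly_Mapping.lookup (skew_nsym (fst i) (snd i)) \<sigma>) (hom_qsym q (?g (fst i) (snd i))))))"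
      by (rule sum.cong[OF refl]) (simp only: mem_Collect_eq eq)
    also have "\<dots> \<simeq> (\<Sum>i\<in>?R \<times> ?V. bipart (skew_nsym (fst i) (snd i)) (?g (fst i) (snd i)) (n - q) q)"
      using finite_csize_le skew_qsym_finite by (intro tcong_sym[OF bipart_expand] finite_cartesian_product) blast+
    finally show "(\<Sum>\<alpha>\<in>?A. bipart (nc_schur \<alpha> * ?f) (quasi_schur \<alpha>) (n - q) q) \<simeq>
      (\<Sum>(\<rho>, \<mu>)\<in>?R \<times> ?V. bipart (skew_nsym \<rho> \<mu>) (?g \<rho> \<mu>) (n - q) q)"
      unfolding case_prod_unfold .
  qed
  also note tcong_sym[OF skew_sum_eval]
  finally show "(cauchy_NQ sX sY evX evY \<odot> eval_X evX ?f) n \<simeq>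
      graded_sum sX sY (\<lambda>(\<rho>, \<mu>).
       eval_Y evY (antipode_qsym (skew_qsym \<eta> \<mu>)) \<odot> eval_Y evY (skew_qsym \<rho> la) \<odot>
       eval_X evX (skew_nsym \<rho> \<mu>)) n" .
qed

end

theorem theorem5p1:
  fixes sX :: "'f::field_char_0 \<Rightarrow> 'a::{comm_ring, comm_monoid_mult} \<Rightarrow> 'a"
    and sY :: "'f \<Rightarrow> 'b::{comm_ring, comm_monoid_mult} \<Rightarrow> 'b"
    and evX :: "'f nsym \<Rightarrow> 'a"
    and evY :: "'f qsym \<Rightarrow> 'b"
    and la \<eta> :: comp
  assumes "comm_algebra sX"
    and "comm_algebra sY"
    and "algebra_morphism scale_pm sX evX"
    and "algebra_morphism scale_qsym sY evY"
  shows "graded_eq sX sY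
    (cauchy_NQ sX sY evX evY \<odot> eval_X evX (skew_nsym la \<eta>))
    (graded_sum sX sY (\<lambda>(\<rho>, \<mu>).
       eval_Y evY (antipode_qsym (skew_qsym \<eta> \<mu>)) \<odot> eval_Y evY (skew_qsym \<rho> la) \<odot>
       eval_X evX (skew_nsym \<rho> \<mu>)))"
  using assms by (rule cauchy_skew_identity)

end
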